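(* Let $G$ be a (finite) peak group with a peak character $\psi$. Then $G$ is solvable provided that one of the following is true: (a) $\deg(\psi)=p^{n}q^{m}$, where $p$ and $q$ are distinct prime numbers and $n,m\in \mathbb{Z}_{\geq 0}$; (b) $\deg(\psi)=p_{1}^{n_{1}}p_{2}^{n_{2}}p_{3}^{n_{3}}$, where $p_{1},p_{2},p_{3}$ are distinct prime numbers and $n_{1},n_{2},n_{3}$ are positive integers, and $G$ has a normal $p_{i}$-complement for some $i\in \{1,2,3\}$; (b') $\deg(\psi)=p_{1}^{n_{1}}p_{2}^{n_{2}}p_{3}^{n_{3}}$, where $p_{1},p_{2},p_{3}$ are distinct prime numbers and $n_{1},n_{2},n_{3}$ are positive integers, and there exists $i\in \{1,2,3\}$ such that $p_{i}\mid \deg(\chi)$ for every nonlinear irreducible character $\chi$ of $G$.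
   Context: Let $K$ be an algebraically closed field of characteristic $0$; characters are over $K$. For a finite group $G$, let $\mathbf{d}(G)$ be the set of degrees of the irreducible characters of $G$. $G$ is a peak group if $\mathbf{d}(G)$ has a greatest element $d$ with respect to divisibility, i.e. there is $d\in\mathbf{d}(G)$ such that every element of $\mathbf{d}(G)$ divides $d$; an irreducible character $\psi$ of $G$ with $\deg(\psi)=d$ is then called a peak character. A character is nonlinear if its degree is greater than $1$. For a prime $p$, $G$ has a normal $p$-complement if there is a normal subgroup $N$ of $G$ with $p\nmid |N|$ and $[G:N]=p^{k}$ for some positive integer $k$. *)

theory Defs
  imports
    "HOL-Algebra.Solvable_Groups"
    "HOL-Computational_Algebra.Primes"
    "HOL-Computational_Algebra.Polynomial"
    "Jordan_Normal_Form.VS_Connect"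
begin

abbreviation GL :: "'k::field itself \<Rightarrow> nat \<Rightarrow> 'k mat monoid" where
  "GL K n \<equiv> units_of (ring_mat K n ())"

definition irreducible_rep ::
    "('a, 'b) monoid_scheme \<Rightarrow> nat \<Rightarrow> ('a \<Rightarrow> 'k::field mat) \<Rightarrow> bool" where
  "irreducible_rep G n \<rho> \<longleftrightarrow>
     0 < n \<and> \<rho> \<in> hom G (GL TYPE('k) n) \<and>
     (\<forall>W. VectorSpace.subspace class_ring W (module_vec TYPE('k) n) \<longrightarrow>
          (\<forall>g\<in>carrier G. \<forall>w\<in>W. \<rho> g *\<^sub>v w \<in> W) \<longrightarrow>
          W = {0\<^sub>v n} \<or> W = carrier_vec n)"

definition mat_trace :: "'k::comm_monoid_add mat \<Rightarrow> 'k" where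
  "mat_trace A = (\<Sum>i<dim_row A. A $$ (i, i))"

(* Characters are made extensional, so that two of them are equal
   exactly when they agree on the group. *)
definition rep_character ::
    "('a, 'b) monoid_scheme \<Rightarrow> ('a \<Rightarrow> 'k::field mat) \<Rightarrow> 'a \<Rightarrow> 'k" where
  "rep_character G \<rho> = (\<lambda>g\<in>carrier G. mat_trace (\<rho> g))"

definition irr_chars :: "('a, 'b) monoid_scheme \<Rightarrow> ('a \<Rightarrow> 'k::field) set" where
  "irr_chars G = {rep_character G \<rho> |n \<rho>. irreducible_rep G n \<rho>}"

(* The value at the identity, read as a natural number: it is the dimension of any
   representation affording the character (rep_character_degree below). *)
definition char_degree ::
    "('a, 'b) monoid_scheme \<Rightarrow> ('a \<Rightarrow> 'k::field_char_0) \<Rightarrow> nat" where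
  "char_degree G \<chi> = (THE d. of_nat d = \<chi> \<one>\<^bsub>G\<^esub>)"

definition char_degrees ::
    "'k::field_char_0 itself \<Rightarrow> ('a, 'b) monoid_scheme \<Rightarrow> nat set" where
  "char_degrees K G = char_degree G ` (irr_chars G :: ('a \<Rightarrow> 'k) set)"

definition peak_degree ::
    "'k::field_char_0 itself \<Rightarrow> ('a, 'b) monoid_scheme \<Rightarrow> nat \<Rightarrow> bool" where
  "peak_degree K G d \<longleftrightarrow> d \<in> char_degrees K G \<and> (\<forall>e\<in>char_degrees K G. e dvd d)"

definition peak_group ::
    "'k::field_char_0 itself \<Rightarrow> ('a, 'b) monoid_scheme \<Rightarrow> bool" where
  "peak_group K G \<longleftrightarrow> (\<exists>d. peak_degree K G d)"

definition peak_character ::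
    "('a, 'b) monoid_scheme \<Rightarrow> ('a \<Rightarrow> 'k::field_char_0) \<Rightarrow> bool" where
  "peak_character G \<psi> \<longleftrightarrow>
     \<psi> \<in> irr_chars G \<and> peak_degree TYPE('k) G (char_degree G \<psi>)"

definition nonlinear_char ::
    "('a, 'b) monoid_scheme \<Rightarrow> ('a \<Rightarrow> 'k::field_char_0) \<Rightarrow> bool" where
  "nonlinear_char G \<chi> \<longleftrightarrow> char_degree G \<chi> > 1"

(* The index is required to be a nontrivial power of p. *)
definition has_normal_complement ::
    "('a, 'b) monoid_scheme \<Rightarrow> nat \<Rightarrow> bool" where
  "has_normal_complement G p \<longleftrightarrow>
     (\<exists>N. N \<lhd> G \<and> \<not> p dvd card N \<and> (\<exists>k>0. card (rcosets\<^bsub>G\<^esub> N) = p ^ k))"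

lemma rep_character_degree:
  fixes \<rho> :: "'a \<Rightarrow> 'k::field_char_0 mat"
  assumes "group G" "irreducible_rep G n \<rho>"
  shows "char_degree G (rep_character G \<rho>) = n"
proof -
  interpret group G by fact
  have m: "monoid (ring_mat TYPE('k) n ())"
    using ring_mat[of n "()", where ?'a='k] by (rule ring.axioms)
  interpret GLn: group "GL TYPE('k) n"
    by (rule monoid.units_group[OF m])
  have "\<rho> \<in> hom G (GL TYPE('k) n)"
    using assms(2) by (simp add: irreducible_rep_def)
  then have "\<rho> \<one>\<^bsub>G\<^esub> = 1\<^sub>m n"
    using hom_one[OF _ assms(1) GLn.is_group] by (simp add: units_of_def ring_mat_simps)
  then show ?thesis
    by (simp add: char_degree_def rep_character_def mat_trace_def)
qed

end

theory Submission
  imports Defs "Jordan_Normal_Form.Char_Poly" "HOL-Algebra.Group_Action" "HOL-Algebra.Sylow"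
    "HOL-Algebra.Multiplicative_Group"
begin

text \<open>
  Everything reduces to: if only two primes \<open>p\<close>, \<open>q\<close> divide degrees of irreducible
  characters of \<open>G\<close>, then \<open>G\<close> is solvable. By Clifford theory the hypothesis passes to normal
  subgroups and quotients, so it is enough to exclude nonabelian simple \<open>G\<close>. Choose \<open>x\<close> of order
  \<open>p\<close> and \<open>y\<close> of order \<open>q\<close>, each centralised by a Sylow subgroup. If \<open>p\<close> divides \<open>\<chi>(1)\<close>, then
  \<open>\<chi>(x)/p\<close> is an algebraic integer; if \<open>\<chi>(1)\<close> is a power of \<open>p\<close> and \<open>\<chi>\<close> is nontrivial, then
  \<open>\<chi>(x) = 0\<close> by simplicity; similarly for \<open>q\<close> and \<open>y\<close>. Column orthogonality for \<open>x\<close> and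
  \<open>y\<close> then exhibits \<open>-1/p\<close> as an algebraic integer, a contradiction. (A prime not dividing
  \<open>|G|\<close> divides no degree, and the corresponding element is replaced by an arbitrary one.)

  In (b), the degrees of the normal \<open>p\<close>-complement involve only the other two primes, and the
  quotient is a \<open>p\<close>-group. Case (b') follows from (b) by Thompson's theorem: let \<open>N\<close> be the smallest
  normal subgroup of \<open>p\<close>-power index. An invariant irreducible character of \<open>N\<close> whose degree
  is prime to \<open>p\<close> extends to \<open>G\<close>, hence is linear, and the invariant linear characters form a
  group of order prime to \<open>p\<close>. Counting fixed points of \<open>G\<close> in the sum of the squared degrees of
  \<open>N\<close> shows that \<open>p\<close> does not divide \<open>|N|\<close>.
\<close>

section \<open>Algebraic integers\<close>

text \<open>Over an arbitrary algebraically closed field of characteristic 0 there is no complex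
  conjugation or absolute value, so the vanishing \<open>\<chi>(x) = 0\<close> is obtained by
  arithmetic. For a matrix of order \<open>p\<close> the traces of the eigenprojections are natural
  numbers. If \<open>p ^ a\<close> is the degree and divides all traces of proper powers as an
  algebraic integer, these multiplicities are congruent modulo \<open>p ^ a\<close>: either one of
  them is \<open>p ^ a\<close> and the matrix is scalar, or all are equal and the trace is a
  multiple of \<open>1 + z + ... + z ^ (p - 1) = 0\<close>. This is why \<open>x\<close> and
  \<open>y\<close> have prime order. The centralising Sylow subgroup \<open>P\<close> has index
  prime to \<open>p\<close>, so integrality of \<open>|G : P| \<chi>(x) / \<chi>(1)\<close> moves
  the whole \<open>p\<close>-part of \<open>\<chi>(1)\<close> into \<open>\<chi>(x)\<close>. For the
  extension step behind Thompson's theorem, intertwiners are normalised to determinant 1. The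
  resulting cocycle then consists of roots of unity whose order is prime to the index, because the
  determinants on \<open>N\<close> have order prime to \<open>p\<close>; such a cocycle is a
  coboundary.\<close>

lemma algebraic_int_eigenvalue_mat:
  fixes A :: "int mat" and x :: "'k::field_char_0"
  assumes A: "A \<in> carrier_mat n n" and v: "v \<in> carrier_vec n" "v \<noteq> 0\<^sub>v n"
    and ev: "map_mat of_int A *\<^sub>v v = x \<cdot>\<^sub>v v"
  shows "algebraic_int x"
proof -
  have A': "map_mat of_int A \<in> carrier_mat n n" using A by simp
  have "eigenvalue (map_mat of_int A) x"
    unfolding eigenvalue_def eigenvector_def using A v ev by auto
  then have r: "poly (char_poly (map_mat of_int A)) x = 0"
    using eigenvalue_root_char_poly[OF A', of x] by blast
  have "char_poly (map_mat of_int A :: 'k mat) = map_poly of_int (char_poly A)"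
    by (rule of_int_hom.char_poly_hom[OF A])
  moreover have "monic (char_poly A)" using degree_monic_char_poly[OF A] by simp
  ultimately show ?thesis
    using r algebraic_int_altdef_ipoly[of x] by auto
qed

text \<open>Multiplication by \<open>x\<close> maps the integer span of the finitely many
  \<open>v i\<close> into itself, so the \<open>v i\<close> form an eigenvector of an integer
  matrix; one nonzero entry makes it a genuine one. Closure under sums and products and the
  integrality of central characters all go through this criterion.\<close>

lemma algebraic_int_eigenvalue:
  fixes c :: "'i \<Rightarrow> 'i \<Rightarrow> int" and v :: "'i \<Rightarrow> 'k::field_char_0"
  assumes fin: "finite S" and s: "s \<in> S" "v s \<noteq> 0"
    and ev: "\<And>i. i \<in> S \<Longrightarrow> x * v i = (\<Sum>j\<in>S. of_int (c i j) * v j)"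
  shows "algebraic_int x"
proof -
  define n where "n = card S"
  obtain e where e: "bij_betw e {0..<n} S"
    using ex_bij_betw_nat_finite[OF fin] n_def by blast
  define A where "A = mat n n (\<lambda>(i,j). c (e i) (e j))"
  define w where "w = vec n (\<lambda>i. v (e i))"
  have A: "A \<in> carrier_mat n n" by (simp add: A_def)
  have w: "w \<in> carrier_vec n" by (simp add: w_def)
  obtain k where k: "k < n" "e k = s"
    using e s(1) by (auto simp: bij_betw_def)
  have "w \<noteq> 0\<^sub>v n"
  proof
    assume "w = 0\<^sub>v n"
    then have "w $ k = 0" using k by simp
    then show False using k s by (simp add: w_def)
  qed
  moreover have "map_mat of_int A *\<^sub>v w = x \<cdot>\<^sub>v w"
  proof (rule eq_vecI)
    fix i assume "i < dim_vec (x \<cdot>\<^sub>v w)"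
    then have i: "i < n" using w by simp
    then have ei: "e i \<in> S" using e by (auto simp: bij_betw_def)
    have "(map_mat of_int A *\<^sub>v w) $ i = (\<Sum>j\<in>{0..<n}. of_int (c (e i) (e j)) * v (e j))"
      using i by (simp add: A_def w_def scalar_prod_def)
    also have "\<dots> = (\<Sum>j\<in>S. of_int (c (e i) j) * v j)"
      by (rule sum.reindex_bij_betw[OF e])
    also have "\<dots> = x * v (e i)" using ev[OF ei] by simp
    finally show "(map_mat of_int A *\<^sub>v w) $ i = (x \<cdot>\<^sub>v w) $ i"
      using i by (simp add: w_def)
  qed (use A w in auto)
  ultimately show ?thesis
    using algebraic_int_eigenvalue_mat[OF A w] by blast
qed

lemma algebraic_int_power_basis:
  fixes x :: "'k::field_char_0"
  assumes "algebraic_int x"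
  obtains d :: nat and c :: "nat \<Rightarrow> nat \<Rightarrow> int" where "d > 0"
    "\<And>i. i < d \<Longrightarrow> x * x ^ i = (\<Sum>j<d. of_int (c i j) * x ^ j)"
proof -
  obtain p :: "int poly" where p: "poly (map_poly of_int p) x = 0" "lead_coeff p = 1"
    using assms algebraic_int_altdef_ipoly by blast
  define d where "d = Polynomial.degree p"
  have "poly (map_poly of_int p) x = (\<Sum>i\<le>d. of_int (Polynomial.coeff p i) * x ^ i)"
    by (simp add: poly_altdef d_def degree_map_poly coeff_map_poly)
  also have "\<dots> = x ^ d + (\<Sum>i<d. of_int (Polynomial.coeff p i) * x ^ i)"
    using p(2) by (simp add: d_def lessThan_Suc_atMost[symmetric] del: lessThan_Suc_atMost)
  finally have xd: "x ^ d = (\<Sum>i<d. of_int (- Polynomial.coeff p i) * x ^ i)"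
    using p(1) by (simp add: sum_negf eq_neg_iff_add_eq_0)
  \<comment> \<open>For \<open>d = 0\<close> the relation \<open>xd\<close> would read
    \<open>1 = 0\<close>.\<close>
  have d0: "d > 0"
  proof (rule ccontr)
    assume "\<not> d > 0"
    then show False using xd by simp
  qed
  \<comment> \<open>The companion matrix: every row shifts the exponent by one, except the last,
    which uses the monic relation.\<close>
  define c where "c = (\<lambda>i j. if i = d - 1 then - Polynomial.coeff p j else if j = Suc i then 1 else (0::int))"
  have "x * x ^ i = (\<Sum>j<d. of_int (c i j) * x ^ j)" if "i < d" for i
  proof (cases "i = d - 1")
    case True
    have "x * x ^ i = x ^ d" using True d0 by (metis Suc_diff_1 power_Suc)
    then show ?thesis using xd True by (simp add: c_def)
  next
    case False
    then have "(\<Sum>j<d. of_int (c i j) * x ^ j) = (\<Sum>j<d. if j = Suc i then x ^ j else 0)"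
      by (intro sum.cong) (auto simp: c_def)
    also have "\<dots> = x ^ Suc i"
    proof -
      have "Suc i \<in> {..<d}" using that False by auto
      then show ?thesis by (subst sum.delta) auto
    qed
    finally show ?thesis by simp
  qed
  then show ?thesis using that d0 by blast
qed

text \<open>The monomials \<open>x ^ i * y ^ j\<close> with exponents below the two degrees span a
  module stable under both numbers at once, and the monomial at \<open>(0, 0)\<close> is 1. Sum and
  product then act on it by the sum and the product of the two integer matrices.\<close>

lemma algebraic_int_common_module:
  fixes x y :: "'k::field_char_0"
  assumes "algebraic_int x" "algebraic_int y"
  obtains S :: "(nat \<times> nat) set" and v s
      and a b :: "nat \<times> nat \<Rightarrow> nat \<times> nat \<Rightarrow> int" where "finite S" "s \<in> S" "v s \<noteq> (0::'k)"
    "\<And>i. i \<in> S \<Longrightarrow> x * v i = (\<Sum>j\<in>S. of_int (a i j) * v j)"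
    "\<And>i. i \<in> S \<Longrightarrow> y * v i = (\<Sum>j\<in>S. of_int (b i j) * v j)"
proof -
  obtain d c where d: "d > (0::nat)"
    and c: "\<And>i. i < d \<Longrightarrow> x * x ^ i = (\<Sum>j<d. of_int (c i j) * x ^ j)"
    by (rule algebraic_int_power_basis[OF assms(1)]) (rule that)
  obtain d' c' where d': "d' > (0::nat)"
    and c': "\<And>i. i < d' \<Longrightarrow> y * y ^ i = (\<Sum>j<d'. of_int (c' i j) * y ^ j)"
    by (rule algebraic_int_power_basis[OF assms(2)]) (rule that)
  define S where "S = {..<d} \<times> {..<d'}"
  define v where "v = (\<lambda>(i,j). x ^ i * y ^ j)"
  define a where "a = (\<lambda>(i,i'::nat) (j,j'). if j' = i' then c i j else (0::int))"
  define b where "b = (\<lambda>(i::nat,i') (j,j'). if j = i then c' i' j' else (0::int))"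
  have "x * v i = (\<Sum>j\<in>S. of_int (a i j) * v j)" if "i \<in> S" for i
  proof -
    obtain i1 i2 where i: "i = (i1, i2)" "i1 < d" "i2 < d'"
      using \<open>i \<in> S\<close> unfolding S_def by blast
    have "(\<Sum>j\<in>S. of_int (a i j) * v j) =
        (\<Sum>j<d. \<Sum>j'<d'. if j' = i2 then of_int (c i1 j) * (x ^ j * y ^ j') else 0)"
      unfolding S_def sum.cartesian_product
      by (intro sum.cong) (auto simp: a_def v_def i)
    also have "\<dots> = (\<Sum>j<d. of_int (c i1 j) * x ^ j) * y ^ i2"
      using i by (simp add: sum_distrib_right mult.assoc)
    finally show ?thesis using c[OF i(2)] i by (simp add: v_def mult.assoc)
  qed
  moreover have "y * v i = (\<Sum>j\<in>S. of_int (b i j) * v j)" if "i \<in> S" for i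
  proof -
    obtain i1 i2 where i: "i = (i1, i2)" "i1 < d" "i2 < d'"
      using \<open>i \<in> S\<close> unfolding S_def by blast
    have "(\<Sum>j\<in>S. of_int (b i j) * v j) =
        (\<Sum>j<d. \<Sum>j'<d'. if j = i1 then of_int (c' i2 j') * (x ^ j * y ^ j') else 0)"
      unfolding S_def sum.cartesian_product
      by (intro sum.cong) (auto simp: b_def v_def i)
    also have "\<dots> = (\<Sum>j'<d'. \<Sum>j<d. if j = i1 then of_int (c' i2 j') * (x ^ j * y ^ j') else 0)"
      by (rule sum.swap)
    also have "\<dots> = x ^ i1 * (\<Sum>j'<d'. of_int (c' i2 j') * y ^ j')"
      using i by (simp add: sum_distrib_left mult_ac)
    finally show ?thesis using c'[OF i(3)] i by (simp add: v_def mult_ac)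
  qed
  moreover have "finite S" "(0,0) \<in> S" "v (0,0) \<noteq> 0"
    using d d' by (auto simp: S_def v_def)
  ultimately show ?thesis using that by blast
qed

lemma algebraic_int_add:
  fixes x y :: "'k::field_char_0"
  assumes "algebraic_int x" "algebraic_int y"
  shows "algebraic_int (x + y)"
proof -
  obtain S :: "(nat \<times> nat) set" and v s a b where *: "finite S" "s \<in> S" "v s \<noteq> (0::'k)"
    "\<And>i. i \<in> S \<Longrightarrow> x * v i = (\<Sum>j\<in>S. of_int (a i j) * v j)"
    "\<And>i. i \<in> S \<Longrightarrow> y * v i = (\<Sum>j\<in>S. of_int (b i j) * v j)"
    by (rule algebraic_int_common_module[OF assms]) (rule that)
  show ?thesis
    by (rule algebraic_int_eigenvalue[where S=S and s=s and v=v, OF *(1-3), where c="\<lambda>i j. a i j + b i j"])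
       (simp add: *(4,5) distrib_right sum.distrib)
qed

lemma algebraic_int_mult:
  fixes x y :: "'k::field_char_0"
  assumes "algebraic_int x" "algebraic_int y"
  shows "algebraic_int (x * y)"
proof -
  obtain S :: "(nat \<times> nat) set" and v s a b where *: "finite S" "s \<in> S" "v s \<noteq> (0::'k)"
    "\<And>i. i \<in> S \<Longrightarrow> x * v i = (\<Sum>j\<in>S. of_int (a i j) * v j)"
    "\<And>i. i \<in> S \<Longrightarrow> y * v i = (\<Sum>j\<in>S. of_int (b i j) * v j)"
    by (rule algebraic_int_common_module[OF assms]) (rule that)
  show ?thesis
  proof (rule algebraic_int_eigenvalue[where S=S and s=s and v=v, OF *(1-3), where c="\<lambda>i k. \<Sum>j\<in>S. b i j * a j k"])
    fix i assume i: "i \<in> S"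
    have "x * y * v i = (\<Sum>j\<in>S. of_int (b i j) * (x * v j))"
      using *(5)[OF i] by (simp add: mult.assoc sum_distrib_left mult.left_commute)
    also have "\<dots> = (\<Sum>j\<in>S. \<Sum>k\<in>S. of_int (b i j * a j k) * v k)"
      by (intro sum.cong) (simp_all add: *(4) sum_distrib_left mult.assoc)
    also have "\<dots> = (\<Sum>k\<in>S. of_int (\<Sum>j\<in>S. b i j * a j k) * v k)"
      by (subst sum.swap) (simp add: sum_distrib_right)
    finally show "x * y * v i = (\<Sum>k\<in>S. of_int (\<Sum>j\<in>S. b i j * a j k) * v k)" .
  qed
qed

lemma algebraic_int_power:
  fixes x :: "'k::field_char_0"
  shows "algebraic_int x \<Longrightarrow> algebraic_int (x ^ n)"
  by (induction n) (auto intro: algebraic_int_mult)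

lemma algebraic_int_diff:
  fixes x y :: "'k::field_char_0"
  assumes "algebraic_int x" "algebraic_int y"
  shows "algebraic_int (x - y)"
  using algebraic_int_add[OF assms(1), of "- y"] assms(2) by auto

lemma algebraic_int_sum:
  fixes f :: "'i \<Rightarrow> 'k::field_char_0"
  assumes "\<And>i. i \<in> S \<Longrightarrow> algebraic_int (f i)"
  shows "algebraic_int (sum f S)"
  using assms by (induction S rule: infinite_finite_induct) (auto intro: algebraic_int_add)

lemma algebraic_int_root_of_unity:
  fixes x :: "'k::field_char_0"
  assumes "x ^ n = 1" "n > 0"
  shows "algebraic_int x"
proof (rule algebraic_int.intros)
  have "Polynomial.degree (Polynomial.monom 1 n - 1 :: 'k poly) = n"
    using assms(2) degree_add_eq_left[of "- 1" "Polynomial.monom 1 n :: 'k poly"]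
    by (simp add: degree_monom_eq)
  then show "lead_coeff (Polynomial.monom 1 n - 1 :: 'k poly) = 1"
    using assms(2) by (simp add: coeff_1)
  show "\<forall>i. Polynomial.coeff (Polynomial.monom 1 n - 1 :: 'k poly) i \<in> \<int>"
    by (auto simp: coeff_monom coeff_1)
  show "poly (Polynomial.monom 1 n - 1) x = 0"
    using assms by (simp add: poly_monom)
qed

text \<open>Here integrality turns into divisibility: a rational algebraic integer is an
  integer.\<close>

lemma algebraic_int_of_nat_divide:
  assumes "algebraic_int (of_nat a / of_nat b :: 'k::field_char_0)" "b > 0"
  shows "b dvd a"
proof -
  have "(of_nat a / of_nat b :: 'k) \<in> \<int>"
    using rational_algebraic_int_is_int[OF assms(1)] by simp
  then obtain z where z: "(of_nat a / of_nat b :: 'k) = of_int z" by (auto elim: Ints_cases)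
  then have "(of_int (int a) :: 'k) = of_int (int b * z)"
    using assms(2) by (simp add: field_simps)
  then have "int a = int b * z" using of_int_eq_iff by blast
  then show ?thesis by (metis dvd_triv_left int_dvd_int_iff)
qed

lemma algebraic_int_of_int_divide:
  assumes "algebraic_int (of_int a / of_nat b :: 'k::field_char_0)" "b > 0"
  shows "int b dvd a"
proof -
  have "(of_int a / of_nat b :: 'k) \<in> \<int>"
    using rational_algebraic_int_is_int[OF assms(1)] by simp
  then obtain z where z: "(of_int a / of_nat b :: 'k) = of_int z" by (auto elim: Ints_cases)
  then have "(of_int a :: 'k) = of_int (int b * z)"
    using assms(2) by (simp add: field_simps)
  then have "a = int b * z" using of_int_eq_iff by blast
  then show ?thesis by simp
qed

section \<open>Sums and traces of matrices, idempotents\<close>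

text \<open>The dimensions are explicit so that the empty sum is a zero matrix of the right
  size.\<close>

definition msum :: "nat \<Rightarrow> nat \<Rightarrow> ('i \<Rightarrow> 'k::comm_ring_1 mat) \<Rightarrow> 'i set \<Rightarrow> 'k mat" where
  "msum n m f S = mat n m (\<lambda>(i, j). \<Sum>s\<in>S. f s $$ (i, j))"

lemma msum_carrier [simp]: "msum n m f S \<in> carrier_mat n m"
  by (simp add: msum_def)

lemma msum_dim [simp]: "dim_row (msum n m f S) = n" "dim_col (msum n m f S) = m"
  by (simp_all add: msum_def)

lemma msum_index [simp]:
  "i < n \<Longrightarrow> j < m \<Longrightarrow> msum n m f S $$ (i, j) = (\<Sum>s\<in>S. f s $$ (i, j))"
  by (simp add: msum_def)

lemma msum_cong:
  "S = T \<Longrightarrow> (\<And>s. s \<in> T \<Longrightarrow> f s = g s) \<Longrightarrow> msum n m f S = msum n m g T"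
  by (auto simp: msum_def intro!: arg_cong[where f="mat n m"] sum.cong)

lemma msum_reindex:
  assumes "bij_betw h S T"
  shows "msum n m f T = msum n m (\<lambda>s. f (h s)) S"
  by (rule eq_matI) (auto simp: sum.reindex_bij_betw[OF assms, symmetric])

lemma mult_msum:
  assumes A: "A \<in> carrier_mat l n" and f: "\<And>s. s \<in> S \<Longrightarrow> f s \<in> carrier_mat n m"
  shows "A * msum n m f S = msum l m (\<lambda>s. A * f s) S"
proof (rule eq_matI)
  fix i j assume "i < dim_row (msum l m (\<lambda>s. A * f s) S)" "j < dim_col (msum l m (\<lambda>s. A * f s) S)"
  then have ij: "i < l" "j < m" by auto
  have "(A * msum n m f S) $$ (i, j) = (\<Sum>k = 0..<n. A $$ (i, k) * (\<Sum>s\<in>S. f s $$ (k, j)))"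
    using ij A by (simp add: scalar_prod_def)
  also have "\<dots> = (\<Sum>s\<in>S. \<Sum>k = 0..<n. A $$ (i, k) * f s $$ (k, j))"
    by (simp add: sum_distrib_left sum.swap[of _ S])
  also have "\<dots> = (\<Sum>s\<in>S. (A * f s) $$ (i, j))"
  proof (rule sum.cong[OF refl])
    fix s assume "s \<in> S"
    from f[OF this] show "(\<Sum>k = 0..<n. A $$ (i, k) * f s $$ (k, j)) = (A * f s) $$ (i, j)"
      using ij A by (simp add: scalar_prod_def)
  qed
  finally show "(A * msum n m f S) $$ (i, j) = msum l m (\<lambda>s. A * f s) S $$ (i, j)"
    using ij by simp
qed (use A in auto)

lemma msum_mult:
  assumes A: "A \<in> carrier_mat m l" and f: "\<And>s. s \<in> S \<Longrightarrow> f s \<in> carrier_mat n m"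
  shows "msum n m f S * A = msum n l (\<lambda>s. f s * A) S"
proof (rule eq_matI)
  fix i j assume "i < dim_row (msum n l (\<lambda>s. f s * A) S)" "j < dim_col (msum n l (\<lambda>s. f s * A) S)"
  then have ij: "i < n" "j < l" by auto
  have "(msum n m f S * A) $$ (i, j) = (\<Sum>k = 0..<m. (\<Sum>s\<in>S. f s $$ (i, k)) * A $$ (k, j))"
    using ij A by (simp add: scalar_prod_def)
  also have "\<dots> = (\<Sum>s\<in>S. \<Sum>k = 0..<m. f s $$ (i, k) * A $$ (k, j))"
    by (simp add: sum_distrib_right sum.swap[of _ S])
  also have "\<dots> = (\<Sum>s\<in>S. (f s * A) $$ (i, j))"
  proof (rule sum.cong[OF refl])
    fix s assume "s \<in> S"
    from f[OF this] show "(\<Sum>k = 0..<m. f s $$ (i, k) * A $$ (k, j)) = (f s * A) $$ (i, j)"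
      using ij A by (simp add: scalar_prod_def)
  qed
  finally show "(msum n m f S * A) $$ (i, j) = msum n l (\<lambda>s. f s * A) S $$ (i, j)"
    using ij by simp
qed (use A in auto)

lemma mat_trace_carrier: "A \<in> carrier_mat n m \<Longrightarrow> mat_trace A = (\<Sum>i<n. A $$ (i, i))"
  by (simp add: mat_trace_def)

lemma mat_trace_msum:
  assumes "\<And>s. s \<in> S \<Longrightarrow> f s \<in> carrier_mat n n"
  shows "mat_trace (msum n n f S) = (\<Sum>s\<in>S. mat_trace (f s))"
proof -
  have "mat_trace (msum n n f S) = (\<Sum>s\<in>S. \<Sum>i<n. f s $$ (i, i))"
    by (simp add: mat_trace_def sum.swap[of _ S])
  also have "\<dots> = (\<Sum>s\<in>S. mat_trace (f s))"
    by (intro sum.cong refl) (simp add: mat_trace_carrier[OF assms])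
  finally show ?thesis .
qed

lemma mat_trace_one [simp]: "mat_trace (1\<^sub>m n) = (of_nat n :: 'k::comm_ring_1)"
  by (simp add: mat_trace_def)

lemma mat_trace_smult:
  "A \<in> carrier_mat n n \<Longrightarrow> mat_trace (c \<cdot>\<^sub>m A) = (c :: 'k::comm_ring_1) * mat_trace A"
  by (simp add: mat_trace_def sum_distrib_left)

lemma mat_trace_add:
  "A \<in> carrier_mat n n \<Longrightarrow> B \<in> carrier_mat n n \<Longrightarrow>
    mat_trace (A + B) = (mat_trace A + mat_trace B :: 'k::comm_ring_1)"
  by (simp add: mat_trace_def sum.distrib)

lemma mat_trace_mult_comm:
  assumes "A \<in> carrier_mat n m" "B \<in> carrier_mat m n"
  shows "mat_trace (A * B) = (mat_trace (B * A) :: 'k::comm_ring_1)"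
proof -
  have "mat_trace (A * B) = (\<Sum>i<n. \<Sum>k<m. A $$ (i, k) * B $$ (k, i))"
    using assms by (auto simp: mat_trace_def scalar_prod_def atLeast0LessThan intro!: sum.cong)
  also have "\<dots> = (\<Sum>k<m. \<Sum>i<n. B $$ (k, i) * A $$ (i, k))"
    by (subst sum.swap) (simp add: mult.commute)
  also have "\<dots> = mat_trace (B * A)"
    using assms by (auto simp: mat_trace_def scalar_prod_def atLeast0LessThan intro!: sum.cong)
  finally show ?thesis .
qed

lemma mat_eq_by_vec:
  fixes A B :: "'k::comm_ring_1 mat"
  assumes A: "A \<in> carrier_mat n m" and B: "B \<in> carrier_mat n m"
    and eq: "\<And>v. v \<in> carrier_vec m \<Longrightarrow> A *\<^sub>v v = B *\<^sub>v v"
  shows "A = B"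
proof (rule eq_matI)
  fix i j assume "i < dim_row B" "j < dim_col B"
  then have ij: "i < n" "j < m" using B by auto
  have *: "(C *\<^sub>v unit_vec m j) $ i = C $$ (i, j)" if "C \<in> carrier_mat n m" for C :: "'k mat"
    using that ij by (auto simp: scalar_prod_right_unit)
  show "A $$ (i, j) = B $$ (i, j)"
    using eq[of "unit_vec m j"] *[OF A] *[OF B] by simp
qed (use A B in auto)

section \<open>Subspaces and idempotents as split injections\<close>

definition vec_subspace :: "nat \<Rightarrow> 'k::field vec set \<Rightarrow> bool" where
  "vec_subspace n W \<longleftrightarrow> W \<subseteq> carrier_vec n \<and> 0\<^sub>v n \<in> W \<and>
     (\<forall>u\<in>W. \<forall>v\<in>W. u + v \<in> W) \<and> (\<forall>c. \<forall>v\<in>W. c \<cdot>\<^sub>v v \<in> W)"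

text \<open>If \<open>n < k\<close>, padding both matrices with zeros to size \<open>k\<close> keeps
  \<open>L * A = 1\<close>. For square matrices a left inverse is a right inverse, but the last row
  of the padded \<open>A\<close> is zero.\<close>

lemma left_inverse_dim:
  fixes A :: "'k::field mat"
  assumes A: "A \<in> carrier_mat n k" and L: "L \<in> carrier_mat k n" and LA: "L * A = 1\<^sub>m k"
  shows "k \<le> n"
proof (rule ccontr)
  assume "\<not> k \<le> n"
  then have nk: "n < k" by simp
  define A0 where "A0 = mat k k (\<lambda>(r, c). if r < n then A $$ (r, c) else 0)"
  define L0 where "L0 = mat k k (\<lambda>(r, c). if c < n then L $$ (r, c) else 0)"
  have c: "A0 \<in> carrier_mat k k" "L0 \<in> carrier_mat k k" by (simp_all add: A0_def L0_def)
  have "L0 * A0 = 1\<^sub>m k"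
  proof (rule eq_matI)
    fix i j assume "i < dim_row (1\<^sub>m k :: 'k mat)" "j < dim_col (1\<^sub>m k :: 'k mat)"
    then have ij: "i < k" "j < k" by auto
    have "(L0 * A0) $$ (i, j) = (\<Sum>t = 0..<k. if t < n then L $$ (i, t) * A $$ (t, j) else 0)"
      using ij by (auto simp: A0_def L0_def scalar_prod_def intro!: sum.cong)
    also have "\<dots> = (\<Sum>t = 0..<n. L $$ (i, t) * A $$ (t, j))"
      using nk by (intro sum.mono_neutral_cong_right) auto
    also have "\<dots> = (L * A) $$ (i, j)"
      using ij A L by (simp add: scalar_prod_def)
    finally show "(L0 * A0) $$ (i, j) = 1\<^sub>m k $$ (i, j)" using LA by simp
  qed (use c in auto)
  then have "A0 * L0 = 1\<^sub>m k" by (rule mat_mult_left_right_inverse[OF c(2,1)])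
  then have "(A0 * L0) $$ (k - 1, k - 1) = 1" using nk by simp
  moreover have "(A0 * L0) $$ (k - 1, k - 1) = 0"
    using nk by (auto simp: A0_def L0_def scalar_prod_def intro!: sum.neutral)
  ultimately show False by simp
qed

text \<open>The defect \<open>u = w - A L w\<close> lies in \<open>W\<close>, is killed by
  \<open>L\<close> and is not zero. Appending it to \<open>A\<close> as a column enlarges the split
  injection by one dimension.\<close>

lemma subspace_splitting_extend:
  fixes A :: "'k::field mat"
  assumes W: "vec_subspace n W"
    and A: "A \<in> carrier_mat n k" and L: "L \<in> carrier_mat k n" and LA: "L * A = 1\<^sub>m k"
    and AW: "\<And>v. v \<in> carrier_vec k \<Longrightarrow> A *\<^sub>v v \<in> W"
    and w: "w \<in> W" "A *\<^sub>v (L *\<^sub>v w) \<noteq> w"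
  shows "\<exists>A' L'. A' \<in> carrier_mat n (Suc k) \<and> L' \<in> carrier_mat (Suc k) n \<and> L' * A' = 1\<^sub>m (Suc k)
    \<and> (\<forall>v\<in>carrier_vec (Suc k). A' *\<^sub>v v \<in> W)"
proof -
  have wc: "w \<in> carrier_vec n" using W w by (auto simp: vec_subspace_def)
  have Lw: "L *\<^sub>v w \<in> carrier_vec k" using L wc by auto
  have ALw: "A *\<^sub>v (L *\<^sub>v w) \<in> carrier_vec n" using A Lw by auto
  define P where "P = 1\<^sub>m n - A * L"
  have P: "P \<in> carrier_mat n n" using A L by (auto simp: P_def)
  define u where "u = P *\<^sub>v w"
  have uc: "u \<in> carrier_vec n" using P wc by (simp add: u_def)
  have u_eq: "u = w - A *\<^sub>v (L *\<^sub>v w)"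
    using A L wc by (simp add: u_def P_def minus_mult_distrib_mat_vec[of _ n n])
  have "u = w + (- 1) \<cdot>\<^sub>v (A *\<^sub>v (L *\<^sub>v w))"
    unfolding u_eq using wc ALw by (intro eq_vecI) auto
  then have uW: "u \<in> W" using W w AW[OF Lw] by (auto simp: vec_subspace_def)
  have PA: "P * A = 0\<^sub>m n k"
    using A L LA by (simp add: P_def minus_mult_distrib_mat[of _ n n] assoc_mult_mat[of _ n k _ n _ k])
  have LP: "L * P = 0\<^sub>m k n"
  proof -
    have "L * P = L - L * (A * L)"
      using A L by (simp add: P_def mult_minus_distrib_mat[of _ k n _ n])
    also have "L * (A * L) = L" using assoc_mult_mat[OF L A L] LA L by simp
    finally show ?thesis using L by simp
  qed
  have Lu: "L *\<^sub>v u = 0\<^sub>v k"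
  proof -
    have "0\<^sub>m k n *\<^sub>v w = 0\<^sub>v k" using wc by (intro eq_vecI) auto
    then show ?thesis unfolding u_def using assoc_mult_mat_vec[OF L P wc] LP by simp
  qed
  have "P * P = P"
  proof -
    have "P * P = P - P * (A * L)"
      using A L P mult_minus_distrib_mat[OF P one_carrier_mat, of "A * L"] by (simp add: P_def[symmetric])
    also have "P * (A * L) = 0\<^sub>m n n" using assoc_mult_mat[OF P A L] PA L by simp
    also have "P - 0\<^sub>m n n = P" using P by (intro eq_matI) auto
    finally show ?thesis .
  qed
  then have Pu: "P *\<^sub>v u = u"
    unfolding u_def using assoc_mult_mat_vec[OF P P wc] by simp
  have "u \<noteq> 0\<^sub>v n"
  proof
    assume z: "u = 0\<^sub>v n"
    have "w = A *\<^sub>v (L *\<^sub>v w)"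
    proof (rule eq_vecI)
      fix i assume "i < dim_vec (A *\<^sub>v (L *\<^sub>v w))"
      then have i: "i < n" using A by simp
      have "u $ i = w $ i - (A *\<^sub>v (L *\<^sub>v w)) $ i" unfolding u_eq using i ALw A by auto
      then show "w $ i = (A *\<^sub>v (L *\<^sub>v w)) $ i" using z i by simp
    qed (use A wc in auto)
    then show False using w(2) by simp
  qed
  then obtain i where i: "i < n" "u $ i \<noteq> 0"
    using uc by (metis eq_vecI carrier_vecD index_zero_vec)
  \<comment> \<open>The new row of \<open>L'\<close> is row \<open>i\<close> of the projection
    \<open>P\<close>, scaled by \<open>1 / u $ i\<close>: it kills the columns of \<open>A\<close>
    because \<open>P * A = 0\<close>, and takes the value 1 at \<open>u\<close> because
    \<open>P\<close> fixes \<open>u\<close>.\<close>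
  define A' where "A' = mat n (Suc k) (\<lambda>(r, c). if c < k then A $$ (r, c) else u $ r)"
  define L' where "L' = mat (Suc k) n (\<lambda>(r, c). if r < k then L $$ (r, c) else P $$ (i, c) / u $ i)"
  have c: "A' \<in> carrier_mat n (Suc k)" "L' \<in> carrier_mat (Suc k) n" by (simp_all add: A'_def L'_def)
  have "L' * A' = 1\<^sub>m (Suc k)"
  proof (rule eq_matI)
    fix r s assume "r < dim_row (1\<^sub>m (Suc k) :: 'k mat)" "s < dim_col (1\<^sub>m (Suc k) :: 'k mat)"
    then have rs: "r < Suc k" "s < Suc k" by auto
    have e: "(L' * A') $$ (r, s) = (\<Sum>t = 0..<n. L' $$ (r, t) * A' $$ (t, s))"
      using rs c by (simp add: scalar_prod_def)
    consider "r < k" "s < k" | "r < k" "s = k" | "r = k" "s < k" | "r = k" "s = k"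
      using rs by linarith
    then show "(L' * A') $$ (r, s) = 1\<^sub>m (Suc k) $$ (r, s)"
    proof cases
      case 1
      then have "(L' * A') $$ (r, s) = (L * A) $$ (r, s)"
        unfolding e using A L by (simp add: scalar_prod_def A'_def L'_def)
      then show ?thesis using LA 1 by simp
    next
      case 2
      then have "(L' * A') $$ (r, s) = (L *\<^sub>v u) $ r"
        unfolding e using L uc by (simp add: scalar_prod_def A'_def L'_def)
      then show ?thesis using Lu 2 by simp
    next
      case 3
      then have "(L' * A') $$ (r, s) = (P * A) $$ (i, s) / u $ i"
        unfolding e using A P i by (simp add: scalar_prod_def A'_def L'_def sum_divide_distrib)
      then show ?thesis using PA 3 i by simp
    next
      case 4
      then have "(L' * A') $$ (r, s) = (P *\<^sub>v u) $ i / u $ i"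
        unfolding e using uc P i by (simp add: scalar_prod_def A'_def L'_def sum_divide_distrib)
      then show ?thesis using Pu 4 i by simp
    qed
  qed (use c in auto)
  moreover have "A' *\<^sub>v v \<in> W" if v: "v \<in> carrier_vec (Suc k)" for v
  proof -
    have "A' *\<^sub>v v = A *\<^sub>v vec k (\<lambda>j. v $ j) + v $ k \<cdot>\<^sub>v u"
      using A uc v by (intro eq_vecI) (auto simp: A'_def scalar_prod_def)
    then show ?thesis using W uW AW[of "vec k (\<lambda>j. v $ j)"] by (auto simp: vec_subspace_def)
  qed
  ultimately show ?thesis using c by blast
qed

text \<open>The columns of \<open>A\<close> serve as a basis of \<open>W\<close> and
  \<open>L\<close> as a coordinate map defined on the whole space. A split injection into
  \<open>W\<close> of greatest rank is onto \<open>W\<close>, since otherwise it could be extended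
  by one column.\<close>

lemma subspace_splitting:
  fixes W :: "'k::field vec set"
  assumes W: "vec_subspace n W"
  obtains k A L where "A \<in> carrier_mat n k" "L \<in> carrier_mat k n" "L * A = 1\<^sub>m k"
    "\<And>v. v \<in> carrier_vec k \<Longrightarrow> A *\<^sub>v v \<in> W" "\<And>w. w \<in> W \<Longrightarrow> A *\<^sub>v (L *\<^sub>v w) = w"
proof -
  define Q where "Q = (\<lambda>k (A :: 'k mat) L. A \<in> carrier_mat n k \<and> L \<in> carrier_mat k n \<and>
    L * A = 1\<^sub>m k \<and> (\<forall>v\<in>carrier_vec k. A *\<^sub>v v \<in> W))"
  define R where "R = (\<lambda>k. \<exists>A L. Q k A L)"
  have "Q 0 (0\<^sub>m n 0) (0\<^sub>m 0 n)"
  proof -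
    have "0\<^sub>m n 0 *\<^sub>v v = 0\<^sub>v n" if "v \<in> carrier_vec 0" for v :: "'k vec"
      using that by (intro eq_vecI) (auto simp: scalar_prod_def)
    moreover have "0\<^sub>m 0 n * 0\<^sub>m n 0 = (1\<^sub>m 0 :: 'k mat)" by (intro eq_matI) auto
    ultimately show ?thesis using W by (auto simp: Q_def vec_subspace_def)
  qed
  then have R0: "R 0" by (auto simp: R_def)
  have bound: "k \<le> n" if "R k" for k
    using that left_inverse_dim by (auto simp: R_def Q_def)
  obtain k where k: "R k" "\<And>l. R l \<Longrightarrow> l \<le> k"
    using ex_has_greatest_nat[of R 0 id "Suc n"] R0 bound by (auto simp: less_Suc_eq_le)
  then obtain A L where AL: "Q k A L" by (auto simp: R_def)
  have "A *\<^sub>v (L *\<^sub>v w) = w" if "w \<in> W" for w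
  proof (rule ccontr)
    assume ne: "A *\<^sub>v (L *\<^sub>v w) \<noteq> w"
    have "R (Suc k)"
      unfolding R_def Q_def
      using subspace_splitting_extend[OF W _ _ _ _ that ne] AL by (auto simp: Q_def)
    then show False using k(2) by fastforce
  qed
  then show ?thesis using that[of A k L] AL by (auto simp: Q_def)
qed

lemma range_vec_subspace:
  assumes "(A :: 'k::field mat) \<in> carrier_mat n m"
  shows "vec_subspace n ((\<lambda>v. A *\<^sub>v v) ` carrier_vec m)"
proof -
  have "0\<^sub>v n = A *\<^sub>v 0\<^sub>v m" using assms by (intro eq_vecI) auto
  moreover have "A *\<^sub>v u + A *\<^sub>v v = A *\<^sub>v (u + v)" if "u \<in> carrier_vec m" "v \<in> carrier_vec m" for u v
    using mult_add_distrib_mat_vec[OF assms that] by simp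
  moreover have "c \<cdot>\<^sub>v (A *\<^sub>v v) = A *\<^sub>v (c \<cdot>\<^sub>v v)" if "v \<in> carrier_vec m" for c v
    using mult_mat_vec[OF assms that] by simp
  ultimately show ?thesis
    unfolding vec_subspace_def using assms
    by (auto intro!: image_eqI[where x="0\<^sub>v m"] simp: image_iff)
qed

lemma idempotent_splitting:
  fixes E :: "'k::field mat"
  assumes E: "E \<in> carrier_mat n n" and EE: "E * E = E"
  obtains k A L where "A \<in> carrier_mat n k" "L \<in> carrier_mat k n" "L * A = 1\<^sub>m k" "A * L = E"
proof -
  define W where "W = (\<lambda>v. E *\<^sub>v v) ` carrier_vec n"
  have "vec_subspace n W" unfolding W_def by (rule range_vec_subspace[OF E])
  then obtain k A L where A: "A \<in> carrier_mat n k" and L: "L \<in> carrier_mat k n" and LA: "L * A = 1\<^sub>m k"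
    and AW: "\<And>v. v \<in> carrier_vec k \<Longrightarrow> A *\<^sub>v v \<in> W" and WL: "\<And>w. w \<in> W \<Longrightarrow> A *\<^sub>v (L *\<^sub>v w) = w"
    by (rule subspace_splitting) (rule that)
  have fixW: "E *\<^sub>v w = w" if "w \<in> W" for w
    using that assoc_mult_mat_vec[OF E E] EE by (auto simp: W_def)
  have EA: "E * A = A"
    by (rule mat_eq_by_vec[of _ n k]) (use E A AW fixW in auto)
  \<comment> \<open>\<open>L\<close> need not vanish on the kernel of \<open>E\<close>, but
    \<open>L * E\<close> does, and it still inverts \<open>A\<close> because \<open>E\<close> fixes
    the columns of \<open>A\<close>.\<close>
  have "A * (L * E) = E"
  proof (rule mat_eq_by_vec[of _ n n])
    fix v :: "'k vec" assume v: "v \<in> carrier_vec n"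
    have "A * (L * E) *\<^sub>v v = A *\<^sub>v (L *\<^sub>v (E *\<^sub>v v))"
      using A L E v by (simp add: assoc_mult_mat_vec[of _ n k _ n] assoc_mult_mat_vec[of _ k n _ n])
    then show "A * (L * E) *\<^sub>v v = E *\<^sub>v v" using WL[of "E *\<^sub>v v"] v by (simp add: W_def)
  qed (use A L E in auto)
  moreover have "(L * E) * A = 1\<^sub>m k"
    using assoc_mult_mat[OF L E A] EA LA by simp
  ultimately show ?thesis using that[OF A, of "L * E"] L E by auto
qed

text \<open>The number \<open>k\<close> is the rank, since \<open>A * L\<close> and
  \<open>L * A = 1\<close> have the same trace. This makes multiplicities of eigenvalues natural
  numbers inside the field, and full rank will detect scalar matrices.\<close>

lemma idempotent_trace:
  fixes E :: "'k::field_char_0 mat"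
  assumes E: "E \<in> carrier_mat n n" and EE: "E * E = E"
  obtains k where "k \<le> n" "mat_trace E = of_nat k" "k = n \<Longrightarrow> E = 1\<^sub>m n"
proof -
  obtain k A L where A: "A \<in> carrier_mat n k" and L: "L \<in> carrier_mat k n"
    and LA: "L * A = 1\<^sub>m k" and AL: "A * L = E"
    using E EE by (rule idempotent_splitting) (rule that)
  have "mat_trace E = of_nat k" using mat_trace_mult_comm[OF A L] LA AL by simp
  moreover have "E = 1\<^sub>m n" if "k = n"
    using mat_mult_left_right_inverse[of L n A] A L LA AL that by simp
  ultimately show ?thesis using that left_inverse_dim[OF A L LA] by blast
qed

lemma vec_subspace_iff:
  "VectorSpace.subspace class_ring W (module_vec TYPE('k::field) n) \<longleftrightarrow> vec_subspace n W"
proof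
  assume "VectorSpace.subspace class_ring W (module_vec TYPE('k) n)"
  then have "submodule class_ring W (module_vec TYPE('k) n)"
    by (rule VectorSpace.subspace.submod)
  then show "vec_subspace n W"
    by (auto simp: vec_subspace_def submodule_def module_vec_simps class_ring_simps)
next
  assume W: "vec_subspace n W"
  have vs: "vectorspace class_ring (module_vec TYPE('k) n)" by (rule vec_vs)
  have "submodule class_ring W (module_vec TYPE('k) n)"
    using W vec_module[of n, where ?'a='k]
    by (auto simp: vec_subspace_def submodule_def module_vec_simps class_ring_simps)
  then show "VectorSpace.subspace class_ring W (module_vec TYPE('k) n)"
    using vs by (simp add: VectorSpace.subspace_def)
qed

section \<open>Representations and Schur's lemma\<close>

definition mat_rep :: "('a, 'b) monoid_scheme \<Rightarrow> nat \<Rightarrow> ('a \<Rightarrow> 'k::field mat) \<Rightarrow> bool" where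
  "mat_rep G n \<rho> \<longleftrightarrow> (\<forall>g\<in>carrier G. \<rho> g \<in> carrier_mat n n) \<and>
     (\<forall>g\<in>carrier G. \<forall>h\<in>carrier G. \<rho> (g \<otimes>\<^bsub>G\<^esub> h) = \<rho> g * \<rho> h) \<and> \<rho> \<one>\<^bsub>G\<^esub> = 1\<^sub>m n"

lemma mat_rep_carrier: "mat_rep G n \<rho> \<Longrightarrow> g \<in> carrier G \<Longrightarrow> \<rho> g \<in> carrier_mat n n"
  and mat_rep_mult: "mat_rep G n \<rho> \<Longrightarrow> g \<in> carrier G \<Longrightarrow> h \<in> carrier G \<Longrightarrow> \<rho> (g \<otimes>\<^bsub>G\<^esub> h) = \<rho> g * \<rho> h"
  and mat_rep_one: "mat_rep G n \<rho> \<Longrightarrow> \<rho> \<one>\<^bsub>G\<^esub> = 1\<^sub>m n"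
  by (auto simp: mat_rep_def)

context group
begin

lemma mat_rep_inv:
  assumes "mat_rep G n \<rho>" "g \<in> carrier G"
  shows "\<rho> g * \<rho> (inv g) = 1\<^sub>m n" "\<rho> (inv g) * \<rho> g = 1\<^sub>m n"
  using mat_rep_mult[OF assms(1), of g "inv g"] mat_rep_mult[OF assms(1), of "inv g" g]
    mat_rep_one[OF assms(1)] assms(2) by auto

lemma mat_rep_pow:
  assumes "mat_rep G n \<rho>" "g \<in> carrier G"
  shows "\<rho> (g [^] (k::nat)) = \<rho> g ^\<^sub>m k"
proof (induction k)
  case 0
  then show ?case using mat_rep_one[OF assms(1)] mat_rep_carrier[OF assms] by simp
next
  case (Suc k)
  then show ?case using mat_rep_mult[OF assms(1), of "g [^] k" g] assms(2) by simp
qed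

lemma mat_rep_iff_hom: "mat_rep G n (\<rho> :: 'a \<Rightarrow> 'k::field mat) \<longleftrightarrow> \<rho> \<in> hom G (GL TYPE('k) n)"
proof
  assume r: "mat_rep G n \<rho>"
  have "\<rho> g \<in> carrier (GL TYPE('k) n)" if "g \<in> carrier G" for g
    using mat_rep_inv[OF r that] mat_rep_carrier[OF r, of g] mat_rep_carrier[OF r, of "inv g"] that
    by (auto simp: units_of_def Units_def ring_mat_simps)
  then show "\<rho> \<in> hom G (GL TYPE('k) n)"
    using r by (auto simp: hom_def mat_rep_def units_of_mult ring_mat_simps)
next
  assume h: "\<rho> \<in> hom G (GL TYPE('k) n)"
  have m: "monoid (ring_mat TYPE('k) n ())"
    using ring_mat[of n "()", where ?'a='k] by (rule ring.axioms)
  interpret GLn: group "GL TYPE('k) n"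
    by (rule monoid.units_group[OF m])
  have "\<rho> \<one> = 1\<^sub>m n"
    using hom_one[OF h is_group GLn.is_group] by (simp add: units_of_one ring_mat_simps)
  then show "mat_rep G n \<rho>"
    using h by (auto simp: hom_def mat_rep_def units_of_def Units_def ring_mat_simps)
qed

lemma irreducible_rep_iff:
  "irreducible_rep G n (\<rho> :: 'a \<Rightarrow> 'k::field mat) \<longleftrightarrow> 0 < n \<and> mat_rep G n \<rho> \<and>
     (\<forall>W. vec_subspace n W \<longrightarrow> (\<forall>g\<in>carrier G. \<forall>w\<in>W. \<rho> g *\<^sub>v w \<in> W) \<longrightarrow> W = {0\<^sub>v n} \<or> W = carrier_vec n)"
  unfolding irreducible_rep_def mat_rep_iff_hom vec_subspace_iff ..

lemma irreducible_rep_mat_rep: "irreducible_rep G n \<rho> \<Longrightarrow> mat_rep G n \<rho>"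
  by (simp add: irreducible_rep_iff)

lemma rep_character_apply: "g \<in> carrier G \<Longrightarrow> rep_character G \<rho> g = mat_trace (\<rho> g)"
  by (simp add: rep_character_def)

text \<open>The image of \<open>X\<close> is invariant under \<open>\<rho>\<close> and its kernel
  under \<open>\<sigma>\<close>, so irreducibility makes \<open>X\<close> onto and injective. The
  columns of the inverse are preimages of the unit vectors.\<close>

lemma schur_intertwiner:
  fixes \<rho> \<sigma> :: "'a \<Rightarrow> 'k::field mat"
  assumes \<rho>: "irreducible_rep G n \<rho>" and \<sigma>: "irreducible_rep G m \<sigma>"
    and X: "X \<in> carrier_mat n m"
    and comm: "\<And>g. g \<in> carrier G \<Longrightarrow> \<rho> g * X = X * \<sigma> g"
    and nz: "X \<noteq> 0\<^sub>m n m"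
  obtains Y where "Y \<in> carrier_mat m n" "X * Y = 1\<^sub>m n" "Y * X = 1\<^sub>m m"
proof -
  note r = mat_rep_carrier[OF irreducible_rep_mat_rep[OF \<rho>]]
  note s = mat_rep_carrier[OF irreducible_rep_mat_rep[OF \<sigma>]]
  define W where "W = (\<lambda>v. X *\<^sub>v v) ` carrier_vec m"
  have "\<rho> g *\<^sub>v w \<in> W" if g: "g \<in> carrier G" and w: "w \<in> W" for g w
  proof -
    obtain v where v: "v \<in> carrier_vec m" "w = X *\<^sub>v v" using w by (auto simp: W_def)
    have "\<rho> g *\<^sub>v w = X *\<^sub>v (\<sigma> g *\<^sub>v v)"
      using assoc_mult_mat_vec[OF r[OF g] X v(1)] assoc_mult_mat_vec[OF X s[OF g] v(1)] comm[OF g] v(2)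
      by simp
    then show ?thesis using s[OF g] v(1) by (auto simp: W_def)
  qed
  then have W: "W = {0\<^sub>v n} \<or> W = carrier_vec n"
    using \<rho> range_vec_subspace[OF X] unfolding irreducible_rep_iff W_def by blast
  have "W \<noteq> {0\<^sub>v n}"
  proof
    assume W0: "W = {0\<^sub>v n}"
    have "X = 0\<^sub>m n m"
    proof (rule mat_eq_by_vec[OF X])
      fix v :: "'k vec" assume v: "v \<in> carrier_vec m"
      then have "X *\<^sub>v v = 0\<^sub>v n" using W0 unfolding W_def by blast
      then show "X *\<^sub>v v = 0\<^sub>m n m *\<^sub>v v" using v by (intro eq_vecI) auto
    qed auto
    then show False using nz by simp
  qed
  then have Wall: "W = carrier_vec n" using W by blast
  have "\<forall>i. \<exists>v. i < n \<longrightarrow> v \<in> carrier_vec m \<and> X *\<^sub>v v = unit_vec n i"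
  proof
    fix i
    have "unit_vec n i \<in> W" using Wall by simp
    then show "\<exists>v. i < n \<longrightarrow> v \<in> carrier_vec m \<and> X *\<^sub>v v = unit_vec n i"
      unfolding W_def by force
  qed
  then obtain f where f: "\<And>i. i < n \<Longrightarrow> f i \<in> carrier_vec m" "\<And>i. i < n \<Longrightarrow> X *\<^sub>v f i = unit_vec n i"
    by metis
  define Y where "Y = mat m n (\<lambda>(r, c). f c $ r)"
  have Y: "Y \<in> carrier_mat m n" by (simp add: Y_def)
  have XY: "X * Y = 1\<^sub>m n"
  proof (rule eq_matI)
    fix i j assume "i < dim_row (1\<^sub>m n :: 'k mat)" "j < dim_col (1\<^sub>m n :: 'k mat)"
    then have ij: "i < n" "j < n" by auto
    have "(X * Y) $$ (i, j) = (X *\<^sub>v f j) $ i"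
      using ij X Y f(1)[OF ij(2)] by (simp add: scalar_prod_def Y_def)
    then show "(X * Y) $$ (i, j) = 1\<^sub>m n $$ (i, j)" using f(2)[OF ij(2)] ij by simp
  qed (use X Y in auto)
  define K where "K = {v \<in> carrier_vec m. X *\<^sub>v v = 0\<^sub>v n}"
  have "vec_subspace m K"
  proof -
    have "X *\<^sub>v 0\<^sub>v m = 0\<^sub>v n" using X by (intro eq_vecI) auto
    moreover have "c \<cdot>\<^sub>v 0\<^sub>v n = 0\<^sub>v n" for c :: 'k by (intro eq_vecI) auto
    ultimately show ?thesis
      unfolding vec_subspace_def K_def
      using mult_add_distrib_mat_vec[OF X] mult_mat_vec[OF X] by auto
  qed
  moreover have "\<sigma> g *\<^sub>v v \<in> K" if g: "g \<in> carrier G" and v: "v \<in> K" for g v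
  proof -
    have vc: "v \<in> carrier_vec m" "X *\<^sub>v v = 0\<^sub>v n" using v by (auto simp: K_def)
    have "X *\<^sub>v (\<sigma> g *\<^sub>v v) = \<rho> g *\<^sub>v (X *\<^sub>v v)"
      using assoc_mult_mat_vec[OF r[OF g] X vc(1)] assoc_mult_mat_vec[OF X s[OF g] vc(1)] comm[OF g]
      by simp
    also have "\<dots> = 0\<^sub>v n" using r[OF g] vc(2) by (intro eq_vecI) auto
    finally show ?thesis using s[OF g] vc by (auto simp: K_def)
  qed
  ultimately have "K = {0\<^sub>v m} \<or> K = carrier_vec m"
    using \<sigma> unfolding irreducible_rep_iff by blast
  moreover have "K \<noteq> carrier_vec m"
  proof
    assume Km: "K = carrier_vec m"
    have "X = 0\<^sub>m n m"
    proof (rule mat_eq_by_vec[OF X])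
      fix v :: "'k vec" assume v: "v \<in> carrier_vec m"
      then have "X *\<^sub>v v = 0\<^sub>v n" using Km unfolding K_def by blast
      then show "X *\<^sub>v v = 0\<^sub>m n m *\<^sub>v v" using v by (intro eq_vecI) auto
    qed auto
    then show False using nz by simp
  qed
  ultimately have K0: "K = {0\<^sub>v m}" by blast
  have "Y * X = 1\<^sub>m m"
  proof (rule mat_eq_by_vec[of _ m m])
    fix v :: "'k vec" assume v: "v \<in> carrier_vec m"
    define u where "u = (Y * X) *\<^sub>v v - v"
    have YXv: "(Y * X) *\<^sub>v v \<in> carrier_vec m" using X Y v by auto
    have Xv: "X *\<^sub>v v \<in> carrier_vec n" using X v by auto
    have "X *\<^sub>v ((Y * X) *\<^sub>v v) = X *\<^sub>v v"
      using assoc_mult_mat_vec[OF Y X v] assoc_mult_mat_vec[OF X Y Xv] XY Xv by simp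
    then have "X *\<^sub>v u = 0\<^sub>v n"
      unfolding u_def mult_minus_distrib_mat_vec[OF X YXv v] using Xv by simp
    moreover have "u \<in> carrier_vec m" unfolding u_def using YXv v by simp
    ultimately have "u \<in> K" unfolding K_def by blast
    then have "u = 0\<^sub>v m" using K0 by blast
    have "(Y * X) *\<^sub>v v = v"
    proof (rule eq_vecI)
      fix i assume "i < dim_vec v"
      then have i: "i < m" using v by simp
      have "u $ i = ((Y * X) *\<^sub>v v) $ i - v $ i" unfolding u_def using i YXv v by auto
      then show "((Y * X) *\<^sub>v v) $ i = v $ i" using \<open>u = 0\<^sub>v m\<close> i by simp
    qed (use Y YXv v in auto)
    then show "(Y * X) *\<^sub>v v = 1\<^sub>m m *\<^sub>v v" using v by simp
  qed (use X Y in auto)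
  then show ?thesis using that Y XY by blast
qed

lemma intertwiner_rep_character_eq:
  fixes \<rho> \<sigma> :: "'a \<Rightarrow> 'k::field mat"
  assumes \<rho>: "irreducible_rep G n \<rho>" and \<sigma>: "irreducible_rep G m \<sigma>"
    and X: "X \<in> carrier_mat n m"
    and comm: "\<And>g. g \<in> carrier G \<Longrightarrow> \<rho> g * X = X * \<sigma> g"
    and nz: "X \<noteq> 0\<^sub>m n m"
  shows "rep_character G \<rho> = rep_character G \<sigma>"
proof -
  obtain Y where Y: "Y \<in> carrier_mat m n" "X * Y = 1\<^sub>m n" "Y * X = 1\<^sub>m m"
    using schur_intertwiner[OF assms] by blast
  have "mat_trace (\<rho> g) = mat_trace (\<sigma> g)" if g: "g \<in> carrier G" for g
  proof -
    have c: "\<rho> g \<in> carrier_mat n n" "\<sigma> g \<in> carrier_mat m m"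
      using g \<rho> \<sigma> by (auto simp: irreducible_rep_iff mat_rep_def)
    have "mat_trace (\<rho> g) = mat_trace (\<rho> g * (X * Y))" using Y c by simp
    also have "\<rho> g * (X * Y) = (X * \<sigma> g) * Y"
      using assoc_mult_mat[OF c(1) X Y(1)] comm[OF g] by simp
    also have "mat_trace \<dots> = mat_trace (Y * (X * \<sigma> g))"
      using X Y c by (intro mat_trace_mult_comm[of _ n m]) auto
    also have "Y * (X * \<sigma> g) = \<sigma> g" using assoc_mult_mat[OF Y(1) X c(2)] Y(3) c by simp
    finally show ?thesis .
  qed
  then show ?thesis by (auto simp: rep_character_def restrict_def)
qed

text \<open>Over an algebraically closed field \<open>X\<close> has an eigenvalue \<open>e\<close>;
  the intertwiner \<open>X - e\<close> is singular and hence zero by Schur's lemma.\<close>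

lemma schur_scalar:
  fixes \<rho> :: "'a \<Rightarrow> 'k::alg_closed_field mat"
  assumes \<rho>: "irreducible_rep G n \<rho>" and X: "X \<in> carrier_mat n n"
    and comm: "\<And>g. g \<in> carrier G \<Longrightarrow> \<rho> g * X = X * \<rho> g"
  obtains c where "X = c \<cdot>\<^sub>m 1\<^sub>m n"
proof -
  have "n > 0" using \<rho> by (simp add: irreducible_rep_iff)
  then have "Polynomial.degree (char_poly X) > 0" using degree_monic_char_poly[OF X] by simp
  then obtain e where "poly (char_poly X) e = 0" using alg_closed_imp_poly_has_root by blast
  then have "eigenvalue X e" using eigenvalue_root_char_poly[OF X] by simp
  then obtain v where v: "v \<in> carrier_vec n" "v \<noteq> 0\<^sub>v n" "X *\<^sub>v v = e \<cdot>\<^sub>v v"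
    using X by (auto simp: eigenvalue_def eigenvector_def)
  define Z where "Z = X - e \<cdot>\<^sub>m 1\<^sub>m n"
  have Z: "Z \<in> carrier_mat n n" unfolding Z_def using X by (intro minus_carrier_mat) auto
  have one: "e \<cdot>\<^sub>m 1\<^sub>m n \<in> carrier_mat n n" by simp
  have Zcomm: "\<rho> g * Z = Z * \<rho> g" if g: "g \<in> carrier G" for g
  proof -
    have c: "\<rho> g \<in> carrier_mat n n" using g \<rho> by (auto simp: irreducible_rep_iff mat_rep_def)
    have "\<rho> g * (e \<cdot>\<^sub>m 1\<^sub>m n) = (e \<cdot>\<^sub>m 1\<^sub>m n) * \<rho> g"
      using mult_smult_distrib[OF c one_carrier_mat, of e] mult_smult_assoc_mat[OF one_carrier_mat c, of e] c
      by simp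
    then show ?thesis
      unfolding Z_def mult_minus_distrib_mat[OF c X one] minus_mult_distrib_mat[OF X one c]
      using comm[OF g] by simp
  qed
  have Zv: "Z *\<^sub>v v = 0\<^sub>v n"
  proof -
    have "(e \<cdot>\<^sub>m 1\<^sub>m n) *\<^sub>v v = e \<cdot>\<^sub>v v" using v(1) by (intro eq_vecI) auto
    then show ?thesis
      unfolding Z_def minus_mult_distrib_mat_vec[OF X one v(1)] using v by simp
  qed
  have "Z = 0\<^sub>m n n"
  proof (rule ccontr)
    assume "Z \<noteq> 0\<^sub>m n n"
    then obtain Y where Y: "Y \<in> carrier_mat n n" "Y * Z = 1\<^sub>m n"
      using schur_intertwiner[OF \<rho> \<rho> Z Zcomm] by blast
    have "v = Y *\<^sub>v (Z *\<^sub>v v)" using assoc_mult_mat_vec[OF Y(1) Z v(1)] Y(2) v(1) by simp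
    also have "\<dots> = 0\<^sub>v n" unfolding Zv using Y(1) by (intro eq_vecI) auto
    finally show False using v(2) by simp
  qed
  have "X = e \<cdot>\<^sub>m 1\<^sub>m n"
  proof (rule eq_matI)
    fix i j assume "i < dim_row (e \<cdot>\<^sub>m 1\<^sub>m n)" "j < dim_col (e \<cdot>\<^sub>m 1\<^sub>m n)"
    then have ij: "i < n" "j < n" by auto
    have "Z $$ (i, j) = X $$ (i, j) - (e \<cdot>\<^sub>m 1\<^sub>m n) $$ (i, j)" unfolding Z_def using ij X by simp
    then show "X $$ (i, j) = (e \<cdot>\<^sub>m 1\<^sub>m n) $$ (i, j)" using \<open>Z = 0\<^sub>m n n\<close> ij by simp
  qed (use X in auto)
  then show ?thesis using that by blast
qed

text \<open>The average of \<open>X\<close> over the group, not divided by the group order; it turns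
  any matrix into an intertwiner from \<open>\<sigma>\<close> to \<open>\<rho>\<close>.\<close>

definition conj_sum :: "nat \<Rightarrow> nat \<Rightarrow> ('a \<Rightarrow> 'k::field mat) \<Rightarrow> ('a \<Rightarrow> 'k mat) \<Rightarrow> 'k mat \<Rightarrow> 'k mat" where
  "conj_sum n m \<rho> \<sigma> X = msum n m (\<lambda>g. \<rho> g * X * \<sigma> (inv g)) (carrier G)"

lemma conj_sum_carrier [simp]: "conj_sum n m \<rho> \<sigma> X \<in> carrier_mat n m"
  by (simp add: conj_sum_def)

lemma bij_betw_left_mult: "h \<in> carrier G \<Longrightarrow> bij_betw (\<lambda>g. h \<otimes> g) (carrier G) (carrier G)"
  by (rule bij_betw_byWitness[where f'="\<lambda>g. inv h \<otimes> g"]) (auto simp: m_assoc[symmetric])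

lemma bij_betw_right_mult: "h \<in> carrier G \<Longrightarrow> bij_betw (\<lambda>g. g \<otimes> h) (carrier G) (carrier G)"
  by (rule bij_betw_byWitness[where f'="\<lambda>g. g \<otimes> inv h"]) (auto simp: m_assoc)

lemma conj_sum_intertwines:
  assumes \<rho>: "mat_rep G n \<rho>" and \<sigma>: "mat_rep G m \<sigma>" and X: "X \<in> carrier_mat n m"
    and h: "h \<in> carrier G"
  shows "\<rho> h * conj_sum n m \<rho> \<sigma> X = conj_sum n m \<rho> \<sigma> X * \<sigma> h"
proof -
  have c: "\<rho> g * X * \<sigma> (inv g) \<in> carrier_mat n m" if "g \<in> carrier G" for g
    using mat_rep_carrier[OF \<rho> that] mat_rep_carrier[OF \<sigma>, of "inv g"] that X by auto
  have step: "\<rho> h * (\<rho> g * X * \<sigma> (inv g)) = \<rho> (h \<otimes> g) * X * \<sigma> (inv (h \<otimes> g)) * \<sigma> h"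
    if g: "g \<in> carrier G" for g
  proof -
    have m: "\<rho> h \<in> carrier_mat n n" "\<rho> g \<in> carrier_mat n n" "\<sigma> h \<in> carrier_mat m m"
      "\<sigma> (inv g) \<in> carrier_mat m m" "\<sigma> (inv (h \<otimes> g)) \<in> carrier_mat m m"
      using g h mat_rep_carrier[OF \<rho>] mat_rep_carrier[OF \<sigma>] by auto
    have 1: "\<sigma> (inv (h \<otimes> g)) * \<sigma> h = \<sigma> (inv g)"
      using g h mat_rep_mult[OF \<sigma>, of "inv (h \<otimes> g)" h] by (simp add: inv_mult_group m_assoc)
    have "\<rho> (h \<otimes> g) * X * \<sigma> (inv (h \<otimes> g)) * \<sigma> h = \<rho> (h \<otimes> g) * X * (\<sigma> (inv (h \<otimes> g)) * \<sigma> h)"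
      using m X mat_rep_carrier[OF \<rho>, of "h \<otimes> g"] g h by (intro assoc_mult_mat) auto
    also have "\<dots> = \<rho> h * \<rho> g * X * \<sigma> (inv g)" using 1 mat_rep_mult[OF \<rho> h g] by simp
    also have "\<dots> = \<rho> h * (\<rho> g * X * \<sigma> (inv g))"
      using assoc_mult_mat[OF m(1,2) X] assoc_mult_mat[OF m(1) mult_carrier_mat[OF m(2) X] m(4)] by simp
    finally show ?thesis by simp
  qed
  have "\<rho> h * conj_sum n m \<rho> \<sigma> X = msum n m (\<lambda>g. \<rho> (h \<otimes> g) * X * \<sigma> (inv (h \<otimes> g)) * \<sigma> h) (carrier G)"
    unfolding conj_sum_def mult_msum[OF mat_rep_carrier[OF \<rho> h] c, of "carrier G" "\<lambda>g. g", simplified]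
    by (rule msum_cong[OF refl step])
  also have "\<dots> = msum n m (\<lambda>g. \<rho> g * X * \<sigma> (inv g) * \<sigma> h) (carrier G)"
    using msum_reindex[OF bij_betw_left_mult[OF h], of n m "\<lambda>g. \<rho> g * X * \<sigma> (inv g) * \<sigma> h"] by simp
  also have "\<dots> = conj_sum n m \<rho> \<sigma> X * \<sigma> h"
    unfolding conj_sum_def msum_mult[OF mat_rep_carrier[OF \<sigma> h] c, of "carrier G" "\<lambda>g. g", simplified] ..
  finally show ?thesis .
qed

section \<open>Orthogonality\<close>

lemma conj_sum_distinct:
  fixes \<rho> \<sigma> :: "'a \<Rightarrow> 'k::field mat"
  assumes \<rho>: "irreducible_rep G n \<rho>" and \<sigma>: "irreducible_rep G m \<sigma>"
    and X: "X \<in> carrier_mat n m" and ne: "rep_character G \<rho> \<noteq> rep_character G \<sigma>"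
  shows "conj_sum n m \<rho> \<sigma> X = 0\<^sub>m n m"
proof (rule ccontr)
  assume "conj_sum n m \<rho> \<sigma> X \<noteq> 0\<^sub>m n m"
  then show False
    using intertwiner_rep_character_eq[OF \<rho> \<sigma> conj_sum_carrier conj_sum_intertwines] ne X
      irreducible_rep_mat_rep[OF \<rho>] irreducible_rep_mat_rep[OF \<sigma>] by blast
qed

text \<open>Schur's lemma gives a scalar matrix, and comparing traces determines the scalar, because
  conjugation preserves the trace.\<close>

lemma conj_sum_self:
  fixes \<rho> :: "'a \<Rightarrow> 'k::{alg_closed_field, field_char_0} mat"
  assumes \<rho>: "irreducible_rep G n \<rho>" and X: "X \<in> carrier_mat n n"
  shows "conj_sum n n \<rho> \<rho> X = (of_nat (card (carrier G)) * mat_trace X / of_nat n) \<cdot>\<^sub>m 1\<^sub>m n"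
proof -
  note r = irreducible_rep_mat_rep[OF \<rho>]
  have n: "n > 0" using \<rho> by (simp add: irreducible_rep_iff)
  obtain c where c: "conj_sum n n \<rho> \<rho> X = c \<cdot>\<^sub>m 1\<^sub>m n"
    using schur_scalar[OF \<rho> conj_sum_carrier conj_sum_intertwines[OF r r X]] by blast
  have tr: "mat_trace (\<rho> g * X * \<rho> (inv g)) = mat_trace X" if g: "g \<in> carrier G" for g
  proof -
    have m: "\<rho> g \<in> carrier_mat n n" "\<rho> (inv g) \<in> carrier_mat n n"
      using mat_rep_carrier[OF r] g by auto
    have "mat_trace (\<rho> g * X * \<rho> (inv g)) = mat_trace (\<rho> (inv g) * (\<rho> g * X))"
      using m X by (intro mat_trace_mult_comm[of _ n n]) auto
    also have "\<rho> (inv g) * (\<rho> g * X) = X"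
      using assoc_mult_mat[OF m(2,1) X] mat_rep_inv(2)[OF r g] X by simp
    finally show ?thesis .
  qed
  have cm: "\<rho> g * X * \<rho> (inv g) \<in> carrier_mat n n" if "g \<in> carrier G" for g
    using mat_rep_carrier[OF r, of g] mat_rep_carrier[OF r, of "inv g"] that X by auto
  have "mat_trace (conj_sum n n \<rho> \<rho> X) = of_nat (card (carrier G)) * mat_trace X"
    unfolding conj_sum_def mat_trace_msum[OF cm, of "carrier G" "\<lambda>g. g", simplified]
    using tr by simp
  then have "c * of_nat n = of_nat (card (carrier G)) * mat_trace X"
    unfolding c by (simp add: mat_trace_smult[OF one_carrier_mat])
  then have "c = of_nat (card (carrier G)) * mat_trace X / of_nat n" using n by (simp add: field_simps)
  then show ?thesis unfolding c by simp
qed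

text \<open>The usual inner product times the group order, with \<open>inv g\<close> in the role of
  complex conjugation.\<close>

definition char_inner :: "('a \<Rightarrow> 'k::field) \<Rightarrow> ('a \<Rightarrow> 'k) \<Rightarrow> 'k" where
  "char_inner \<chi> \<theta> = (\<Sum>g\<in>carrier G. \<chi> g * \<theta> (inv g))"

lemma mat_unit_entry:
  fixes A B :: "'k::field mat"
  assumes A: "A \<in> carrier_mat n n" and B: "B \<in> carrier_mat m m" and ik: "i < n" "k < m"
  defines "E \<equiv> mat n m (\<lambda>(r, c). if r = i \<and> c = k then 1 else 0)"
  shows "(A * E * B) $$ (i, k) = A $$ (i, i) * B $$ (k, k)"
proof -
  have E: "E \<in> carrier_mat n m" by (simp add: E_def)
  have 1: "(A * E) $$ (i, c) = (if c = k then A $$ (i, i) else 0)" if c: "c < m" for c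
  proof -
    have "(A * E) $$ (i, c) = (\<Sum>r = 0..<n. A $$ (i, r) * E $$ (r, c))"
      using A E c ik by (simp add: scalar_prod_def)
    also have "\<dots> = (\<Sum>r = 0..<n. if r = i then (if c = k then A $$ (i, r) else 0) else 0)"
      using c by (intro sum.cong) (auto simp: E_def)
    also have "\<dots> = (if c = k then A $$ (i, i) else 0)" using ik by simp
    finally show ?thesis .
  qed
  have "(D * B) $$ (i, k) = (\<Sum>c = 0..<m. D $$ (i, c) * B $$ (c, k))" if "D \<in> carrier_mat n m" for D
    using that B ik by (simp add: scalar_prod_def)
  then have "(A * E * B) $$ (i, k) = (\<Sum>c = 0..<m. (A * E) $$ (i, c) * B $$ (c, k))"
    using A E by simp
  also have "\<dots> = (\<Sum>c = 0..<m. if c = k then A $$ (i, i) * B $$ (c, k) else 0)"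
    by (intro sum.cong) (auto simp: 1)
  also have "\<dots> = A $$ (i, i) * B $$ (k, k)" using ik by simp
  finally show ?thesis .
qed

text \<open>A product of two traces is a sum over pairs of diagonal entries, and each such product
  is an entry of \<open>\<rho> g * E * \<sigma> (inv g)\<close> for a matrix unit \<open>E\<close>.
  Orthogonality is thereby reduced to Schur's lemma for averaged matrix units.\<close>

lemma char_inner_conj_sum:
  fixes \<rho> \<sigma> :: "'a \<Rightarrow> 'k::field mat"
  assumes r: "mat_rep G n \<rho>" and s: "mat_rep G m \<sigma>"
  shows "char_inner (rep_character G \<rho>) (rep_character G \<sigma>) =
    (\<Sum>i<n. \<Sum>k<m. conj_sum n m \<rho> \<sigma> (mat n m (\<lambda>(r, c). if r = i \<and> c = k then 1 else 0)) $$ (i, k))"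
proof -
  have 1: "rep_character G \<rho> g * rep_character G \<sigma> (inv g) = (\<Sum>i<n. \<Sum>k<m.
      (\<rho> g * mat n m (\<lambda>(r, c). if r = i \<and> c = k then 1 else 0) * \<sigma> (inv g)) $$ (i, k))"
    if g: "g \<in> carrier G" for g
  proof -
    have c: "\<rho> g \<in> carrier_mat n n" "\<sigma> (inv g) \<in> carrier_mat m m"
      using mat_rep_carrier[OF r] mat_rep_carrier[OF s] g by auto
    have "rep_character G \<rho> g * rep_character G \<sigma> (inv g) =
        (\<Sum>i<n. \<Sum>k<m. \<rho> g $$ (i, i) * \<sigma> (inv g) $$ (k, k))"
      using g by (simp add: rep_character_apply mat_trace_carrier[OF c(1)] mat_trace_carrier[OF c(2)] sum_product)
    also have "\<dots> = (\<Sum>i<n. \<Sum>k<m.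
      (\<rho> g * mat n m (\<lambda>(r, c). if r = i \<and> c = k then 1 else 0) * \<sigma> (inv g)) $$ (i, k))"
      by (intro sum.cong refl mat_unit_entry[OF c, symmetric]) auto
    finally show ?thesis .
  qed
  have "char_inner (rep_character G \<rho>) (rep_character G \<sigma>) = (\<Sum>g\<in>carrier G. \<Sum>i<n. \<Sum>k<m.
      (\<rho> g * mat n m (\<lambda>(r, c). if r = i \<and> c = k then 1 else 0) * \<sigma> (inv g)) $$ (i, k))"
    unfolding char_inner_def by (intro sum.cong refl 1)
  also have "\<dots> = (\<Sum>i<n. \<Sum>k<m. \<Sum>g\<in>carrier G.
      (\<rho> g * mat n m (\<lambda>(r, c). if r = i \<and> c = k then 1 else 0) * \<sigma> (inv g)) $$ (i, k))"
    by (subst sum.swap, intro sum.cong refl, subst sum.swap) (rule refl)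
  also have "\<dots> = (\<Sum>i<n. \<Sum>k<m. conj_sum n m \<rho> \<sigma> (mat n m (\<lambda>(r, c). if r = i \<and> c = k then 1 else 0)) $$ (i, k))"
    by (intro sum.cong refl) (simp add: conj_sum_def)
  finally show ?thesis .
qed

lemma irr_charsE:
  assumes "\<chi> \<in> irr_chars G"
  obtains n \<rho> where "irreducible_rep G n \<rho>" "\<chi> = rep_character G \<rho>"
  using assms by (auto simp: irr_chars_def)

theorem irr_chars_orthogonal:
  fixes \<chi> \<theta> :: "'a \<Rightarrow> 'k::{alg_closed_field, field_char_0}"
  assumes "\<chi> \<in> irr_chars G" "\<theta> \<in> irr_chars G"
  shows "char_inner \<chi> \<theta> = (if \<chi> = \<theta> then of_nat (card (carrier G)) else 0)"
proof -
  obtain n \<rho> where \<rho>: "irreducible_rep G n \<rho>" "\<chi> = rep_character G \<rho>"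
    using assms(1) by (rule irr_charsE)
  note r = irreducible_rep_mat_rep[OF \<rho>(1)]
  show ?thesis
  proof (cases "\<chi> = \<theta>")
    case True
    have n: "n > 0" using \<rho> by (simp add: irreducible_rep_iff)
    have "char_inner \<chi> \<theta> = (\<Sum>i<n. \<Sum>k<n. if k = i then of_nat (card (carrier G)) / of_nat n else 0)"
      unfolding True[symmetric] \<rho>(2) char_inner_conj_sum[OF r r]
    proof (intro sum.cong refl)
      fix i k assume ik: "i \<in> {..<n}" "k \<in> {..<n}"
      have t: "mat_trace (mat n n (\<lambda>(r, c). if r = i \<and> c = k then 1 else 0)) = (if k = i then 1 else 0 :: 'k)"
        using ik by (auto simp: mat_trace_def if_distrib cong: if_cong)
      show "conj_sum n n \<rho> \<rho> (mat n n (\<lambda>(r, c). if r = i \<and> c = k then 1 else 0)) $$ (i, k) =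
          (if k = i then of_nat (card (carrier G)) / of_nat n else 0)"
        using ik by (simp add: conj_sum_self[OF \<rho>(1)] t)
    qed
    then show ?thesis using True n by simp
  next
    case False
    obtain m \<sigma> where \<sigma>: "irreducible_rep G m \<sigma>" "\<theta> = rep_character G \<sigma>"
      using assms(2) by (rule irr_charsE)
    have "conj_sum n m \<rho> \<sigma> (mat n m X) = 0\<^sub>m n m" for X
      using conj_sum_distinct[OF \<rho>(1) \<sigma>(1) mat_carrier] False \<rho>(2) \<sigma>(2) by blast
    then show ?thesis
      unfolding \<rho>(2) \<sigma>(2) char_inner_conj_sum[OF r irreducible_rep_mat_rep[OF \<sigma>(1)]]
      using False \<rho>(2) \<sigma>(2) by simp
  qed
qed

text \<open>The average of \<open>\<rho> y\<close> is a scalar matrix by Schur's lemma; multiplying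
  it by \<open>\<rho> x\<close> and taking traces gives the formula.\<close>

lemma conj_class_sum_character:
  fixes \<rho> :: "'a \<Rightarrow> 'k::{alg_closed_field, field_char_0} mat"
  assumes \<rho>: "irreducible_rep G n \<rho>" and x: "x \<in> carrier G" and y: "y \<in> carrier G"
  shows "of_nat n * (\<Sum>h\<in>carrier G. rep_character G \<rho> (x \<otimes> (h \<otimes> y \<otimes> inv h))) =
    of_nat (card (carrier G)) * rep_character G \<rho> x * rep_character G \<rho> y"
proof -
  note r = irreducible_rep_mat_rep[OF \<rho>]
  note c = mat_rep_carrier[OF r]
  have n: "n > 0" using \<rho> by (simp add: irreducible_rep_iff)
  have cm: "\<rho> h * \<rho> y * \<rho> (inv h) \<in> carrier_mat n n" if "h \<in> carrier G" for h
    using c[OF that] c[OF y] c[of "inv h"] that by auto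
  have "(\<Sum>h\<in>carrier G. rep_character G \<rho> (x \<otimes> (h \<otimes> y \<otimes> inv h))) =
      (\<Sum>h\<in>carrier G. mat_trace (\<rho> x * (\<rho> h * \<rho> y * \<rho> (inv h))))"
    using x y by (intro sum.cong refl) (simp add: rep_character_apply mat_rep_mult[OF r])
  also have "\<dots> = mat_trace (\<rho> x * conj_sum n n \<rho> \<rho> (\<rho> y))"
    unfolding conj_sum_def mult_msum[OF c[OF x] cm, of "carrier G" "\<lambda>g. g", simplified]
    by (rule mat_trace_msum[symmetric]) (use c[OF x] cm in auto)
  also have "\<dots> = mat_trace ((of_nat (card (carrier G)) * mat_trace (\<rho> y) / of_nat n) \<cdot>\<^sub>m \<rho> x)"
    unfolding conj_sum_self[OF \<rho> c[OF y]] using c[OF x] mult_smult_distrib[OF c[OF x] one_carrier_mat]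
    by simp
  also have "\<dots> = (of_nat (card (carrier G)) * mat_trace (\<rho> y) / of_nat n) * mat_trace (\<rho> x)"
    by (rule mat_trace_smult[OF c[OF x]])
  finally show ?thesis using n x y by (simp add: rep_character_apply field_simps)
qed

text \<open>Only traces are decomposed, for which a block-triangular form suffices: an invariant
  subspace and a complement of it yield two diagonal blocks of smaller size, both representations,
  whose traces add up.\<close>

theorem rep_decomposition:
  fixes \<rho> :: "'a \<Rightarrow> 'k::field_char_0 mat"
  assumes "mat_rep G n \<rho>"
  shows "\<exists>cs. set cs \<subseteq> irr_chars G \<and> (\<forall>g\<in>carrier G. mat_trace (\<rho> g) = (\<Sum>\<chi>\<leftarrow>cs. \<chi> g))"
  using assms
proof (induction n arbitrary: \<rho> rule: less_induct)
  case (less n)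
  note r = less.prems
  note c = mat_rep_carrier[OF r]
  consider "n = 0" | "irreducible_rep G n \<rho>" | "n > 0" "\<not> irreducible_rep G n \<rho>" by blast
  then show ?case
  proof cases
    case 1
    then have "\<forall>g\<in>carrier G. mat_trace (\<rho> g) = 0" using mat_trace_carrier[OF c] by simp
    then show ?thesis by (intro exI[of _ "[]"]) simp
  next
    case 2
    then show ?thesis
      by (intro exI[of _ "[rep_character G \<rho>]"]) (auto simp: irr_chars_def rep_character_apply)
  next
    case 3
    then obtain W where W: "vec_subspace n W" "\<And>g w. g \<in> carrier G \<Longrightarrow> w \<in> W \<Longrightarrow> \<rho> g *\<^sub>v w \<in> W"
      "W \<noteq> {0\<^sub>v n}" "W \<noteq> carrier_vec n"
      using r unfolding irreducible_rep_iff by blast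
    have Wn: "W \<subseteq> carrier_vec n" using W(1) by (simp add: vec_subspace_def)
    obtain k A L where A: "A \<in> carrier_mat n k" and L: "L \<in> carrier_mat k n" and LA: "L * A = 1\<^sub>m k"
      and AW: "\<And>v. v \<in> carrier_vec k \<Longrightarrow> A *\<^sub>v v \<in> W"
      and WL: "\<And>w. w \<in> W \<Longrightarrow> A *\<^sub>v (L *\<^sub>v w) = w"
      using W(1) by (rule subspace_splitting) (rule that)
    have AL: "A * L \<in> carrier_mat n n" using A L by auto
    \<comment> \<open>The complementary idempotent, split below as \<open>B * M\<close>. The columns
      of \<open>A\<close> and \<open>B\<close> together form a basis whose coordinate maps are
      \<open>L\<close> and \<open>M\<close>.\<close>
    define F where "F = 1\<^sub>m n - A * L"
    have F: "F \<in> carrier_mat n n" unfolding F_def using AL by (intro minus_carrier_mat)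
    have FA: "F * A = 0\<^sub>m n k"
    proof -
      have "F * A = A - A * L * A" unfolding F_def using A AL minus_mult_distrib_mat[OF one_carrier_mat AL A] by simp
      also have "A * L * A = A" using assoc_mult_mat[OF A L A] LA A by simp
      also have "A - A = 0\<^sub>m n k" using A by auto
      finally show ?thesis .
    qed
    have FF: "F * F = F"
    proof -
      have "F * F = F - F * (A * L)"
        using mult_minus_distrib_mat[OF F one_carrier_mat AL] F by (simp add: F_def[symmetric])
      also have "F * (A * L) = 0\<^sub>m n n" using assoc_mult_mat[OF F A L] FA L by simp
      also have "F - 0\<^sub>m n n = F" using F by (intro eq_matI) auto
      finally show ?thesis .
    qed
    obtain l B M where B: "B \<in> carrier_mat n l" and M: "M \<in> carrier_mat l n" and MB: "M * B = 1\<^sub>m l"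
      and BM: "B * M = F"
      using F FF by (rule idempotent_splitting) (rule that)
    have split: "A * L + B * M = 1\<^sub>m n"
    proof -
      have "X + (1\<^sub>m n - X) = 1\<^sub>m n" if "X \<in> carrier_mat n n" for X :: "'k mat"
        using that by (intro eq_matI) auto
      from this[OF AL] show ?thesis unfolding BM F_def .
    qed
    have MA: "M * A = 0\<^sub>m l k"
    proof -
      have "M * A = (M * B) * (M * A)" using MB M A by simp
      also have "\<dots> = M * (F * A)"
        using assoc_mult_mat[OF M B mult_carrier_mat[OF M A]] assoc_mult_mat[OF B M A] BM M A by simp
      also have "\<dots> = 0\<^sub>m l k" using FA M by simp
      finally show ?thesis .
    qed
    \<comment> \<open>Invariance of \<open>W\<close> as a matrix identity: \<open>A * L\<close>
      fixes every vector of \<open>W\<close>.\<close>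
    have stable: "A * (L * (\<rho> g * A)) = \<rho> g * A" if g: "g \<in> carrier G" for g
    proof (rule mat_eq_by_vec[of _ n k])
      fix v :: "'k vec" assume v: "v \<in> carrier_vec k"
      have "\<rho> g *\<^sub>v (A *\<^sub>v v) \<in> W" using W(2)[OF g AW[OF v]] .
      from WL[OF this] show "A * (L * (\<rho> g * A)) *\<^sub>v v = \<rho> g * A *\<^sub>v v"
        using A L c[OF g] v
        by (simp add: assoc_mult_mat_vec[of _ n k _ k] assoc_mult_mat_vec[of _ k n _ k] assoc_mult_mat_vec[of _ n n _ k])
    qed (use A L c[OF g] in auto)
    have kn: "k + l = n"
    proof -
      have "of_nat n = mat_trace (A * L + B * M)" unfolding split by simp
      also have "\<dots> = mat_trace (A * L) + mat_trace (B * M)"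
        using A L B M by (intro mat_trace_add[of _ n]) auto
      also have "\<dots> = of_nat (k + l)"
        unfolding mat_trace_mult_comm[OF A L] mat_trace_mult_comm[OF B M] LA MB by simp
      finally show ?thesis using of_nat_eq_iff by metis
    qed
    have k0: "k \<noteq> 0"
    proof
      assume k: "k = 0"
      have "w = 0\<^sub>v n" if "w \<in> W" for w
      proof -
        have "w = A *\<^sub>v (L *\<^sub>v w)" using WL[OF that] by simp
        also have "\<dots> = 0\<^sub>v n" using A L k by (intro eq_vecI) (auto simp: scalar_prod_def)
        finally show ?thesis .
      qed
      then show False using W(1,3) by (auto simp: vec_subspace_def)
    qed
    have l0: "l \<noteq> 0"
    proof
      assume "l = 0"
      then have "k = n" using kn by simp
      then have "A * L = 1\<^sub>m n" using mat_mult_left_right_inverse[of L n A] A L LA by simp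
      have "v \<in> W" if v: "v \<in> carrier_vec n" for v
      proof -
        have "v = A *\<^sub>v (L *\<^sub>v v)" using assoc_mult_mat_vec[OF A L v] \<open>A * L = 1\<^sub>m n\<close> v by simp
        then show ?thesis using AW[of "L *\<^sub>v v"] L v by simp
      qed
      then show False using W(4) Wn by blast
    qed
    define \<sigma> where "\<sigma> = (\<lambda>g. L * (\<rho> g * A))"
    define \<tau> where "\<tau> = (\<lambda>g. M * (\<rho> g * B))"
    have \<sigma>c: "\<sigma> g \<in> carrier_mat k k" and \<tau>c: "\<tau> g \<in> carrier_mat l l" if "g \<in> carrier G" for g
      using A L B M c[OF that] by (auto simp: \<sigma>_def \<tau>_def)
    have "mat_rep G k \<sigma>"
      unfolding mat_rep_def
    proof (intro conjI ballI)
      fix g h assume g: "g \<in> carrier G" and h: "h \<in> carrier G"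
      have "\<sigma> g * \<sigma> h = L * ((\<rho> g * A) * (L * (\<rho> h * A)))"
        unfolding \<sigma>_def using A L c[OF g] c[OF h] by (intro assoc_mult_mat) auto
      also have "(\<rho> g * A) * (L * (\<rho> h * A)) = \<rho> g * (A * (L * (\<rho> h * A)))"
        using A L c[OF g] c[OF h] by (intro assoc_mult_mat) auto
      also have "\<dots> = \<rho> g * (\<rho> h * A)" unfolding stable[OF h] ..
      also have "\<dots> = \<rho> (g \<otimes> h) * A"
        unfolding mat_rep_mult[OF r g h] using A c[OF g] c[OF h] by (intro assoc_mult_mat[symmetric]) auto
      finally show "\<sigma> (g \<otimes> h) = \<sigma> g * \<sigma> h" unfolding \<sigma>_def by simp
    qed (use \<sigma>c A LA mat_rep_one[OF r] in \<open>auto simp: \<sigma>_def\<close>)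
    have "mat_rep G l \<tau>"
      unfolding mat_rep_def
    proof (intro conjI ballI)
      fix g h assume g: "g \<in> carrier G" and h: "h \<in> carrier G"
      \<comment> \<open>The block below the diagonal vanishes because \<open>W\<close> is invariant;
        it is the term that would otherwise spoil multiplicativity of \<open>\<tau>\<close>.\<close>
      have z: "M * (\<rho> g * A) = 0\<^sub>m l k"
      proof -
        have "M * (\<rho> g * A) = M * (A * (L * (\<rho> g * A)))" unfolding stable[OF g] ..
        also have "\<dots> = (M * A) * (L * (\<rho> g * A))"
          using M A L c[OF g] by (intro assoc_mult_mat[symmetric]) auto
        also have "\<dots> = 0\<^sub>m l k" unfolding MA using L A c[OF g] by simp
        finally show ?thesis .
      qed
      have hB: "\<rho> h * B \<in> carrier_mat n l" using B c[OF h] by auto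
      have e: "\<rho> h * B = A * (L * (\<rho> h * B)) + B * (M * (\<rho> h * B))"
      proof -
        have "\<rho> h * B = (A * L + B * M) * (\<rho> h * B)" unfolding split left_mult_one_mat[OF hB] ..
        also have "\<dots> = A * L * (\<rho> h * B) + B * M * (\<rho> h * B)"
          by (rule add_mult_distrib_mat[OF mult_carrier_mat[OF A L] mult_carrier_mat[OF B M] hB])
        finally show ?thesis using assoc_mult_mat[OF A L hB] assoc_mult_mat[OF B M hB] by simp
      qed
      have Mg: "M * \<rho> g \<in> carrier_mat l n" using M c[OF g] by auto
      have LhB: "L * (\<rho> h * B) \<in> carrier_mat k l" and MhB: "M * (\<rho> h * B) \<in> carrier_mat l l"
        using L M hB by auto
      have "\<tau> (g \<otimes> h) = M * \<rho> g * (\<rho> h * B)"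
        unfolding \<tau>_def mat_rep_mult[OF r g h]
        using assoc_mult_mat[OF c[OF g] c[OF h] B] assoc_mult_mat[OF M c[OF g] hB] by simp
      also have "\<dots> = M * \<rho> g * (A * (L * (\<rho> h * B))) + M * \<rho> g * (B * (M * (\<rho> h * B)))"
        using mult_add_distrib_mat[OF Mg mult_carrier_mat[OF A LhB] mult_carrier_mat[OF B MhB]]
        unfolding e[symmetric] .
      also have "M * \<rho> g * (A * (L * (\<rho> h * B))) = (M * (\<rho> g * A)) * (L * (\<rho> h * B))"
        using assoc_mult_mat[OF Mg A LhB] assoc_mult_mat[OF M c[OF g] A] by simp
      also have "\<dots> = 0\<^sub>m l l" unfolding z by (rule left_mult_zero_mat[OF LhB])
      also have "M * \<rho> g * (B * (M * (\<rho> h * B))) = \<tau> g * \<tau> h"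
        unfolding \<tau>_def using assoc_mult_mat[OF Mg B MhB] assoc_mult_mat[OF M c[OF g] B] by simp
      also have "0\<^sub>m l l + \<tau> g * \<tau> h = \<tau> g * \<tau> h"
        by (rule left_add_zero_mat[OF mult_carrier_mat[OF \<tau>c[OF g] \<tau>c[OF h]]])
      finally show "\<tau> (g \<otimes> h) = \<tau> g * \<tau> h" .
    qed (use \<tau>c B MB mat_rep_one[OF r] in \<open>auto simp: \<tau>_def\<close>)
    have tr: "mat_trace (\<rho> g) = mat_trace (\<sigma> g) + mat_trace (\<tau> g)" if g: "g \<in> carrier G" for g
    proof -
      have "mat_trace (\<sigma> g) = mat_trace (\<rho> g * (A * L))"
        unfolding \<sigma>_def mat_trace_mult_comm[OF L mult_carrier_mat[OF c[OF g] A]]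
        using assoc_mult_mat[OF c[OF g] A L] by simp
      moreover have "mat_trace (\<tau> g) = mat_trace (\<rho> g * (B * M))"
        unfolding \<tau>_def mat_trace_mult_comm[OF M mult_carrier_mat[OF c[OF g] B]]
        using assoc_mult_mat[OF c[OF g] B M] by simp
      moreover have "mat_trace (\<rho> g) = mat_trace (\<rho> g * (A * L) + \<rho> g * (B * M))"
        using mult_add_distrib_mat[OF c[OF g] mult_carrier_mat[OF A L] mult_carrier_mat[OF B M]] split c[OF g]
        by simp
      ultimately show ?thesis
        using mat_trace_add[of "\<rho> g * (A * L)" n "\<rho> g * (B * M)"] A L B M c[OF g] by auto
    qed
    obtain cs where cs: "set cs \<subseteq> irr_chars G" "\<forall>g\<in>carrier G. mat_trace (\<sigma> g) = (\<Sum>\<chi>\<leftarrow>cs. \<chi> g)"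
      using less.IH[OF _ \<open>mat_rep G k \<sigma>\<close>] kn l0 by auto
    obtain ds where ds: "set ds \<subseteq> irr_chars G" "\<forall>g\<in>carrier G. mat_trace (\<tau> g) = (\<Sum>\<chi>\<leftarrow>ds. \<chi> g)"
      using less.IH[OF _ \<open>mat_rep G l \<tau>\<close>] kn k0 by auto
    show ?thesis
      by (rule exI[of _ "cs @ ds"]) (use cs ds tr in auto)
  qed
qed

section \<open>The regular character and integrality\<close>

lemma irr_char_one:
  fixes \<chi> :: "'a \<Rightarrow> 'k::field_char_0"
  assumes "\<chi> \<in> irr_chars G"
  shows "\<chi> \<one> = of_nat (char_degree G \<chi>)" "char_degree G \<chi> > 0"
proof -
  obtain n \<rho> where \<rho>: "irreducible_rep G n \<rho>" "\<chi> = rep_character G \<rho>"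
    using assms by (rule irr_charsE)
  have "char_degree G \<chi> = n" unfolding \<rho>(2) by (rule rep_character_degree[OF is_group \<rho>(1)])
  moreover have "\<chi> \<one> = of_nat n"
    using mat_rep_one[OF irreducible_rep_mat_rep[OF \<rho>(1)]] unfolding \<rho>(2) by (simp add: rep_character_apply)
  ultimately show "\<chi> \<one> = of_nat (char_degree G \<chi>)" "char_degree G \<chi> > 0"
    using \<rho>(1) by (auto simp: irreducible_rep_iff)
qed

text \<open>Left multiplication written as permutation matrices in an enumeration of the group; an
  element other than the identity fixes no point.\<close>

lemma regular_rep:
  assumes fin: "finite (carrier G)"
  defines "N \<equiv> card (carrier G)"
  shows "\<exists>R :: 'a \<Rightarrow> 'k::field mat. mat_rep G N R \<and>
    (\<forall>g\<in>carrier G. mat_trace (R g) = (if g = \<one> then of_nat N else 0))"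
proof -
  obtain e where e: "bij_betw e {0..<N} (carrier G)"
    using ex_bij_betw_nat_finite[OF fin] N_def by blast
  have eG: "e i \<in> carrier G" if "i < N" for i
    using e that by (auto simp: bij_betw_def)
  have einj: "e i = e j \<longleftrightarrow> i = j" if "i < N" "j < N" for i j
    using e that by (auto simp: bij_betw_def inj_on_def)
  have esurj: "\<exists>i<N. e i = g" if "g \<in> carrier G" for g
  proof -
    have "g \<in> e ` {0..<N}" using e that by (simp add: bij_betw_def)
    then show ?thesis by auto
  qed
  define R :: "'a \<Rightarrow> 'k mat" where "R = (\<lambda>g. mat N N (\<lambda>(i, j). if e i = g \<otimes> e j then 1 else 0))"
  have "mat_rep G N R"
    unfolding mat_rep_def
  proof (intro conjI ballI)
    fix g h assume g: "g \<in> carrier G" and h: "h \<in> carrier G"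
    show "R (g \<otimes> h) = R g * R h"
    proof (rule eq_matI)
      fix i j assume "i < dim_row (R g * R h)" "j < dim_col (R g * R h)"
      then have ij: "i < N" "j < N" by (auto simp: R_def)
      obtain k where k: "k < N" "e k = h \<otimes> e j" using esurj[of "h \<otimes> e j"] h eG[OF ij(2)] by auto
      have "(R g * R h) $$ (i, j) = (\<Sum>l = 0..<N. R g $$ (i, l) * R h $$ (l, j))"
        using ij by (simp add: R_def scalar_prod_def)
      also have "\<dots> = (\<Sum>l = 0..<N. if l = k then (if e i = g \<otimes> e l then 1 else 0) else 0)"
        using ij k by (intro sum.cong) (auto simp: R_def einj simp flip: k(2))
      also have "\<dots> = (if e i = g \<otimes> e k then 1 else 0)" using k by simp
      also have "\<dots> = R (g \<otimes> h) $$ (i, j)"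
        using ij g h eG[OF ij(2)] by (simp add: R_def k(2) m_assoc)
      finally show "R (g \<otimes> h) $$ (i, j) = (R g * R h) $$ (i, j)" by simp
    qed (auto simp: R_def)
  next
    show "R \<one> = 1\<^sub>m N"
      by (rule eq_matI) (auto simp: R_def eG einj)
  qed (auto simp: R_def)
  moreover have "mat_trace (R g) = (if g = \<one> then of_nat N else 0)" if g: "g \<in> carrier G" for g
  proof -
    have "mat_trace (R g) = (\<Sum>i<N. if e i = g \<otimes> e i then 1 else 0)" by (simp add: mat_trace_def R_def)
    also have "\<dots> = (\<Sum>i<N. if g = \<one> then 1 else 0)"
      using g eG by (intro sum.cong refl if_cong) (auto simp: r_cancel_one')
    finally show ?thesis by simp
  qed
  ultimately show ?thesis by blast
qed

text \<open>Pairing the regular character with \<open>\<chi>\<close> shows that the multiplicity of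
  \<open>\<chi>\<close> in the list \<open>cs\<close> is its degree, which is positive. Hence this
  finite list contains every irreducible character, which gives finiteness and the sum formula
  together.\<close>

theorem regular_character:
  assumes fin: "finite (carrier G)"
  shows finite_irr_chars: "finite (irr_chars G :: ('a \<Rightarrow> 'k::{alg_closed_field, field_char_0}) set)"
    and regular_character_sum: "g \<in> carrier G \<Longrightarrow>
      (\<Sum>\<chi>\<in>irr_chars G. of_nat (char_degree G \<chi>) * \<chi> g) =
        (if g = \<one> then of_nat (card (carrier G)) else (0 :: 'k))"
proof -
  define N where "N = card (carrier G)"
  have N: "N > 0" using fin by (auto simp: N_def card_gt_0_iff)
  obtain R :: "'a \<Rightarrow> 'k mat" where R: "mat_rep G N R"
    "\<forall>g\<in>carrier G. mat_trace (R g) = (if g = \<one> then of_nat N else 0)"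
    using regular_rep[OF fin] N_def by blast
  obtain cs where cs: "set cs \<subseteq> irr_chars G" "\<forall>g\<in>carrier G. mat_trace (R g) = (\<Sum>\<chi>\<leftarrow>cs. \<chi> g)"
    using rep_decomposition[OF R(1)] by blast
  have mult: "count_list cs \<chi> = char_degree G \<chi>" if \<chi>: "\<chi> \<in> irr_chars G" for \<chi>
  proof -
    have "of_nat N * \<chi> \<one> = (\<Sum>g\<in>carrier G. (if g = \<one> then of_nat N * \<chi> \<one> else 0))"
      using fin by simp
    also have "\<dots> = (\<Sum>g\<in>carrier G. (\<Sum>\<theta>\<leftarrow>cs. \<theta> g) * \<chi> (inv g))"
    proof (rule sum.cong[OF refl])
      fix g assume g: "g \<in> carrier G"
      have "(\<Sum>\<theta>\<leftarrow>cs. \<theta> g) = (if g = \<one> then of_nat N else 0)" using R(2) cs(2) g by simp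
      then show "(if g = \<one> then of_nat N * \<chi> \<one> else 0) = (\<Sum>\<theta>\<leftarrow>cs. \<theta> g) * \<chi> (inv g)" by simp
    qed
    also have "\<dots> = (\<Sum>\<theta>\<leftarrow>cs. char_inner \<theta> \<chi>)"
      by (induction cs) (simp_all add: char_inner_def distrib_right sum.distrib)
    also have "\<dots> = (\<Sum>\<theta>\<leftarrow>cs. if \<theta> = \<chi> then of_nat N else 0)"
      using cs(1) \<chi> by (intro arg_cong[where f=sum_list] map_cong refl)
        (auto simp: irr_chars_orthogonal N_def)
    also have "\<dots> = of_nat N * of_nat (count_list cs \<chi>)"
      by (induction cs) (auto simp: algebra_simps)
    finally have "\<chi> \<one> = of_nat (count_list cs \<chi>)" using N by simp
    then show ?thesis using irr_char_one(1)[OF \<chi>] by simp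
  qed
  have set_cs: "irr_chars G = set cs"
  proof
    show "irr_chars G \<subseteq> set cs"
    proof
      fix \<chi> :: "'a \<Rightarrow> 'k" assume "\<chi> \<in> irr_chars G"
      then have "count_list cs \<chi> \<noteq> 0" using mult irr_char_one(2) by fastforce
      then show "\<chi> \<in> set cs" by (simp add: count_list_0_iff)
    qed
  qed (rule cs(1))
  then show "finite (irr_chars G :: ('a \<Rightarrow> 'k) set)" by simp
  show "(\<Sum>\<chi>\<in>irr_chars G. of_nat (char_degree G \<chi>) * \<chi> g) =
        (if g = \<one> then of_nat (card (carrier G)) else (0 :: 'k))" if g: "g \<in> carrier G"
  proof -
    have "(\<Sum>\<chi>\<leftarrow>cs. \<chi> g) = (\<Sum>\<chi>\<in>set cs. of_nat (count_list cs \<chi>) * \<chi> g)"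
    proof (induction cs)
      case (Cons c cs)
      have "(\<Sum>\<chi>\<in>set (c # cs). of_nat (count_list (c # cs) \<chi>) * \<chi> g) =
          (\<Sum>\<chi>\<in>set (c # cs). of_nat (count_list cs \<chi>) * \<chi> g + (if \<chi> = c then \<chi> g else 0))"
        by (intro sum.cong) (auto simp: algebra_simps)
      also have "\<dots> = (\<Sum>\<chi>\<in>set (c # cs). of_nat (count_list cs \<chi>) * \<chi> g) + c g"
        by (simp add: sum.distrib)
      also have "(\<Sum>\<chi>\<in>set (c # cs). of_nat (count_list cs \<chi>) * \<chi> g) =
          (\<Sum>\<chi>\<in>set cs. of_nat (count_list cs \<chi>) * \<chi> g)"
        by (rule sum.mono_neutral_right) (auto simp: count_list_0_iff)
      finally show ?case using Cons.IH by simp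
    qed simp
    also have "\<dots> = (\<Sum>\<chi>\<in>irr_chars G. of_nat (char_degree G \<chi>) * \<chi> g)"
      unfolding set_cs[symmetric] by (intro sum.cong refl) (simp add: mult)
    finally have "mat_trace (R g) = (\<Sum>\<chi>\<in>irr_chars G. of_nat (char_degree G \<chi>) * \<chi> g)"
      using cs(2) g by simp
    then show ?thesis using R(2) g unfolding N_def by metis
  qed
qed

text \<open>The hypothesis \<open>nc\<close> says that \<open>x\<close> is not conjugate to the
  inverse of \<open>y\<close>. Summing \<open>conj_class_sum_character\<close> over all characters
  produces values of the regular character at the elements
  \<open>x \<otimes> (h \<otimes> y \<otimes> inv h)\<close>, none of which is the identity.\<close>

theorem column_orthogonality:
  fixes x y :: 'a
  assumes fin: "finite (carrier G)" and x: "x \<in> carrier G" and y: "y \<in> carrier G"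
    and nc: "\<And>h. h \<in> carrier G \<Longrightarrow> x \<otimes> (h \<otimes> y \<otimes> inv h) \<noteq> \<one>"
  shows "(\<Sum>\<chi>\<in>irr_chars G. \<chi> x * \<chi> y) = (0 :: 'k::{alg_closed_field, field_char_0})"
proof -
  have N: "card (carrier G) > 0" using fin by (auto simp: card_gt_0_iff)
  have "of_nat (card (carrier G)) * (\<Sum>\<chi>\<in>irr_chars G. \<chi> x * \<chi> y) =
      (\<Sum>\<chi>\<in>irr_chars G. of_nat (char_degree G \<chi>) * (\<Sum>h\<in>carrier G. \<chi> (x \<otimes> (h \<otimes> y \<otimes> inv h))) :: 'k)"
    unfolding sum_distrib_left
  proof (rule sum.cong[OF refl])
    fix \<chi> :: "'a \<Rightarrow> 'k" assume "\<chi> \<in> irr_chars G"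
    then obtain n \<rho> where \<rho>: "irreducible_rep G n \<rho>" "\<chi> = rep_character G \<rho>" by (rule irr_charsE)
    show "of_nat (card (carrier G)) * (\<chi> x * \<chi> y) =
        (\<Sum>h\<in>carrier G. of_nat (char_degree G \<chi>) * \<chi> (x \<otimes> (h \<otimes> y \<otimes> inv h)))"
      unfolding \<rho>(2) rep_character_degree[OF is_group \<rho>(1)]
      using conj_class_sum_character[OF \<rho>(1) x y] by (simp add: sum_distrib_left mult.assoc)
  qed
  also have "\<dots> = (\<Sum>h\<in>carrier G. \<Sum>\<chi>\<in>irr_chars G. of_nat (char_degree G \<chi>) * \<chi> (x \<otimes> (h \<otimes> y \<otimes> inv h)))"
    by (subst sum.swap) (simp add: sum_distrib_left)
  also have "\<dots> = 0"
    by (rule sum.neutral) (use x y nc in \<open>simp add: regular_character_sum[OF fin]\<close>)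
  finally show ?thesis using N by simp
qed

text \<open>The corner entries \<open>\<rho> h $$ (0, 0)\<close> span a finitely generated integer
  module: multiplying by \<open>w\<close> is acting with the integral group ring element
  \<open>f\<close>, which permutes and combines these entries. The entry at the identity is
  1.\<close>

lemma algebraic_int_central_scalar:
  fixes \<rho> :: "'a \<Rightarrow> 'k::field_char_0 mat"
  assumes fin: "finite (carrier G)" and r: "mat_rep G n \<rho>" and n: "n > 0"
    and eq: "msum n n (\<lambda>g. of_int (f g) \<cdot>\<^sub>m \<rho> g) (carrier G) = w \<cdot>\<^sub>m 1\<^sub>m n"
  shows "algebraic_int w"
proof (rule algebraic_int_eigenvalue[where S="carrier G" and s=\<one> and v="\<lambda>h. \<rho> h $$ (0, 0)"
      and c="\<lambda>h k. f (k \<otimes> inv h)"])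
  show "\<rho> \<one> $$ (0, 0) \<noteq> 0" using mat_rep_one[OF r] n by simp
  fix h assume h: "h \<in> carrier G"
  note c = mat_rep_carrier[OF r]
  have "w * \<rho> h $$ (0, 0) = ((w \<cdot>\<^sub>m 1\<^sub>m n) * \<rho> h) $$ (0, 0)"
    using mult_smult_assoc_mat[OF one_carrier_mat c[OF h], of w] c[OF h] n by simp
  also have "(w \<cdot>\<^sub>m 1\<^sub>m n) * \<rho> h = msum n n (\<lambda>g. (of_int (f g) \<cdot>\<^sub>m \<rho> g) * \<rho> h) (carrier G)"
    unfolding eq[symmetric] by (rule msum_mult[OF c[OF h]]) (simp add: c)
  also have "\<dots> $$ (0, 0) = (\<Sum>g\<in>carrier G. of_int (f g) * \<rho> (g \<otimes> h) $$ (0, 0))"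
  proof -
    have "((of_int (f g) \<cdot>\<^sub>m \<rho> g) * \<rho> h) $$ (0, 0) = of_int (f g) * \<rho> (g \<otimes> h) $$ (0, 0)"
      if g: "g \<in> carrier G" for g
    proof -
      have "(of_int (f g) \<cdot>\<^sub>m \<rho> g) * \<rho> h = of_int (f g) \<cdot>\<^sub>m \<rho> (g \<otimes> h)"
        using mult_smult_assoc_mat[OF c[OF g] c[OF h]] mat_rep_mult[OF r g h] by simp
      then show ?thesis using c[of "g \<otimes> h"] g h n by simp
    qed
    then show ?thesis using n by simp
  qed
  also have "\<dots> = (\<Sum>g\<in>carrier G. of_int (f (g \<otimes> h \<otimes> inv h)) * \<rho> (g \<otimes> h) $$ (0, 0))"
    using h by (intro sum.cong refl) (simp add: m_assoc)
  also have "\<dots> = (\<Sum>k\<in>carrier G. of_int (f (k \<otimes> inv h)) * \<rho> k $$ (0, 0))"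
    by (rule sum.reindex_bij_betw[OF bij_betw_right_mult[OF h]])
  finally show "w * \<rho> h $$ (0, 0) = (\<Sum>k\<in>carrier G. of_int (f (k \<otimes> inv h)) * \<rho> k $$ (0, 0))" .
qed (use fin in auto)

text \<open>A nonempty fibre of \<open>h \<mapsto> h \<otimes> x \<otimes> inv h\<close> is a left
  coset of the centraliser of \<open>x\<close>, which contains \<open>P\<close>. Thus a sum over
  conjugates can be divided by the order of \<open>P\<close> and keep integer coefficients.\<close>

lemma card_conj_fiber_dvd:
  assumes fin: "finite (carrier G)" and x: "x \<in> carrier G"
    and P: "subgroup P G" and comm: "\<And>t. t \<in> P \<Longrightarrow> t \<otimes> x = x \<otimes> t"
  shows "card P dvd card {h \<in> carrier G. h \<otimes> x \<otimes> inv h = g}"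
proof (cases "\<exists>h\<in>carrier G. h \<otimes> x \<otimes> inv h = g")
  case False
  then have "{h \<in> carrier G. h \<otimes> x \<otimes> inv h = g} = {}" by blast
  then show ?thesis by (metis card.empty dvd_0_right)
next
  case True
  then obtain h0 where h0: "h0 \<in> carrier G" "h0 \<otimes> x \<otimes> inv h0 = g" by blast
  define C where "C = {t \<in> carrier G. t \<otimes> x = x \<otimes> t}"
  have C: "subgroup C G"
  proof (rule subgroupI)
    fix t assume "t \<in> C"
    then have t: "t \<in> carrier G" "t \<otimes> x = x \<otimes> t" by (auto simp: C_def)
    have "inv t \<otimes> x = inv t \<otimes> (x \<otimes> t) \<otimes> inv t" using t(1) x by (simp add: m_assoc)
    also have "\<dots> = x \<otimes> inv t" unfolding t(2)[symmetric] using t(1) x by (simp add: m_assoc[symmetric])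
    finally show "inv t \<in> C" using t by (simp add: C_def)
  next
    fix s t assume "s \<in> C" "t \<in> C"
    then have st: "s \<in> carrier G" "s \<otimes> x = x \<otimes> s" "t \<in> carrier G" "t \<otimes> x = x \<otimes> t" by (auto simp: C_def)
    have "s \<otimes> t \<otimes> x = s \<otimes> (x \<otimes> t)" unfolding st(4)[symmetric] using st(1,3) x by (rule m_assoc)
    also have "\<dots> = s \<otimes> x \<otimes> t" using st(1,3) x by (simp add: m_assoc)
    also have "\<dots> = x \<otimes> (s \<otimes> t)" unfolding st(2) using st(1,3) x by (simp add: m_assoc)
    finally show "s \<otimes> t \<in> C" using st by (simp add: C_def)
  qed (use x in \<open>auto simp: C_def\<close>)
  have PC: "P \<subseteq> C" using comm subgroup.subset[OF P] by (auto simp: C_def)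
  interpret GC: group "G\<lparr>carrier := C\<rparr>" by (rule subgroup.subgroup_is_group[OF C is_group])
  have "subgroup P (G\<lparr>carrier := C\<rparr>)" by (rule subgroup_incl[OF P C PC])
  from GC.lagrange[OF this] have "card C = card (rcosets\<^bsub>G\<lparr>carrier := C\<rparr>\<^esub> P) * card P"
    by (simp add: Coset.order_def)
  then have "card P dvd card C" by simp
  moreover have "bij_betw (\<lambda>t. h0 \<otimes> t) C {h \<in> carrier G. h \<otimes> x \<otimes> inv h = g}"
  proof (rule bij_betw_byWitness[where f'="\<lambda>h. inv h0 \<otimes> h"])
    show "\<forall>a\<in>C. inv h0 \<otimes> (h0 \<otimes> a) = a" using h0 by (auto simp: C_def m_assoc[symmetric])
    show "\<forall>a'\<in>{h \<in> carrier G. h \<otimes> x \<otimes> inv h = g}. h0 \<otimes> (inv h0 \<otimes> a') = a'"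
      using h0 by (auto simp: m_assoc[symmetric])
    show "(\<lambda>t. h0 \<otimes> t) ` C \<subseteq> {h \<in> carrier G. h \<otimes> x \<otimes> inv h = g}"
    proof clarify
      fix t assume "t \<in> C"
      then have t: "t \<in> carrier G" "t \<otimes> x = x \<otimes> t" by (auto simp: C_def)
      have "h0 \<otimes> t \<otimes> x \<otimes> inv (h0 \<otimes> t) = h0 \<otimes> (t \<otimes> x) \<otimes> inv t \<otimes> inv h0"
        using t(1) x h0(1) by (simp add: m_assoc inv_mult_group)
      also have "\<dots> = h0 \<otimes> x \<otimes> inv h0" unfolding t(2) using t(1) x h0(1) by (simp add: m_assoc)
      finally show "h0 \<otimes> t \<in> carrier G \<and> h0 \<otimes> t \<otimes> x \<otimes> inv (h0 \<otimes> t) = g" using h0 t by simp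
    qed
    show "(\<lambda>h. inv h0 \<otimes> h) ` {h \<in> carrier G. h \<otimes> x \<otimes> inv h = g} \<subseteq> C"
    proof clarify
      fix h assume h: "h \<in> carrier G" and g: "g = h \<otimes> x \<otimes> inv h"
      have "inv h0 \<otimes> h \<otimes> x = inv h0 \<otimes> (h \<otimes> x \<otimes> inv h) \<otimes> h" using h h0(1) x by (simp add: m_assoc)
      also have "\<dots> = inv h0 \<otimes> (h0 \<otimes> x \<otimes> inv h0) \<otimes> h" using g h0(2) by simp
      also have "\<dots> = x \<otimes> (inv h0 \<otimes> h)" using h h0(1) x by (simp add: m_assoc[symmetric])
      finally show "inv h0 \<otimes> h \<in> C" using h h0(1) by (simp add: C_def)
    qed
  qed
  then have "card C = card {h \<in> carrier G. h \<otimes> x \<otimes> inv h = g}" by (rule bij_betw_same_card)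
  ultimately show ?thesis by simp
qed

text \<open>An integer multiple of the central character at the class of \<open>x\<close>: the class
  size divides the index of any subgroup centralising \<open>x\<close>. With \<open>P\<close> a
  Sylow subgroup the factor in front is prime to \<open>p\<close>; with \<open>P\<close> trivial the
  statement applies to every \<open>x\<close>.\<close>

lemma algebraic_int_class_scalar:
  fixes \<rho> :: "'a \<Rightarrow> 'k::{alg_closed_field, field_char_0} mat"
  assumes fin: "finite (carrier G)" and \<rho>: "irreducible_rep G n \<rho>" and x: "x \<in> carrier G"
    and P: "subgroup P G" and comm: "\<And>t. t \<in> P \<Longrightarrow> t \<otimes> x = x \<otimes> t"
  shows "algebraic_int (of_nat (card (carrier G) div card P) * rep_character G \<rho> x / of_nat n)"
proof -
  note r = irreducible_rep_mat_rep[OF \<rho>]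
  note c = mat_rep_carrier[OF r]
  have n: "n > 0" using \<rho> by (simp add: irreducible_rep_iff)
  have finP: "finite P" using subgroup.subset[OF P] fin finite_subset by blast
  have P0: "card P > 0" using finP subgroup.one_closed[OF P] by (auto simp: card_gt_0_iff)
  have PG: "card P dvd card (carrier G)"
    using lagrange[OF P] by (metis dvd_triv_right Coset.order_def)
  have Nq: "of_nat (card (carrier G)) = (of_nat (card P) * of_nat (card (carrier G) div card P) :: 'k)"
    using PG by (metis dvd_mult_div_cancel of_nat_mult)
  \<comment> \<open>How often \<open>g\<close> occurs as a conjugate of \<open>x\<close>, counted in
    units of the order of \<open>P\<close>.\<close>
  define f where "f = (\<lambda>g. card {h \<in> carrier G. h \<otimes> x \<otimes> inv h = g} div card P)"
  have f: "card {h \<in> carrier G. h \<otimes> x \<otimes> inv h = g} = card P * f g" for g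
    using card_conj_fiber_dvd[OF fin x P comm, of g] by (simp add: f_def)
  have cs: "conj_sum n n \<rho> \<rho> (\<rho> x) = of_nat (card P) \<cdot>\<^sub>m msum n n (\<lambda>g. of_int (int (f g)) \<cdot>\<^sub>m \<rho> g) (carrier G)"
  proof (rule eq_matI)
    fix i j assume "i < dim_row (of_nat (card P) \<cdot>\<^sub>m msum n n (\<lambda>g. of_int (int (f g)) \<cdot>\<^sub>m \<rho> g) (carrier G))"
      "j < dim_col (of_nat (card P) \<cdot>\<^sub>m msum n n (\<lambda>g. of_int (int (f g)) \<cdot>\<^sub>m \<rho> g) (carrier G))"
    then have ij: "i < n" "j < n" by auto
    have e: "(of_int (int (f g)) \<cdot>\<^sub>m \<rho> g) $$ (i, j) = of_nat (f g) * \<rho> g $$ (i, j)" if "g \<in> carrier G" for g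
      using c[OF that] ij by simp
    have "conj_sum n n \<rho> \<rho> (\<rho> x) $$ (i, j) = (\<Sum>h\<in>carrier G. \<rho> (h \<otimes> x \<otimes> inv h) $$ (i, j))"
      using ij x by (simp add: conj_sum_def mat_rep_mult[OF r])
    also have "\<dots> = (\<Sum>g\<in>carrier G. \<Sum>h\<in>{h \<in> carrier G. h \<otimes> x \<otimes> inv h = g}. \<rho> (h \<otimes> x \<otimes> inv h) $$ (i, j))"
      using x by (intro sum.group[symmetric] fin) auto
    also have "\<dots> = (\<Sum>g\<in>carrier G. of_nat (card P * f g) * \<rho> g $$ (i, j))"
      unfolding f[symmetric] by (intro sum.cong refl) simp
    also have "\<dots> = of_nat (card P) * (\<Sum>g\<in>carrier G. of_nat (f g) * \<rho> g $$ (i, j))"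
      by (simp add: sum_distrib_left mult.assoc)
    finally show "conj_sum n n \<rho> \<rho> (\<rho> x) $$ (i, j) =
      (of_nat (card P) \<cdot>\<^sub>m msum n n (\<lambda>g. of_int (int (f g)) \<cdot>\<^sub>m \<rho> g) (carrier G)) $$ (i, j)"
      using ij e by simp
  qed (auto simp: conj_sum_def)
  have "msum n n (\<lambda>g. of_int (int (f g)) \<cdot>\<^sub>m \<rho> g) (carrier G) =
      (of_nat (card (carrier G) div card P) * rep_character G \<rho> x / of_nat n) \<cdot>\<^sub>m 1\<^sub>m n" (is "?M = ?w \<cdot>\<^sub>m _")
  proof (rule eq_matI)
    fix i j assume "i < dim_row (?w \<cdot>\<^sub>m 1\<^sub>m n)" "j < dim_col (?w \<cdot>\<^sub>m 1\<^sub>m n)"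
    then have ij: "i < n" "j < n" by auto
    have "of_nat (card P) * ?M $$ (i, j) = conj_sum n n \<rho> \<rho> (\<rho> x) $$ (i, j)"
      unfolding cs using ij by simp
    also have "\<dots> = of_nat (card P) * (?w \<cdot>\<^sub>m 1\<^sub>m n) $$ (i, j)"
      unfolding conj_sum_self[OF \<rho> c[OF x]] using ij x P0 Nq
      by (simp add: rep_character_apply)
    finally show "?M $$ (i, j) = (?w \<cdot>\<^sub>m 1\<^sub>m n) $$ (i, j)" using P0 by simp
  qed auto
  then show ?thesis by (rule algebraic_int_central_scalar[OF fin r n])
qed

text \<open>Orthogonality evaluates a sum of products of central character values to
  \<open>N ^ 3 / n ^ 2\<close>, so \<open>n ^ 2\<close> divides \<open>N ^ 3\<close>, which is
  enough for prime divisors. Taking central characters in both factors avoids integrality of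
  \<open>\<chi>\<close> itself at elements of arbitrary order.\<close>

theorem prime_dvd_degree_imp_dvd_card:
  fixes \<rho> :: "'a \<Rightarrow> 'k::{alg_closed_field, field_char_0} mat"
  assumes fin: "finite (carrier G)" and \<rho>: "irreducible_rep G n \<rho>" and p: "prime p" "p dvd n"
  shows "p dvd card (carrier G)"
proof -
  have n: "n > 0" using \<rho> by (simp add: irreducible_rep_iff)
  define N where "N = card (carrier G)"
  define \<chi> where "\<chi> = rep_character G \<rho>"
  have a: "algebraic_int (of_nat N * \<chi> g / of_nat n)" if "g \<in> carrier G" for g
    using algebraic_int_class_scalar[OF fin \<rho> that triv_subgroup] that by (simp add: N_def \<chi>_def)
  have "algebraic_int (\<Sum>g\<in>carrier G. (of_nat N * \<chi> g / of_nat n) * (of_nat N * \<chi> (inv g) / of_nat n))"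
    by (intro algebraic_int_sum algebraic_int_mult a) auto
  also have "(\<Sum>g\<in>carrier G. (of_nat N * \<chi> g / of_nat n) * (of_nat N * \<chi> (inv g) / of_nat n)) =
      of_nat N ^ 2 / of_nat n ^ 2 * char_inner \<chi> \<chi>"
    unfolding char_inner_def sum_distrib_left by (intro sum.cong refl) (simp add: power2_eq_square)
  also have "char_inner \<chi> \<chi> = of_nat N"
    using irr_chars_orthogonal[of \<chi> \<chi>] \<rho> by (auto simp: \<chi>_def irr_chars_def N_def)
  finally have "algebraic_int (of_nat (N ^ 3) / of_nat (n ^ 2) :: 'k)"
    by (simp add: power3_eq_cube power2_eq_square)
  then have "n ^ 2 dvd N ^ 3" using n by (intro algebraic_int_of_nat_divide) auto
  then have "p dvd N ^ 3" using p(2) by (meson dvd_trans dvd_power_same dvd_power zero_less_numeral)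
  then show ?thesis unfolding N_def using p(1) prime_dvd_power by blast
qed

end

section \<open>Matrices of prime order\<close>

lemma sum_cyclic_shift:
  fixes f :: "nat \<Rightarrow> 'k::ab_group_add"
  assumes "f p = f 0"
  shows "(\<Sum>i<p. f (Suc i)) = (\<Sum>i<p. f i)"
  using sum.lessThan_Suc[of f p] sum.lessThan_Suc_shift[of f p] assms by simp

lemma sum_powers_root_of_unity:
  fixes w :: "'k::field"
  assumes "w ^ p = 1" "w \<noteq> 1"
  shows "(\<Sum>i<p. w ^ i) = 0"
proof -
  have "w * (\<Sum>i<p. w ^ i) = (\<Sum>i<p. w ^ Suc i)" by (simp add: sum_distrib_left)
  also have "\<dots> = (\<Sum>i<p. w ^ i)" using sum_cyclic_shift[of "\<lambda>i. w ^ i" p] assms(1) by simp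
  finally have "(w - 1) * (\<Sum>i<p. w ^ i) = 0" by (simp add: algebra_simps)
  then show ?thesis using assms(2) by simp
qed

lemma primitive_root_of_unity_exists:
  assumes p: "prime p"
  obtains z :: "'k::{alg_closed_field, field_char_0}" where
    "z ^ p = 1" "\<And>i. 0 < i \<Longrightarrow> i < p \<Longrightarrow> z ^ i \<noteq> 1"
proof -
  have p1: "p > 1" using p prime_gt_1_nat by blast
  \<comment> \<open>A root of the \<open>p\<close>-th cyclotomic polynomial; it differs from 1
    because \<open>p\<close> is nonzero in characteristic 0.\<close>
  obtain z :: 'k where "(\<Sum>k\<le>p - 1. 1 * z ^ k) = 0"
    using alg_closed[of "p - 1" "\<lambda>_. 1"] p1 by auto
  moreover have "{..p - 1} = {..<p}" using p1 by auto
  ultimately have z: "(\<Sum>k<p. z ^ k) = 0" by simp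
  have z1: "z \<noteq> 1" using z p1 by auto
  have "z * (\<Sum>k<p. z ^ k) + 1 = (\<Sum>k<p. z ^ k) + z ^ p"
    using sum.lessThan_Suc[of "\<lambda>i. z ^ i" p] sum.lessThan_Suc_shift[of "\<lambda>i. z ^ i" p]
    by (simp add: sum_distrib_left)
  then have zp: "z ^ p = 1" using z by simp
  have "z ^ i \<noteq> 1" if i: "0 < i" "i < p" for i
  proof
    assume zi: "z ^ i = 1"
    have "\<not> p dvd i" using i by (simp add: nat_dvd_not_less)
    then have "coprime p i" using prime_imp_coprime p by blast
    then have "gcd p i = 1" by (rule coprime_imp_gcd_eq_1)
    then have "gcd i p = 1" by (simp only: gcd.commute[of i p])
    then obtain x y where "i * x = p * y + 1" using bezout_nat[of i p] i by auto
    then have "z ^ (i * x) = z ^ (p * y) * z" by simp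
    then show False using zi zp z1 by (simp add: power_mult)
  qed
  then show ?thesis using that zp by blast
qed

text \<open>In the binomial expansion the inner coefficients are divisible by \<open>p\<close>, and
  the two end terms add up to \<open>(- 1) ^ p + 1\<close>, which is 0 for odd \<open>p\<close> and
  2 for \<open>p = 2\<close>. This takes the place of the ramification of \<open>p\<close> in the
  cyclotomic ring.\<close>

lemma algebraic_int_root_of_unity_diff_power:
  fixes w :: "'k::field_char_0"
  assumes p: "prime p" and w: "w ^ p = 1"
  shows "algebraic_int ((w - 1) ^ p / of_nat p)"
proof -
  have p1: "p > 1" using p prime_gt_1_nat by blast
  have wi: "algebraic_int w" using algebraic_int_root_of_unity[OF w] p1 by simp
  have ends: "algebraic_int (((- 1) ^ p + 1) / of_nat p :: 'k)"
  proof (cases "p = 2")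
    case False
    then have "odd p" using p p1 prime_odd_nat by auto
    then show ?thesis by simp
  qed simp
  have mid: "algebraic_int (of_nat (p choose k) * w ^ k * (- 1) ^ (p - k) / of_nat p)"
    if k: "k \<in> {1..<p}" for k
  proof -
    have "p dvd (p choose k)" using k p by (intro dvd_choose_prime) auto
    then obtain m where m: "p choose k = p * m" by blast
    have "of_nat (p choose k) * w ^ k * (- 1) ^ (p - k) / of_nat p = of_nat m * (w ^ k * (- 1) ^ (p - k))"
      using p1 by (simp add: m)
    also have "algebraic_int \<dots>"
      by (intro algebraic_int_mult algebraic_int_power wi) auto
    finally show ?thesis .
  qed
  have "(w - 1) ^ p = (w + - 1) ^ p" by simp
  also have "\<dots> = (\<Sum>k\<le>p. of_nat (p choose k) * w ^ k * (- 1) ^ (p - k))"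
    by (rule binomial_ring)
  also have "{..p} = insert 0 (insert p {1..<p})" using p1 by auto
  also have "(\<Sum>k\<in>\<dots>. of_nat (p choose k) * w ^ k * (- 1) ^ (p - k)) =
      ((- 1) ^ p + 1) + (\<Sum>k = 1..<p. of_nat (p choose k) * w ^ k * (- 1) ^ (p - k))"
    using p1 w by (subst sum.insert; simp)
  finally have "(w - 1) ^ p / of_nat p = ((- 1) ^ p + 1) / of_nat p +
      (\<Sum>k = 1..<p. of_nat (p choose k) * w ^ k * (- 1) ^ (p - k) / of_nat p)"
    by (simp add: add_divide_distrib sum_divide_distrib)
  also have "algebraic_int \<dots>"
    by (intro algebraic_int_add ends algebraic_int_sum mid)
  finally show ?thesis .
qed

text \<open>Raising to the \<open>p\<close>-th power makes \<open>m ^ p\<close> divisible by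
  \<open>p\<close>, first as an algebraic integer and then as an integer. The lemma replaces the
  statement that the prime ideal above \<open>p\<close> meets the integers in the multiples of
  \<open>p\<close>.\<close>

lemma prime_dvd_of_root_of_unity_diff_multiple:
  fixes w :: "'k::field_char_0"
  assumes p: "prime p" and w: "w ^ p = 1" and c: "algebraic_int c" and m: "of_int m = (w - 1) * c"
  shows "int p dvd m"
proof -
  have p1: "p > 1" using p prime_gt_1_nat by blast
  have "of_int (m ^ p) / of_nat p = (w - 1) ^ p / of_nat p * c ^ p"
    using m by (simp add: power_mult_distrib)
  also have "algebraic_int \<dots>"
    by (intro algebraic_int_mult algebraic_int_power algebraic_int_root_of_unity_diff_power p w c)
  finally have "algebraic_int (of_int (m ^ p) / of_nat p :: 'k)" .
  then have "int p dvd m ^ p" using p1 by (intro algebraic_int_of_int_divide) auto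
  moreover have "prime (int p)" using p by simp
  ultimately show ?thesis using prime_dvd_power by blast
qed

text \<open>\<open>proj j\<close> below is the projection onto the eigenspace of \<open>z ^ j\<close>.\<close>

locale prime_order_mat =
  fixes M :: "'k::{alg_closed_field, field_char_0} mat" and n p :: nat and z :: 'k
  assumes M: "M \<in> carrier_mat n n" and p: "prime p" and Mp: "M ^\<^sub>m p = 1\<^sub>m n"
    and z: "z ^ p = 1" "\<And>i. 0 < i \<Longrightarrow> i < p \<Longrightarrow> z ^ i \<noteq> 1"
begin

abbreviation "y \<equiv> inverse z"

definition proj :: "nat \<Rightarrow> 'k mat" where
  "proj j = msum n n (\<lambda>i. (y ^ (i * j) / of_nat p) \<cdot>\<^sub>m (M ^\<^sub>m i)) {..<p}"

lemma p1: "p > 1" using p prime_gt_1_nat by blast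

lemma z0: "z \<noteq> 0" using z(1) p1 by (auto simp: power_0_left)

lemma y_pow: "y ^ p = 1" using z(1) by (simp add: power_inverse)

lemma y_pow_neq: "0 < i \<Longrightarrow> i < p \<Longrightarrow> y ^ i \<noteq> 1"
  using z(2)[of i] by (simp add: power_inverse)

lemma Mpow [simp]: "M ^\<^sub>m i \<in> carrier_mat n n" using M by simp

lemma term_carrier: "c \<cdot>\<^sub>m (M ^\<^sub>m i) \<in> carrier_mat n n" by simp

lemma proj_carrier [simp]: "proj j \<in> carrier_mat n n" by (simp add: proj_def)

lemma proj_dim [simp]: "dim_row (proj j) = n" "dim_col (proj j) = n" by (simp_all add: proj_def)

text \<open>Multiplication by \<open>M\<close> shifts the defining sum by one place, and the sum
  wraps around because the \<open>p\<close>-th powers of \<open>M\<close> and of \<open>y\<close>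
  are trivial.\<close>

lemma proj_mult: "proj j * M = z ^ j \<cdot>\<^sub>m proj j"
proof -
  have t: "c \<cdot>\<^sub>m (M ^\<^sub>m i) * M = c \<cdot>\<^sub>m (M ^\<^sub>m Suc i)" for c i
    using mult_smult_assoc_mat[OF Mpow M] by simp
  define f where "f = (\<lambda>r s i. y ^ (i * j) / of_nat p * (M ^\<^sub>m i) $$ (r, s))"
  have fp: "f r s p = f r s 0" for r s
    using Mp y_pow by (simp add: f_def power_mult) (use M in simp)
  have "proj j * M = msum n n (\<lambda>i. (y ^ (i * j) / of_nat p) \<cdot>\<^sub>m (M ^\<^sub>m Suc i)) {..<p}"
    unfolding proj_def by (subst msum_mult[OF M]) (simp_all only: t term_carrier)
  also have "\<dots> = z ^ j \<cdot>\<^sub>m proj j"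
  proof (rule eq_matI)
    fix r s assume "r < dim_row (z ^ j \<cdot>\<^sub>m proj j)" "s < dim_col (z ^ j \<cdot>\<^sub>m proj j)"
    then have rs: "r < n" "s < n" by (auto simp: proj_def)
    have ix: "(c \<cdot>\<^sub>m (M ^\<^sub>m i)) $$ (r, s) = c * (M ^\<^sub>m i) $$ (r, s)" for c i
      using rs Mpow[of i] by (metis carrier_matD index_smult_mat(1))
    have "msum n n (\<lambda>i. (y ^ (i * j) / of_nat p) \<cdot>\<^sub>m (M ^\<^sub>m Suc i)) {..<p} $$ (r, s) =
        (\<Sum>i<p. y ^ (i * j) / of_nat p * (M ^\<^sub>m Suc i) $$ (r, s))"
      using rs by (simp only: msum_index ix)
    also have "\<dots> = (\<Sum>i<p. z ^ j * f r s (Suc i))"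
      using z0 by (intro sum.cong refl) (simp add: f_def power_add power_inverse field_simps)
    also have "\<dots> = z ^ j * (\<Sum>i<p. f r s i)"
      by (simp add: sum_distrib_left[symmetric] sum_cyclic_shift[of "f r s", OF fp])
    also have "\<dots> = (z ^ j \<cdot>\<^sub>m proj j) $$ (r, s)"
      using rs by (simp add: proj_def f_def ix)
    finally show "msum n n (\<lambda>i. (y ^ (i * j) / of_nat p) \<cdot>\<^sub>m (M ^\<^sub>m Suc i)) {..<p} $$ (r, s) =
        (z ^ j \<cdot>\<^sub>m proj j) $$ (r, s)" .
  qed (auto simp: proj_def)
  finally show ?thesis .
qed

lemma proj_mult_pow: "proj j * M ^\<^sub>m i = z ^ (i * j) \<cdot>\<^sub>m proj j"
proof (induction i)
  case (Suc i)
  have "proj j * M ^\<^sub>m Suc i = (proj j * M ^\<^sub>m i) * M"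
    using assoc_mult_mat[OF proj_carrier Mpow M, of j i] by simp
  also have "\<dots> = z ^ (i * j) \<cdot>\<^sub>m (proj j * M)"
    unfolding Suc.IH by (rule mult_smult_assoc_mat[OF proj_carrier M])
  also have "\<dots> = z ^ (Suc i * j) \<cdot>\<^sub>m proj j"
    unfolding proj_mult by (intro eq_matI) (auto simp: power_add)
  finally show ?case .
next
  case 0
  have "M ^\<^sub>m 0 = 1\<^sub>m n" using M by simp
  then show ?case using right_mult_one_mat[OF proj_carrier, of j] by (auto intro!: eq_matI)
qed

lemma proj_idem: "proj j * proj j = proj j"
proof -
  have "proj j * proj j = msum n n (\<lambda>i. proj j * ((y ^ (i * j) / of_nat p) \<cdot>\<^sub>m (M ^\<^sub>m i))) {..<p}"
    unfolding proj_def[of j] by (subst mult_msum[OF msum_carrier]) (simp_all only: term_carrier)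
  also have "\<dots> = msum n n (\<lambda>i. (1 / of_nat p) \<cdot>\<^sub>m proj j) {..<p}"
  proof (rule msum_cong[OF refl])
    fix i
    have "proj j * ((y ^ (i * j) / of_nat p) \<cdot>\<^sub>m (M ^\<^sub>m i)) = (y ^ (i * j) / of_nat p) \<cdot>\<^sub>m (z ^ (i * j) \<cdot>\<^sub>m proj j)"
      using mult_smult_distrib[OF proj_carrier Mpow] proj_mult_pow by simp
    also have "\<dots> = (1 / of_nat p) \<cdot>\<^sub>m proj j"
      using z0 by (intro eq_matI) (auto simp: power_inverse)
    finally show "proj j * ((y ^ (i * j) / of_nat p) \<cdot>\<^sub>m (M ^\<^sub>m i)) = (1 / of_nat p) \<cdot>\<^sub>m proj j" .
  qed
  also have "\<dots> = proj j"
    using p1 proj_carrier[of j] by (intro eq_matI) auto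
  finally show ?thesis .
qed

lemma trace_proj: "of_nat p * mat_trace (proj j) = (\<Sum>i<p. y ^ (i * j) * mat_trace (M ^\<^sub>m i))"
proof -
  have "mat_trace (proj j) = (\<Sum>i<p. mat_trace ((y ^ (i * j) / of_nat p) \<cdot>\<^sub>m (M ^\<^sub>m i)))"
    unfolding proj_def by (rule mat_trace_msum) (rule term_carrier)
  also have "\<dots> = (\<Sum>i<p. y ^ (i * j) / of_nat p * mat_trace (M ^\<^sub>m i))"
    by (simp only: mat_trace_smult[OF Mpow])
  finally show ?thesis using p1 by (simp add: sum_distrib_left)
qed

text \<open>Finite Fourier inversion: after exchanging the sums, the geometric sum over
  \<open>j\<close> leaves only the term \<open>i = 1\<close>.\<close>

lemma trace_eq_sum_proj: "mat_trace M = (\<Sum>j<p. z ^ j * mat_trace (proj j))"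
proof -
  have inner: "(\<Sum>j<p. z ^ j * y ^ (i * j)) = (if i = 1 then of_nat p else 0)" if i: "i < p" for i
  proof -
    have e: "(\<Sum>j<p. z ^ j * y ^ (i * j)) = (\<Sum>j<p. (z * y ^ i) ^ j)"
      by (simp add: power_mult power_mult_distrib)
    show ?thesis
    proof (cases "i = 1")
      case True
      then show ?thesis unfolding e using z0 by simp
    next
      case False
      have "z * y ^ i \<noteq> 1"
      proof (cases i)
        case 0
        then show ?thesis using z(2)[of 1] p1 by simp
      next
        case (Suc k)
        then have "z * y ^ i = y ^ k" using z0 by (simp add: mult.assoc[symmetric])
        moreover have "y ^ k \<noteq> 1" using y_pow_neq[of k] Suc False i by simp
        ultimately show ?thesis by metis
      qed
      moreover have "(z * y ^ i) ^ p = 1"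
      proof -
        have "(z * y ^ i) ^ p = z ^ p * (y ^ p) ^ i"
          by (simp only: power_mult_distrib power_mult[symmetric] mult.commute)
        then show ?thesis using z(1) y_pow by simp
      qed
      ultimately show ?thesis unfolding e using sum_powers_root_of_unity False by simp
    qed
  qed
  have "of_nat p * (\<Sum>j<p. z ^ j * mat_trace (proj j)) =
      (\<Sum>j<p. z ^ j * (\<Sum>i<p. y ^ (i * j) * mat_trace (M ^\<^sub>m i)))"
    by (simp add: sum_distrib_left mult.left_commute flip: trace_proj)
  also have "\<dots> = (\<Sum>i<p. (\<Sum>j<p. z ^ j * y ^ (i * j)) * mat_trace (M ^\<^sub>m i))"
    by (simp only: sum_distrib_left sum_distrib_right mult.assoc) (rule sum.swap)
  also have "\<dots> = (\<Sum>i<p. if i = 1 then of_nat p * mat_trace (M ^\<^sub>m i) else 0)"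
    by (intro sum.cong refl) (simp add: inner)
  also have "\<dots> = of_nat p * mat_trace M" using p1 M by simp
  finally show ?thesis using p1 by simp
qed

text \<open>The traces of the projections are the eigenvalue multiplicities. Unless \<open>M\<close>
  is scalar they are all below \<open>n = p ^ a\<close>, so it is enough that they agree modulo
  \<open>p ^ a\<close>; being equal, they factor out of the trace and leave a vanishing sum of roots
  of unity. In the Fourier formula for the difference of two multiplicities the term
  \<open>i = 0\<close> cancels and every other one is divisible by
  \<open>p ^ a * (y - 1)\<close>.\<close>

lemma trace_zero_or_scalar:
  assumes n: "n = p ^ a" and int: "\<And>i. 0 < i \<Longrightarrow> i < p \<Longrightarrow> algebraic_int (mat_trace (M ^\<^sub>m i) / of_nat (p ^ a))"
  shows "mat_trace M = 0 \<or> (\<exists>c. M = c \<cdot>\<^sub>m 1\<^sub>m n)"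
proof (cases "\<exists>j. proj j = 1\<^sub>m n")
  case True
  then obtain j where "proj j = 1\<^sub>m n" by blast
  then have "M = z ^ j \<cdot>\<^sub>m 1\<^sub>m n" using proj_mult[of j] M by simp
  then show ?thesis by blast
next
  case False
  have "\<exists>k. k < n \<and> mat_trace (proj j) = of_nat k" for j
  proof -
    obtain k where "k \<le> n" "mat_trace (proj j) = of_nat k" "k = n \<Longrightarrow> proj j = 1\<^sub>m n"
      using idempotent_trace[OF proj_carrier proj_idem] by blast
    then show ?thesis using False by (metis le_neq_implies_less)
  qed
  then obtain k where k: "\<And>j. k j < n" "\<And>j. mat_trace (proj j) = of_nat (k j)" by metis
  have "k j = k 0" for j
  proof -
    define t where "t = (\<lambda>i. mat_trace (M ^\<^sub>m i) / of_nat (p ^ a))"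
    define d where "d = int (k j) - int (k 0)"
    define c where "c = (\<Sum>i\<in>{0<..<p}. (\<Sum>s<i * j. y ^ s) * t i)"
    have yi: "algebraic_int y" using algebraic_int_root_of_unity[OF y_pow] p1 by simp
    have ci: "algebraic_int c"
      unfolding c_def using int by (intro algebraic_int_sum algebraic_int_mult algebraic_int_power yi) (auto simp: t_def)
    have "of_nat p * of_int d = (\<Sum>i<p. (y ^ (i * j) - 1) * mat_trace (M ^\<^sub>m i))"
      using trace_proj[of j] trace_proj[of 0]
      by (simp add: d_def k(2) algebra_simps sum_subtractf)
    also have "\<dots> = (\<Sum>i\<in>{0<..<p}. (y ^ (i * j) - 1) * mat_trace (M ^\<^sub>m i))"
      by (intro sum.mono_neutral_right) (auto intro: Nat.gr0I)
    also have "\<dots> = (\<Sum>i\<in>{0<..<p}. of_nat (p ^ a) * ((y - 1) * ((\<Sum>s<i * j. y ^ s) * t i)))"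
      using p1 by (intro sum.cong refl) (simp add: t_def power_diff_1_eq)
    also have "\<dots> = of_nat (p ^ a) * ((y - 1) * c)"
      by (simp add: c_def sum_distrib_left)
    finally have pd: "of_nat p * of_int d = of_nat (p ^ a) * ((y - 1) * c)" .
    then have "of_int (int p * d) / of_nat (p ^ a) = (y - 1) * c" using p1 by (simp add: field_simps)
    moreover have "algebraic_int ((y - 1) * c)"
      by (intro algebraic_int_mult algebraic_int_diff yi ci) auto
    ultimately have "int (p ^ a) dvd int p * d"
      using p1 by (intro algebraic_int_of_int_divide[where ?'k='k]) (auto simp del: of_int_mult)
    \<comment> \<open>The Fourier formula costs a factor \<open>p\<close> on the left. It is
      regained because \<open>m = (y - 1) * c\<close> is an integer divisible by
      \<open>y - 1\<close>, hence by \<open>p\<close>.\<close>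
    then obtain m where m: "int p * d = int (p ^ a) * m" by blast
    have "of_int (int p * d) = (of_nat p * of_int d :: 'k)" by simp
    then have "of_nat (p ^ a) * of_int m = of_nat (p ^ a) * ((y - 1) * c)" unfolding m pd[symmetric] by simp
    then have "of_int m = (y - 1) * c" using p1 by simp
    then have "int p dvd m" by (rule prime_dvd_of_root_of_unity_diff_multiple[OF p y_pow ci])
    then have "int (p ^ a) dvd d" using m p1 by auto
    moreover have "\<bar>d\<bar> < int (p ^ a)" using k(1)[of j] k(1)[of 0] unfolding d_def n by linarith
    ultimately have "d = 0" using dvd_imp_le_int[of d "int (p ^ a)"] by (metis abs_of_nat linorder_not_less)
    then show ?thesis by (simp add: d_def)
  qed
  then have "mat_trace M = (\<Sum>j<p. z ^ j * of_nat (k 0))"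
    unfolding trace_eq_sum_proj k(2) by (intro sum.cong refl) metis
  also have "\<dots> = (\<Sum>j<p. z ^ j) * of_nat (k 0)" by (simp add: sum_distrib_right)
  also have "(\<Sum>j<p. z ^ j) = 0"
    using sum_powers_root_of_unity[OF z(1)] z(2)[of 1] p1 by simp
  finally show ?thesis by simp
qed

end

section \<open>Characters at central elements of Sylow subgroups\<close>

lemma (in prime_order_mat) algebraic_int_trace: "algebraic_int (mat_trace M)"
proof -
  have "algebraic_int (mat_trace (proj j))" for j
    using idempotent_trace[OF proj_carrier proj_idem, of j] by (metis algebraic_int_of_nat)
  moreover have "algebraic_int z" using algebraic_int_root_of_unity[OF z(1)] p1 by simp
  ultimately show ?thesis
    unfolding trace_eq_sum_proj by (intro algebraic_int_sum algebraic_int_mult algebraic_int_power)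
qed

text \<open>An orbit with more than one point contributes its size, a multiple of \<open>p\<close>,
  times a constant weight. The condition is put on orbit sizes because in Thompson's theorem the
  acting group is not a \<open>p\<close>-group, and weights are allowed because there squared
  degrees are counted; weight 1 gives the centre of a \<open>p\<close>-group.\<close>

lemma (in group_action) fixed_points_weight_mod:
  fixes w :: "'c \<Rightarrow> nat"
  assumes p: "prime p" and orb: "\<And>x. x \<in> E \<Longrightarrow> card (orbit G \<phi> x) dvd p ^ a" and fin: "finite E"
    and inv: "\<And>g x. g \<in> carrier G \<Longrightarrow> x \<in> E \<Longrightarrow> w (\<phi> g x) = w x"
  shows "(\<Sum>x\<in>E. w x) mod p = (\<Sum>x\<in>{x \<in> E. \<forall>g\<in>carrier G. \<phi> g x = x}. w x) mod p"
proof -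
  define F where "F = {x \<in> E. \<forall>g\<in>carrier G. \<phi> g x = x}"
  interpret group G using group_hom group_hom.axioms(1) by auto
  have orbE: "orbit G \<phi> x \<subseteq> E" if "x \<in> E" for x
    using element_image that by (auto simp: orbit_def)
  have same: "{y \<in> E - F. orbit G \<phi> y = orbit G \<phi> x} = orbit G \<phi> x" if x: "x \<in> E - F" for x
  proof
    show "{y \<in> E - F. orbit G \<phi> y = orbit G \<phi> x} \<subseteq> orbit G \<phi> x"
      using orbit_refl by blast
    show "orbit G \<phi> x \<subseteq> {y \<in> E - F. orbit G \<phi> y = orbit G \<phi> x}"
    proof
      fix y assume y: "y \<in> orbit G \<phi> x"
      have yE: "y \<in> E" and xE: "x \<in> E" using x y orbE by auto
      have "x \<in> orbit G \<phi> y" by (rule orbit_sym[OF xE yE y])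
      then have eq: "orbit G \<phi> y = orbit G \<phi> x"
        using orbit_trans[OF xE yE _ y] orbit_trans[OF yE xE] orbE xE yE by blast
      have "y \<notin> F"
      proof
        assume "y \<in> F"
        then have "orbit G \<phi> y \<subseteq> {y}" by (auto simp: F_def orbit_def)
        then have "x = y" using \<open>x \<in> orbit G \<phi> y\<close> by blast
        then show False using x \<open>y \<in> F\<close> by simp
      qed
      then show "y \<in> {y \<in> E - F. orbit G \<phi> y = orbit G \<phi> x}" using yE eq by simp
    qed
  qed
  have dvd: "p dvd card (orbit G \<phi> x)" if x: "x \<in> E - F" for x
  proof -
    have "card (orbit G \<phi> x) dvd p ^ a" using orb x by blast
    then obtain i where i: "card (orbit G \<phi> x) = p ^ i" using divides_primepow_nat[OF p] by blast
    have "i \<noteq> 0"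
    proof
      assume "i = 0"
      then have "card (orbit G \<phi> x) = 1" using i by simp
      then have "orbit G \<phi> x = {x}" using orbit_refl[of x] x by (auto simp: card_1_singleton_iff)
      then have "\<phi> g x = x" if "g \<in> carrier G" for g using that by (auto simp: orbit_def)
      then show False using x by (auto simp: F_def)
    qed
    then show ?thesis using i by simp
  qed
  have "p dvd (\<Sum>x\<in>E - F. w x)"
  proof -
    have "(\<Sum>x\<in>E - F. w x) = (\<Sum>B\<in>orbit G \<phi> ` (E - F). \<Sum>x\<in>{x \<in> E - F. orbit G \<phi> x = B}. w x)"
      by (rule sum.image_gen) (use fin in simp)
    moreover have "p dvd (\<Sum>y\<in>{y \<in> E - F. orbit G \<phi> y = B}. w y)" if B: "B \<in> orbit G \<phi> ` (E - F)" for B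
    proof -
      obtain x where x: "x \<in> E - F" "B = orbit G \<phi> x" using B by blast
      have "(\<Sum>y\<in>{y \<in> E - F. orbit G \<phi> y = B}. w y) = (\<Sum>y\<in>orbit G \<phi> x. w x)"
        unfolding x(2) same[OF x(1)] using inv x(1) by (intro sum.cong) (auto simp: orbit_def)
      also have "\<dots> = card (orbit G \<phi> x) * w x" by simp
      finally show ?thesis using dvd[OF x(1)] by simp
    qed
    ultimately show ?thesis by (simp add: dvd_sum)
  qed
  moreover have "(\<Sum>x\<in>E. w x) = (\<Sum>x\<in>E - F. w x) + (\<Sum>x\<in>F. w x)"
    using sum.subset_diff[of F E w] fin by (auto simp: F_def)
  ultimately show ?thesis unfolding F_def[symmetric] by (auto elim!: dvdE)
qed

lemma prime_power_decompose:
  fixes n :: nat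
  assumes "prime p" "n > 0"
  obtains a m where "n = p ^ a * m" "\<not> p dvd m" "multiplicity p n = a"
proof -
  have "n \<noteq> 0" "\<not> is_unit p" using assms not_prime_unit by auto
  then show ?thesis using multiplicity_decompose'[of n p] that by metis
qed

lemma only_prime_divisor_power:
  fixes n :: nat
  assumes "prime p" "n > 0" "\<And>r. prime r \<Longrightarrow> r dvd n \<Longrightarrow> r = p"
  obtains a where "n = p ^ a"
proof -
  obtain b m where m: "n = p ^ b * m" "\<not> p dvd m"
    using prime_power_decompose[OF assms(1,2)] by metis
  have "m = 1"
  proof (rule ccontr)
    assume "m \<noteq> 1"
    then obtain r where r: "prime r" "r dvd m" using prime_factor_nat by blast
    then have "r = p" using assms(3) m(1) by (metis dvd_mult)
    then show False using r m(2) by simp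
  qed
  then show ?thesis using that m(1) by simp
qed

context group
begin

text \<open>Of a Sylow subgroup \<open>P\<close> only the index prime to \<open>p\<close> is
  recorded, which is what the arithmetic with central characters uses.\<close>

definition central_sylow_element :: "nat \<Rightarrow> 'a \<Rightarrow> bool" where
  "central_sylow_element p x \<longleftrightarrow> x \<in> carrier G \<and> x \<noteq> \<one> \<and> x [^] p = \<one> \<and>
     (\<exists>P. subgroup P G \<and> \<not> p dvd card (carrier G) div card P \<and> (\<forall>t\<in>P. t \<otimes> x = x \<otimes> t))"

text \<open>Counting fixed points of conjugation modulo \<open>p\<close> gives a nontrivial central
  element; a suitable power of it has order \<open>p\<close>.\<close>

lemma p_group_center_element:
  assumes p: "prime p" and ord: "Coset.order G = p ^ a" and a: "a > 0"
  obtains x where "x \<in> carrier G" "x \<noteq> \<one>" "x [^] p = \<one>" "\<And>t. t \<in> carrier G \<Longrightarrow> t \<otimes> x = x \<otimes> t"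
proof -
  have p1: "p > 1" using p prime_gt_1_nat by blast
  have fin: "finite (carrier G)" using ord p1 by (intro card_ge_0_finite) (simp add: Coset.order_def)
  interpret act: group_action G "carrier G" "\<lambda>g. \<lambda>h\<in>carrier G. g \<otimes> h \<otimes> inv g"
    by (rule action_by_conjugation)
  define Z where "Z = {x \<in> carrier G. \<forall>g\<in>carrier G. g \<otimes> x \<otimes> inv g = x}"
  have orb: "card (orbit G (\<lambda>g. \<lambda>h\<in>carrier G. g \<otimes> h \<otimes> inv g) x) dvd p ^ a" if "x \<in> carrier G" for x
    by (rule dvdI[OF act.orbit_stabilizer_theorem[OF that, unfolded ord, symmetric]])
  have "card (carrier G) mod p = card Z mod p"
    using act.fixed_points_weight_mod[OF p orb fin, of "\<lambda>_. 1"] by (simp add: Z_def cong: conj_cong)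
  moreover have "card (carrier G) mod p = 0" using ord a by (simp add: Coset.order_def)
  ultimately have pZ: "p dvd card Z" by (simp add: mod_0_imp_dvd)
  have "\<one> \<in> Z" by (simp add: Z_def)
  moreover have "finite Z" using fin by (simp add: Z_def)
  ultimately have "card Z > 0" by (auto simp: card_gt_0_iff)
  then have "p \<le> card Z" using pZ by (rule dvd_imp_le[rotated])
  then have "\<not> card Z \<le> card {\<one>}" using p1 by simp
  then have "\<not> Z \<subseteq> {\<one>}" using card_mono[of "{\<one>}" Z] by blast
  then obtain u where u: "u \<in> Z" "u \<noteq> \<one>" by blast
  have uG: "u \<in> carrier G" using u by (simp add: Z_def)
  have cu: "t \<otimes> u = u \<otimes> t" if "t \<in> carrier G" for t
  proof -
    have "t \<otimes> u \<otimes> inv t = u" using u(1) that by (simp add: Z_def)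
    then have "t \<otimes> u \<otimes> inv t \<otimes> t = u \<otimes> t" by simp
    then show ?thesis using that uG by (simp add: m_assoc)
  qed
  have "u [^] (p ^ a) = \<one>" using pow_order_eq_1[OF uG] ord by simp
  then have ex: "\<exists>k. u [^] (p ^ k) = \<one>" by blast
  \<comment> \<open>The order of \<open>u\<close> is \<open>p ^ k\<close>, so the power
    \<open>p ^ (k - 1)\<close> of \<open>u\<close> has order exactly \<open>p\<close>.\<close>
  define k where "k = (LEAST k. u [^] (p ^ k) = \<one>)"
  have k: "u [^] (p ^ k) = \<one>" unfolding k_def by (rule LeastI_ex[OF ex])
  have "k \<noteq> 0" using k u(2) uG by (intro notI) simp
  then obtain l where l: "k = Suc l" using not0_implies_Suc by blast
  define x where "x = u [^] (p ^ l)"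
  have "x \<noteq> \<one>" unfolding x_def using not_less_Least[of l "\<lambda>k. u [^] (p ^ k) = \<one>"] l k_def by simp
  moreover have "x [^] p = \<one>" unfolding x_def using k l uG by (simp add: nat_pow_pow mult.commute)
  moreover have "t \<otimes> x = x \<otimes> t" if t: "t \<in> carrier G" for t
  proof -
    have "t \<otimes> u [^] m = u [^] m \<otimes> t" for m :: nat
    proof (induction m)
      case (Suc m)
      have "t \<otimes> u [^] Suc m = (t \<otimes> u [^] m) \<otimes> u" using t uG by (simp add: m_assoc)
      also have "\<dots> = u [^] m \<otimes> (t \<otimes> u)" unfolding Suc.IH using t uG by (simp add: m_assoc)
      also have "\<dots> = u [^] Suc m \<otimes> t" unfolding cu[OF t] using t uG by (simp add: m_assoc)
      finally show ?case .
    qed (use t in simp)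
    then show ?thesis by (simp add: x_def)
  qed
  ultimately show ?thesis using that uG by (metis nat_pow_closed x_def)
qed

lemma central_sylow_element_exists:
  assumes fin: "finite (carrier G)" and p: "prime p" and dvd: "p dvd card (carrier G)"
  obtains x where "central_sylow_element p x"
proof -
  have "card (carrier G) > 0" using fin by (auto simp: card_gt_0_iff)
  then obtain a m where ma: "card (carrier G) = p ^ a * m" and m: "\<not> p dvd m"
    using prime_power_decompose[OF p] by metis
  have a0: "a > 0" using dvd m ma by (intro Nat.gr0I) auto
  obtain P where P: "subgroup P G" "card P = p ^ a"
    using sylow_thm[OF p is_group _ fin, of a m] ma by (auto simp: Coset.order_def)
  interpret GP: group "G\<lparr>carrier := P\<rparr>" by (rule subgroup.subgroup_is_group[OF P(1) is_group])
  obtain x where x: "x \<in> P" "x \<noteq> \<one>" "x [^]\<^bsub>G\<lparr>carrier := P\<rparr>\<^esub> p = \<one>" "\<And>t. t \<in> P \<Longrightarrow> t \<otimes> x = x \<otimes> t"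
    using GP.p_group_center_element[OF p, of a] P(2) a0 by (auto simp: Coset.order_def)
  have "x [^] p = \<one>" using x(3) nat_pow_consistent[of x p P] by metis
  moreover have "card (carrier G) div card P = m" using ma P(2) p by (simp add: prime_gt_0_nat)
  ultimately show ?thesis
    using that x(1,2,4) P(1) m subgroup.mem_carrier[OF P(1)] unfolding central_sylow_element_def by blast
qed

text \<open>All rests on \<open>key\<close>: the full \<open>p\<close>-part \<open>p ^ b\<close> of
  the degree divides \<open>\<chi>\<close> at every power of \<open>x\<close> as an algebraic
  integer. The powers are included because the dichotomy \<open>trace_zero_or_scalar\<close> asks
  for the traces of all proper powers of the matrix.\<close>

lemma central_sylow_character:
  fixes \<rho> :: "'a \<Rightarrow> 'k::{alg_closed_field, field_char_0} mat"
  assumes fin: "finite (carrier G)" and p: "prime p" and x: "central_sylow_element p x"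
    and \<rho>: "irreducible_rep G n \<rho>"
  shows "algebraic_int (rep_character G \<rho> x)"
    and "p dvd n \<Longrightarrow> algebraic_int (rep_character G \<rho> x / of_nat p)"
    and "n = p ^ a \<Longrightarrow> rep_character G \<rho> x = 0 \<or> (\<exists>c. \<rho> x = c \<cdot>\<^sub>m 1\<^sub>m n)"
proof -
  note r = irreducible_rep_mat_rep[OF \<rho>]
  have p1: "p > 1" using p prime_gt_1_nat by blast
  have n0: "n > 0" using \<rho> by (simp add: irreducible_rep_iff)
  obtain z :: 'k where z: "z ^ p = 1" "\<And>i. 0 < i \<Longrightarrow> i < p \<Longrightarrow> z ^ i \<noteq> 1"
    using primitive_root_of_unity_exists[OF p] by blast
  obtain P where xG: "x \<in> carrier G" and xp: "x [^] p = \<one>" and P: "subgroup P G"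
    "\<not> p dvd card (carrier G) div card P" "\<And>t. t \<in> P \<Longrightarrow> t \<otimes> x = x \<otimes> t"
    using x unfolding central_sylow_element_def by blast
  have tr: "rep_character G \<rho> (x [^] i) = mat_trace (\<rho> x ^\<^sub>m i)" for i :: nat
    using xG by (simp add: rep_character_apply mat_rep_pow[OF r])
  have loc: "prime_order_mat (\<rho> y) n p z" if y: "y \<in> carrier G" "y [^] p = \<one>" for y
  proof
    show "\<rho> y ^\<^sub>m p = 1\<^sub>m n" using mat_rep_pow[OF r y(1), of p] y(2) mat_rep_one[OF r] by simp
  qed (use mat_rep_carrier[OF r y(1)] p z in auto)
  have ai: "algebraic_int (rep_character G \<rho> (x [^] i))" for i :: nat
  proof -
    have "(x [^] i) [^] p = (x [^] p) [^] i" using xG by (simp add: nat_pow_pow mult.commute)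
    then have "(x [^] i) [^] p = \<one>" using xp by simp
    from prime_order_mat.algebraic_int_trace[OF loc[OF _ this]] show ?thesis
      using xG by (simp add: rep_character_apply)
  qed
  then show "algebraic_int (rep_character G \<rho> x)" using xG nat_pow_eone by metis
  obtain b m where nb: "n = p ^ b * m" and m: "\<not> p dvd m" and b: "multiplicity p n = b"
    using prime_power_decompose[OF p n0] by metis
  have key: "algebraic_int (rep_character G \<rho> (x [^] i) / of_nat (p ^ b))" for i :: nat
  proof -
    have xi: "t \<otimes> x [^] i = x [^] i \<otimes> t" if t: "t \<in> P" for t
    proof (induction i)
      case (Suc i)
      have tG: "t \<in> carrier G" using t subgroup.mem_carrier[OF P(1)] by blast
      have "t \<otimes> x [^] Suc i = (t \<otimes> x [^] i) \<otimes> x" using tG xG by (simp add: m_assoc)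
      also have "\<dots> = x [^] i \<otimes> (t \<otimes> x)" unfolding Suc.IH using tG xG by (simp add: m_assoc)
      also have "\<dots> = x [^] Suc i \<otimes> t" unfolding P(3)[OF t] using tG xG by (simp add: m_assoc)
      finally show ?case .
    qed (use t subgroup.mem_carrier[OF P(1)] in simp)
    define q where "q = card (carrier G) div card P"
    have w: "algebraic_int (of_nat q * rep_character G \<rho> (x [^] i) / of_nat n)"
      using algebraic_int_class_scalar[OF fin \<rho> _ P(1) xi] xG by (simp add: q_def)
    have "coprime p q" using P(2) p prime_imp_coprime by (simp add: q_def)
    then have "coprime (int (p ^ b)) (int q)" by simp
    \<comment> \<open>The index \<open>q\<close> is prime to \<open>p ^ b\<close>. The Bezout
      relation combines integrality of \<open>\<chi>\<close> with integrality of
      \<open>q * \<chi> / n\<close> into integrality of \<open>\<chi> / p ^ b\<close>.\<close>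
    then obtain u v :: int where uv: "u * int (p ^ b) + v * int q = 1"
      using bezout_int[of "int (p ^ b)" "int q"] coprime_imp_gcd_eq_1 by metis
    have "rep_character G \<rho> (x [^] i) / of_nat (p ^ b) =
        of_int (u * int (p ^ b) + v * int q) * rep_character G \<rho> (x [^] i) / of_nat (p ^ b)"
      unfolding uv by simp
    also have "\<dots> = of_int u * rep_character G \<rho> (x [^] i) +
        of_int v * of_nat m * (of_nat q * rep_character G \<rho> (x [^] i) / of_nat n)"
      using n0 p1 unfolding nb by (simp add: field_simps)
    also have "algebraic_int \<dots>"
      by (intro algebraic_int_add algebraic_int_mult ai w) auto
    finally show ?thesis .
  qed
  show "algebraic_int (rep_character G \<rho> x / of_nat p)" if "p dvd n"
  proof -
    have "b \<noteq> 0" using that nb m by (intro notI) simp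
    then obtain c where c: "b = Suc c" using not0_implies_Suc by blast
    have "rep_character G \<rho> x / of_nat p = of_nat (p ^ c) * (rep_character G \<rho> (x [^] (1::nat)) / of_nat (p ^ b))"
      using p1 xG by (simp add: c)
    also have "algebraic_int \<dots>" by (intro algebraic_int_mult key) (auto intro: algebraic_int_power)
    finally show ?thesis .
  qed
  show "rep_character G \<rho> x = 0 \<or> (\<exists>c. \<rho> x = c \<cdot>\<^sub>m 1\<^sub>m n)" if n: "n = p ^ a"
  proof -
    have "b = a" unfolding b[symmetric] n using p by (simp add: multiplicity_prime_power)
    then have "algebraic_int (mat_trace (\<rho> x ^\<^sub>m i) / of_nat (p ^ a))" for i using key[of i] tr[of i] by simp
    then show ?thesis
      using prime_order_mat.trace_zero_or_scalar[OF loc[OF xG xp] n] xG by (simp add: rep_character_apply)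
  qed
qed

end

section \<open>Simple groups with degrees in two primes\<close>

text \<open>Stated for representations instead of characters, so that inflation along surjections
  applies to it directly.\<close>

definition degree_primes_in :: "'k::field itself \<Rightarrow> ('a, 'b) monoid_scheme \<Rightarrow> nat set \<Rightarrow> bool" where
  "degree_primes_in K G \<pi> \<longleftrightarrow>
     (\<forall>n (\<rho> :: 'a \<Rightarrow> 'k mat) r. irreducible_rep G n \<rho> \<longrightarrow> prime r \<longrightarrow> r dvd n \<longrightarrow> r \<in> \<pi>)"

lemma degree_primes_inD:
  fixes \<rho> :: "'a \<Rightarrow> 'k::field mat"
  shows "degree_primes_in TYPE('k) G \<pi> \<Longrightarrow> irreducible_rep G n \<rho> \<Longrightarrow> prime r \<Longrightarrow> r dvd n \<Longrightarrow> r \<in> \<pi>"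
  unfolding degree_primes_in_def by blast

text \<open>Serves twice: for quotient maps, and for the automorphisms that elements of a group
  induce on a normal subgroup, where it yields the conjugate representations.\<close>

lemma irreducible_rep_inflate:
  fixes \<rho> :: "'c \<Rightarrow> 'k::field mat"
  assumes G: "group G" and H: "group H" and h: "h \<in> hom G H" "h ` carrier G = carrier H"
    and \<rho>: "irreducible_rep H n \<rho>"
  shows "irreducible_rep G n (\<lambda>g. \<rho> (h g))"
proof -
  interpret G: group G by fact
  interpret H: group H by fact
  have r: "mat_rep H n \<rho>" using H.irreducible_rep_mat_rep[OF \<rho>] .
  have hG: "h g \<in> carrier H" if "g \<in> carrier G" for g using h(2) that by blast
  have "mat_rep G n (\<lambda>g. \<rho> (h g))"
    using r hG hom_mult[OF h(1)] hom_one[OF h(1) G H] by (auto simp: mat_rep_def)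
  moreover have "W = {0\<^sub>v n} \<or> W = carrier_vec n"
    if W: "vec_subspace n W" "\<forall>g\<in>carrier G. \<forall>w\<in>W. \<rho> (h g) *\<^sub>v w \<in> W" for W
  proof -
    have "\<forall>x\<in>carrier H. \<forall>w\<in>W. \<rho> x *\<^sub>v w \<in> W" using W(2) unfolding h(2)[symmetric] by blast
    then show ?thesis using \<rho> W(1) unfolding H.irreducible_rep_iff by blast
  qed
  ultimately show ?thesis using \<rho> unfolding G.irreducible_rep_iff H.irreducible_rep_iff by blast
qed

lemma degree_primes_in_surj_image:
  assumes "group G" "group H" "h \<in> hom G H" "h ` carrier G = carrier H"
    and deg: "degree_primes_in TYPE('k::field) G \<pi>"
  shows "degree_primes_in TYPE('k) H \<pi>"
  unfolding degree_primes_in_def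
proof (intro allI impI)
  fix n r and \<rho> :: "'c \<Rightarrow> 'k mat"
  assume "irreducible_rep H n \<rho>" "prime r" "r dvd n"
  then show "r \<in> \<pi>" using degree_primes_inD[OF deg irreducible_rep_inflate[OF assms(1-4)]] by blast
qed

context group
begin

lemma one_dim_irreducible:
  fixes \<rho> :: "'a \<Rightarrow> 'k::field mat"
  assumes "mat_rep G 1 \<rho>"
  shows "irreducible_rep G 1 \<rho>"
  unfolding irreducible_rep_iff
proof (intro conjI allI impI)
  fix W :: "'k vec set" assume W: "vec_subspace 1 W"
  show "W = {0\<^sub>v 1} \<or> W = carrier_vec 1"
  proof (rule disjCI)
    assume ne: "W \<noteq> carrier_vec 1"
    show "W = {0\<^sub>v 1}"
    proof (rule ccontr)
      assume "W \<noteq> {0\<^sub>v 1}"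
      then obtain v where v: "v \<in> W" "v \<noteq> 0\<^sub>v 1" using W by (auto simp: vec_subspace_def)
      have vc: "v \<in> carrier_vec 1" using v(1) W by (auto simp: vec_subspace_def)
      have v0: "v $ 0 \<noteq> 0"
      proof
        assume "v $ 0 = 0"
        then have "v = 0\<^sub>v 1" using vc by (intro eq_vecI) auto
        then show False using v(2) by simp
      qed
      have "u \<in> W" if "u \<in> carrier_vec 1" for u
      proof -
        have "u = (u $ 0 / v $ 0) \<cdot>\<^sub>v v" using that vc v0 by (intro eq_vecI) auto
        also have "\<dots> \<in> W" using W v(1) by (simp add: vec_subspace_def)
        finally show ?thesis .
      qed
      then show False using ne W by (auto simp: vec_subspace_def)
    qed
  qed
qed (use assms in auto)

definition triv_char :: "'a \<Rightarrow> 'k::field" where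
  "triv_char = (\<lambda>g\<in>carrier G. 1)"

lemma triv_char_irr: "triv_char \<in> (irr_chars G :: ('a \<Rightarrow> 'k::field) set)"
proof -
  have "mat_rep G 1 (\<lambda>_. 1\<^sub>m 1 :: 'k mat)" by (simp add: mat_rep_def)
  then have "irreducible_rep G 1 (\<lambda>_. 1\<^sub>m 1 :: 'k mat)" by (rule one_dim_irreducible)
  moreover have "triv_char = rep_character G (\<lambda>_. 1\<^sub>m 1 :: 'k mat)"
    by (auto simp: triv_char_def rep_character_def)
  ultimately show ?thesis by (auto simp: irr_chars_def)
qed

lemma kernel_mat_rep_normal:
  assumes r: "mat_rep G n (\<rho> :: 'a \<Rightarrow> 'k::field mat)"
  shows "{g \<in> carrier G. \<rho> g = 1\<^sub>m n} \<lhd> G"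
  unfolding normal_inv_iff
proof (intro conjI ballI subgroupI)
  fix g assume "g \<in> {g \<in> carrier G. \<rho> g = 1\<^sub>m n}"
  then show "inv g \<in> {g \<in> carrier G. \<rho> g = 1\<^sub>m n}"
    using mat_rep_inv(1)[OF r, of g] mat_rep_carrier[OF r, of "inv g"] by auto
next
  fix x h assume x: "x \<in> carrier G" and h: "h \<in> {g \<in> carrier G. \<rho> g = 1\<^sub>m n}"
  then show "x \<otimes> h \<otimes> inv x \<in> {g \<in> carrier G. \<rho> g = 1\<^sub>m n}"
    using mat_rep_mult[OF r] mat_rep_carrier[OF r x] mat_rep_inv(1)[OF r x] by auto
qed (use mat_rep_one[OF r] mat_rep_mult[OF r] in auto)

text \<open>This subgroup is usually written \<open>Z(\<chi>)\<close>. Its normality lets simplicity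
  turn one nontrivial scalar value into scalar values everywhere.\<close>

lemma scalar_mat_rep_normal:
  assumes r: "mat_rep G n (\<rho> :: 'a \<Rightarrow> 'k::field mat)" and n: "n > 0"
  shows "{g \<in> carrier G. \<exists>c. \<rho> g = c \<cdot>\<^sub>m 1\<^sub>m n} \<lhd> G"
proof -
  define S where "S = {g \<in> carrier G. \<exists>c. \<rho> g = c \<cdot>\<^sub>m 1\<^sub>m n}"
  have sm: "(c \<cdot>\<^sub>m 1\<^sub>m n) * A = c \<cdot>\<^sub>m A" if "A \<in> carrier_mat n n" for c and A :: "'k mat"
    using mult_smult_assoc_mat[OF one_carrier_mat that] that by simp
  have one: "1 \<cdot>\<^sub>m 1\<^sub>m n = (1\<^sub>m n :: 'k mat)" by (intro eq_matI) auto
  have "S \<lhd> G"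
    unfolding normal_inv_iff
  proof (intro conjI ballI subgroupI)
    have "\<exists>c. \<rho> \<one> = c \<cdot>\<^sub>m 1\<^sub>m n" using mat_rep_one[OF r] one by metis
    then show "S \<noteq> {}" unfolding S_def by blast
  next
    fix g assume "g \<in> S"
    then obtain c where g: "g \<in> carrier G" "\<rho> g = c \<cdot>\<^sub>m 1\<^sub>m n" by (auto simp: S_def)
    have ig: "\<rho> (inv g) \<in> carrier_mat n n" using mat_rep_carrier[OF r] g by simp
    have e: "c \<cdot>\<^sub>m \<rho> (inv g) = 1\<^sub>m n"
      using mat_rep_inv(1)[OF r g(1)] g(2) sm[OF ig] by simp
    have "c \<noteq> 0"
    proof
      assume "c = 0"
      then have "(1\<^sub>m n :: 'k mat) $$ (0, 0) = 0" unfolding e[symmetric] using ig n by auto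
      then show False using n by simp
    qed
    have "\<rho> (inv g) = (1 / c) \<cdot>\<^sub>m (c \<cdot>\<^sub>m \<rho> (inv g))" using \<open>c \<noteq> 0\<close> by (intro eq_matI) auto
    then show "inv g \<in> S" using e g by (auto simp: S_def)
  next
    fix g h assume "g \<in> S" "h \<in> S"
    then obtain c d where gh: "g \<in> carrier G" "\<rho> g = c \<cdot>\<^sub>m 1\<^sub>m n" "h \<in> carrier G" "\<rho> h = d \<cdot>\<^sub>m 1\<^sub>m n"
      by (auto simp: S_def)
    have "\<rho> (g \<otimes> h) = c \<cdot>\<^sub>m (d \<cdot>\<^sub>m 1\<^sub>m n)"
      using mat_rep_mult[OF r gh(1,3)] sm[of "d \<cdot>\<^sub>m 1\<^sub>m n" c] gh by simp
    also have "\<dots> = (c * d) \<cdot>\<^sub>m 1\<^sub>m n" by (intro eq_matI) auto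
    finally show "g \<otimes> h \<in> S" using gh by (auto simp: S_def)
  next
    fix x h assume x: "x \<in> carrier G" and "h \<in> S"
    then obtain c where h: "h \<in> carrier G" "\<rho> h = c \<cdot>\<^sub>m 1\<^sub>m n" by (auto simp: S_def)
    note xc = mat_rep_carrier[OF r x]
    have ix: "\<rho> (inv x) \<in> carrier_mat n n" using mat_rep_carrier[OF r] x by simp
    have "\<rho> (x \<otimes> h \<otimes> inv x) = (\<rho> x * (c \<cdot>\<^sub>m 1\<^sub>m n)) * \<rho> (inv x)"
      using mat_rep_mult[OF r] x h by simp
    also have "\<rho> x * (c \<cdot>\<^sub>m 1\<^sub>m n) = c \<cdot>\<^sub>m \<rho> x"
      using mult_smult_distrib[OF xc one_carrier_mat, of c] xc by simp
    also have "c \<cdot>\<^sub>m \<rho> x * \<rho> (inv x) = c \<cdot>\<^sub>m 1\<^sub>m n"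
      using mult_smult_assoc_mat[OF xc ix, of c] mat_rep_inv(1)[OF r x] by simp
    finally show "x \<otimes> h \<otimes> inv x \<in> S" using x h by (auto simp: S_def)
  qed (auto simp: S_def)
  then show ?thesis by (simp add: S_def)
qed

lemma eq_if_mult_inv_eq_one:
  assumes "x \<in> carrier G" "y \<in> carrier G" "x \<otimes> inv y = \<one>"
  shows "x = y"
  using inv_equality[OF assms(3)] assms(1,2) by simp

text \<open>By simplicity all values become scalar. A nontrivial irreducible character cannot have
  the whole group as kernel, so the kernel is trivial; scalar matrices commute, and the group would
  be abelian.\<close>

lemma simple_scalar_imp_trivial:
  fixes \<rho> :: "'a \<Rightarrow> 'k::{alg_closed_field, field_char_0} mat"
  assumes fin: "finite (carrier G)"
    and simple: "\<And>N. N \<lhd> G \<Longrightarrow> N = {\<one>} \<or> N = carrier G"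
    and nc: "a \<in> carrier G" "b \<in> carrier G" "a \<otimes> b \<noteq> b \<otimes> a"
    and \<rho>: "irreducible_rep G n \<rho>"
    and x: "x \<in> carrier G" "x \<noteq> \<one>" "\<rho> x = c \<cdot>\<^sub>m 1\<^sub>m n"
  shows "rep_character G \<rho> = triv_char"
proof (rule ccontr)
  assume ne: "rep_character G \<rho> \<noteq> triv_char"
  note r = irreducible_rep_mat_rep[OF \<rho>]
  have n: "n > 0" using \<rho> by (simp add: irreducible_rep_iff)
  have "x \<in> {g \<in> carrier G. \<exists>c. \<rho> g = c \<cdot>\<^sub>m 1\<^sub>m n}" using x by blast
  then have all: "{g \<in> carrier G. \<exists>c. \<rho> g = c \<cdot>\<^sub>m 1\<^sub>m n} = carrier G"
    using simple[OF scalar_mat_rep_normal[OF r n]] x(2) by blast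
  \<comment> \<open>With the whole group as kernel, the pairing with the trivial character would be
    \<open>n\<close> times the group order, against orthogonality.\<close>
  have "{g \<in> carrier G. \<rho> g = 1\<^sub>m n} \<noteq> carrier G"
  proof
    assume K: "{g \<in> carrier G. \<rho> g = 1\<^sub>m n} = carrier G"
    have "char_inner (rep_character G \<rho>) triv_char = (\<Sum>g\<in>carrier G. of_nat n)"
      unfolding char_inner_def
    proof (rule sum.cong[OF refl])
      fix g assume g: "g \<in> carrier G"
      then have "\<rho> g = 1\<^sub>m n" using K by blast
      then show "rep_character G \<rho> g * triv_char (inv g) = of_nat n"
        using g by (simp add: rep_character_apply triv_char_def)
    qed
    moreover have "char_inner (rep_character G \<rho>) triv_char = 0"
      using irr_chars_orthogonal[OF _ triv_char_irr, of "rep_character G \<rho>"] \<rho> ne by (auto simp: irr_chars_def)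
    moreover have "card (carrier G) \<noteq> 0" using fin by (metis card_eq_0_iff empty_iff one_closed)
    ultimately show False using n by simp
  qed
  then have K: "{g \<in> carrier G. \<rho> g = 1\<^sub>m n} = {\<one>}" using simple[OF kernel_mat_rep_normal[OF r]] by blast
  obtain ca cb where cab: "\<rho> a = ca \<cdot>\<^sub>m 1\<^sub>m n" "\<rho> b = cb \<cdot>\<^sub>m 1\<^sub>m n" using all nc(1,2) by blast
  have "\<rho> (a \<otimes> b) = \<rho> (b \<otimes> a)"
  proof -
    have "(c \<cdot>\<^sub>m 1\<^sub>m n) * (d \<cdot>\<^sub>m 1\<^sub>m n) = ((c * d) \<cdot>\<^sub>m 1\<^sub>m n :: 'k mat)" for c d
      by (subst mult_smult_assoc_mat[of _ n n _ n]) (auto intro!: eq_matI)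
    then show ?thesis using mat_rep_mult[OF r] nc cab by (simp add: mult.commute)
  qed
  then have "\<rho> (a \<otimes> b \<otimes> inv (b \<otimes> a)) = 1\<^sub>m n"
    using mat_rep_mult[OF r, of "a \<otimes> b" "inv (b \<otimes> a)"] mat_rep_inv(1)[OF r, of "b \<otimes> a"] nc by simp
  then have "a \<otimes> b \<otimes> inv (b \<otimes> a) \<in> {g \<in> carrier G. \<rho> g = 1\<^sub>m n}" using nc by blast
  then have "a \<otimes> b \<otimes> inv (b \<otimes> a) = \<one>" using K by blast
  then have "a \<otimes> b = b \<otimes> a" using nc eq_if_mult_inv_eq_one[of "a \<otimes> b" "b \<otimes> a"] by blast
  then show False using nc by simp
qed

text \<open>The inverse of \<open>x\<close> is a conjugate of \<open>y\<close>, so the order of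
  \<open>x\<close> divides both of the coprime numbers \<open>p\<close> and
  \<open>q\<close>.\<close>

lemma not_conjugate_inverse:
  assumes "x \<in> carrier G" "y \<in> carrier G" "h \<in> carrier G" "x \<otimes> (h \<otimes> y \<otimes> inv h) = \<one>"
    and "x [^] (p::nat) = \<one>" "y [^] (q::nat) = \<one>" "coprime p q" "p > 0"
  shows "x = \<one>"
proof -
  have e: "h \<otimes> y \<otimes> inv h = inv x"
  proof -
    have "inv (h \<otimes> y \<otimes> inv h) = x" using inv_equality[OF assms(4)] assms(1-3) by simp
    then have "inv x = inv (inv (h \<otimes> y \<otimes> inv h))" by (rule arg_cong[OF sym])
    then show ?thesis using assms(2,3) by simp
  qed
  have pw: "(h \<otimes> y \<otimes> inv h) [^] k = h \<otimes> y [^] k \<otimes> inv h" for k :: nat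
  proof (induction k)
    case (Suc k)
    have "inv h \<otimes> (h \<otimes> u) = u" if "u \<in> carrier G" for u
      using assms(3) that by (simp add: m_assoc[symmetric])
    then show ?case unfolding nat_pow_Suc Suc.IH using assms(2,3) by (simp add: m_assoc)
  qed (use assms(3) in simp)
  have "inv x [^] q = \<one>" using pw[of q] e assms(3,6) by simp
  then have xq: "x [^] q = \<one>" using assms(1) by (simp add: nat_pow_inv)
  have "gcd p q = 1" using assms(7) by (rule coprime_imp_gcd_eq_1)
  then obtain u v where "p * u = q * v + 1" using bezout_nat[of p q] assms(8) by auto
  then have "x [^] (p * u) = x [^] (q * v) \<otimes> x" using assms(1) by simp
  then show ?thesis using assms(1,5) xq by (simp flip: nat_pow_pow)
qed

theorem simple_two_prime_degrees_comm:
  assumes fin: "finite (carrier G)"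
    and simple: "\<And>N. N \<lhd> G \<Longrightarrow> N = {\<one>} \<or> N = carrier G"
    and pq: "prime p" "prime q" "p \<noteq> q"
    and deg: "degree_primes_in TYPE('k::{alg_closed_field, field_char_0}) G {p, q}"
    and ab: "a \<in> carrier G" "b \<in> carrier G"
  shows "a \<otimes> b = b \<otimes> a"
proof (rule ccontr)
  assume nc: "a \<otimes> b \<noteq> b \<otimes> a"
  have cop: "coprime p q" using pq primes_coprime by blast
  have nontriv: "\<exists>u\<in>carrier G. u \<noteq> \<one>"
  proof (rule ccontr)
    assume "\<not> (\<exists>u\<in>carrier G. u \<noteq> \<one>)"
    then have "a = \<one>" "b = \<one>" using ab by blast+
    then show False using nc by blast
  qed
  define good where "good = (\<lambda>p x. x \<in> carrier G \<and> (central_sylow_element p x \<or> \<not> p dvd card (carrier G)))"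
  \<comment> \<open>When a prime does not divide the group order, its element may be chosen freely:
    the identity for one prime, provided that the element for the other is nontrivial. This keeps
    \<open>x\<close> from being conjugate to the inverse of \<open>y\<close>, as column
    orthogonality demands.\<close>
  have "\<exists>x y. good p x \<and> good q y \<and> (\<forall>h\<in>carrier G. x \<otimes> (h \<otimes> y \<otimes> inv h) \<noteq> \<one>)"
  proof (cases "p dvd card (carrier G)")
    case True
    then obtain x where x: "central_sylow_element p x" using central_sylow_element_exists[OF fin pq(1)] by blast
    then have x': "x \<in> carrier G" "x \<noteq> \<one>" "x [^] p = \<one>" by (auto simp: central_sylow_element_def)
    show ?thesis
    proof (cases "q dvd card (carrier G)")
      case True
      then obtain y where y: "central_sylow_element q y" using central_sylow_element_exists[OF fin pq(2)] by blast
      then have y': "y \<in> carrier G" "y [^] q = \<one>" by (auto simp: central_sylow_element_def)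
      have "x \<otimes> (h \<otimes> y \<otimes> inv h) \<noteq> \<one>" if h: "h \<in> carrier G" for h
        using not_conjugate_inverse[OF x'(1) y'(1) h _ x'(3) y'(2) cop] x'(2) prime_gt_0_nat[OF pq(1)] by blast
      moreover have "good p x" "good q y" using x x'(1) y y'(1) by (simp_all add: good_def)
      ultimately show ?thesis by blast
    next
      case False
      then have "good q \<one>" by (simp add: good_def)
      moreover have "x \<otimes> (h \<otimes> \<one> \<otimes> inv h) \<noteq> \<one>" if "h \<in> carrier G" for h using that x' by simp
      moreover have "good p x" using x x'(1) by (simp add: good_def)
      ultimately show ?thesis by blast
    qed
  next
    case False
    then have g1: "good p \<one>" by (simp add: good_def)
    have *: "\<one> \<otimes> (h \<otimes> y \<otimes> inv h) \<noteq> \<one>" if "h \<in> carrier G" "y \<in> carrier G" "y \<noteq> \<one>" for h y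
    proof
      assume "\<one> \<otimes> (h \<otimes> y \<otimes> inv h) = \<one>"
      then have "h \<otimes> y = h" using that eq_if_mult_inv_eq_one[of "h \<otimes> y" h] by simp
      then show False using that by simp
    qed
    have "\<exists>y. good q y \<and> y \<noteq> \<one>"
    proof (cases "q dvd card (carrier G)")
      case True
      then obtain y where y: "central_sylow_element q y" using central_sylow_element_exists[OF fin pq(2)] by blast
      then have "y \<in> carrier G" "y \<noteq> \<one>" by (auto simp: central_sylow_element_def)
      then show ?thesis using y by (auto simp: good_def)
    next
      case False
      then show ?thesis using nontriv by (auto simp: good_def)
    qed
    then obtain y where y: "good q y" "y \<noteq> \<one>" by blast
    then have "y \<in> carrier G" by (simp add: good_def)
    then show ?thesis using g1 *[of _ y] y by blast
  qed
  then obtain x y where x: "good p x" and y: "good q y"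
    and xy: "\<And>h. h \<in> carrier G \<Longrightarrow> x \<otimes> (h \<otimes> y \<otimes> inv h) \<noteq> \<one>" by blast
  have xG: "x \<in> carrier G" and yG: "y \<in> carrier G" using x y by (auto simp: good_def)
  have vals: "algebraic_int (\<chi> u) \<and> algebraic_int (\<chi> u / of_nat s) \<and> ((\<forall>r. prime r \<longrightarrow> r dvd n \<longrightarrow> r = s) \<longrightarrow> \<chi> u = 0)"
    if s: "prime s" "good s u" and \<rho>: "irreducible_rep G n \<rho>" "\<chi> = rep_character G \<rho>" "\<chi> \<noteq> triv_char"
      and sn: "s dvd n"
    for s u n \<rho> and \<chi> :: "'a \<Rightarrow> 'k"
  proof -
    have "s dvd card (carrier G)" by (rule prime_dvd_degree_imp_dvd_card[OF fin \<rho>(1) s(1) sn])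
    then have u: "central_sylow_element s u" using s(2) by (simp add: good_def)
    then have uG: "u \<in> carrier G" "u \<noteq> \<one>" by (auto simp: central_sylow_element_def)
    note c = central_sylow_character[OF fin s(1) u \<rho>(1)]
    have "\<chi> u = 0" if only: "\<forall>r. prime r \<longrightarrow> r dvd n \<longrightarrow> r = s"
    proof -
      have "n > 0" using \<rho>(1) by (simp add: irreducible_rep_iff)
      then obtain e where "n = s ^ e" using only_prime_divisor_power[OF s(1)] only by blast
      then have "\<chi> u = 0 \<or> (\<exists>c. \<rho> u = c \<cdot>\<^sub>m 1\<^sub>m n)" using c(3) \<rho>(2) by blast
      then show ?thesis using simple_scalar_imp_trivial[OF fin simple ab nc \<rho>(1) uG] \<rho>(2,3) by blast
    qed
    then show ?thesis using c(1,2) sn \<rho>(2) by blast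
  qed
  have quot: "algebraic_int (\<chi> x * \<chi> y / of_nat p)" if \<chi>: "\<chi> \<in> irr_chars G" "\<chi> \<noteq> triv_char" for \<chi> :: "'a \<Rightarrow> 'k"
  proof -
    obtain n \<rho> where \<rho>: "irreducible_rep G n \<rho>" "\<chi> = rep_character G \<rho>" using \<chi>(1) by (rule irr_charsE)
    note r = irreducible_rep_mat_rep[OF \<rho>(1)]
    have n: "n > 0" using \<rho>(1) by (simp add: irreducible_rep_iff)
    have rs: "r = p \<or> r = q" if "prime r" "r dvd n" for r
      using degree_primes_inD[OF deg \<rho>(1) that] by simp
    \<comment> \<open>Values in dimension one are scalar, so a linear character would be trivial.
      Hence some prime divides \<open>n\<close>, and it is \<open>p\<close> or
      \<open>q\<close>.\<close>
    have "n \<noteq> 1"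
    proof
      assume n1: "n = 1"
      obtain u where u: "u \<in> carrier G" "u \<noteq> \<one>" using nontriv by blast
      have "\<rho> u = (\<rho> u $$ (0, 0)) \<cdot>\<^sub>m 1\<^sub>m n"
        using mat_rep_carrier[OF r u(1)] n1 by (intro eq_matI) auto
      then show False using simple_scalar_imp_trivial[OF fin simple ab nc \<rho>(1) u] \<rho>(2) \<chi>(2) by blast
    qed
    then obtain r where r: "prime r" "r dvd n" using prime_factor_nat by blast
    show ?thesis
    proof (cases "p dvd n")
      case pn: True
      note px = vals[OF pq(1) x \<rho> \<chi>(2) pn]
      show ?thesis
      proof (cases "q dvd n")
        case True
        note py = vals[OF pq(2) y \<rho> \<chi>(2) True]
        have "\<chi> x * \<chi> y / of_nat p = (\<chi> x / of_nat p) * \<chi> y" by simp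
        also have "algebraic_int \<dots>" using px py by (intro algebraic_int_mult) auto
        finally show ?thesis .
      next
        case False
        then have "\<chi> x = 0" using px rs by blast
        then show ?thesis by simp
      qed
    next
      case False
      then have "q dvd n" using r rs by blast
      then have "\<chi> y = 0" using vals[OF pq(2) y \<rho> \<chi>(2)] rs False by blast
      then show ?thesis by simp
    qed
  qed
  have fi: "finite (irr_chars G :: ('a \<Rightarrow> 'k) set)" by (rule finite_irr_chars[OF fin])
  have "0 = (\<Sum>\<chi>\<in>irr_chars G. \<chi> x * \<chi> y :: 'k)"
    by (rule column_orthogonality[OF fin xG yG xy, symmetric])
  also have "\<dots> = triv_char x * triv_char y + (\<Sum>\<chi>\<in>irr_chars G - {triv_char}. \<chi> x * \<chi> y)"
    by (rule sum.remove[OF fi triv_char_irr])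
  also have "triv_char x * triv_char y = (1 :: 'k)" using xG yG by (simp add: triv_char_def)
  finally have s: "(\<Sum>\<chi>\<in>irr_chars G - {triv_char}. \<chi> x * \<chi> y :: 'k) = - 1" by (simp add: eq_neg_iff_add_eq_0 add.commute)
  have p0: "p > 0" using pq(1) prime_gt_0_nat by blast
  have "algebraic_int (\<Sum>\<chi>\<in>irr_chars G - {triv_char}. \<chi> x * \<chi> y / of_nat p :: 'k)"
    by (intro algebraic_int_sum quot) auto
  also have "(\<Sum>\<chi>\<in>irr_chars G - {triv_char}. \<chi> x * \<chi> y / of_nat p :: 'k) = of_int (- 1) / of_nat p"
    unfolding sum_divide_distrib[symmetric] s by simp
  finally have "int p dvd - 1" by (rule algebraic_int_of_int_divide[OF _ p0])
  then show False using pq(1) by (auto simp: prime_nat_iff)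
qed

end

section \<open>Clifford theory\<close>

context group
begin

lemma irr_char_comm:
  fixes \<chi> :: "'a \<Rightarrow> 'k::field"
  assumes "\<chi> \<in> irr_chars G" "g \<in> carrier G" "h \<in> carrier G"
  shows "\<chi> (g \<otimes> h) = \<chi> (h \<otimes> g)"
proof -
  obtain n \<rho> where \<rho>: "irreducible_rep G n \<rho>" "\<chi> = rep_character G \<rho>" using assms(1) by (rule irr_charsE)
  note r = irreducible_rep_mat_rep[OF \<rho>(1)]
  show ?thesis
    using assms(2,3) mat_trace_mult_comm[OF mat_rep_carrier[OF r assms(2)] mat_rep_carrier[OF r assms(3)]]
    by (simp add: \<rho>(2) rep_character_apply mat_rep_mult[OF r])
qed

lemma irr_char_conj:
  fixes \<chi> :: "'a \<Rightarrow> 'k::field"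
  assumes "\<chi> \<in> irr_chars G" "g \<in> carrier G" "h \<in> carrier G"
  shows "\<chi> (h \<otimes> g \<otimes> inv h) = \<chi> g"
  using irr_char_comm[OF assms(1), of "h \<otimes> g" "inv h"] assms(2,3) by (simp add: m_assoc[symmetric])

lemma irr_char_extensional: "\<chi> \<in> irr_chars G \<Longrightarrow> \<chi> \<in> extensional (carrier G)"
  by (auto simp: irr_chars_def rep_character_def)

lemma bij_betw_conj: "h \<in> carrier G \<Longrightarrow> bij_betw (\<lambda>g. h \<otimes> g \<otimes> inv h) (carrier G) (carrier G)"
proof (rule bij_betw_byWitness[where f'="\<lambda>g. inv h \<otimes> g \<otimes> h"])
  assume h: "h \<in> carrier G"
  have c: "inv h \<otimes> (h \<otimes> u) = u" "h \<otimes> (inv h \<otimes> u) = u" if "u \<in> carrier G" for u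
    using h that by (simp_all add: m_assoc[symmetric])
  show "\<forall>a\<in>carrier G. inv h \<otimes> (h \<otimes> a \<otimes> inv h) \<otimes> h = a"
    "\<forall>a\<in>carrier G. h \<otimes> (inv h \<otimes> a \<otimes> h) \<otimes> inv h = a"
    using h by (simp_all add: m_assoc c)
qed auto

text \<open>For a class function \<open>f\<close> the matrix \<open>X\<close>, the sum of the
  \<open>f g \<cdot>\<^sub>m \<rho> g\<close>, commutes with the representation and is scalar by
  Schur's lemma; the claim is the trace of \<open>X * \<rho> h\<close>.\<close>

lemma class_function_eigen:
  fixes \<chi> :: "'a \<Rightarrow> 'k::{alg_closed_field, field_char_0}"
  assumes \<chi>: "\<chi> \<in> irr_chars G"
    and f: "\<And>g h. g \<in> carrier G \<Longrightarrow> h \<in> carrier G \<Longrightarrow> f (h \<otimes> g \<otimes> inv h) = f g"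
  obtains c where "\<And>h. h \<in> carrier G \<Longrightarrow> (\<Sum>g\<in>carrier G. f g * \<chi> (g \<otimes> h)) = c * \<chi> h"
proof -
  obtain n \<rho> where \<rho>: "irreducible_rep G n \<rho>" "\<chi> = rep_character G \<rho>" using \<chi> by (rule irr_charsE)
  note r = irreducible_rep_mat_rep[OF \<rho>(1)]
  note c = mat_rep_carrier[OF r]
  define X where "X = msum n n (\<lambda>g. f g \<cdot>\<^sub>m \<rho> g) (carrier G)"
  have tc: "f g \<cdot>\<^sub>m \<rho> g \<in> carrier_mat n n" if "g \<in> carrier G" for g using c[OF that] by simp
  have left: "\<rho> h * (f g \<cdot>\<^sub>m \<rho> g) = f g \<cdot>\<^sub>m \<rho> (h \<otimes> g)" if "g \<in> carrier G" "h \<in> carrier G" for g h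
    using mult_smult_distrib[OF c[OF that(2)] c[OF that(1)]] mat_rep_mult[OF r that(2,1)] by simp
  have right: "f g \<cdot>\<^sub>m \<rho> g * \<rho> h = f g \<cdot>\<^sub>m \<rho> (g \<otimes> h)" if "g \<in> carrier G" "h \<in> carrier G" for g h
    using mult_smult_assoc_mat[OF c[OF that(1)] c[OF that(2)]] mat_rep_mult[OF r that] by simp
  have XR: "X * \<rho> h = msum n n (\<lambda>g. f g \<cdot>\<^sub>m \<rho> (g \<otimes> h)) (carrier G)" if h: "h \<in> carrier G" for h
    unfolding X_def msum_mult[OF c[OF h] tc, of "carrier G" "\<lambda>g. g", simplified]
    by (rule msum_cong[OF refl right[OF _ h]])
  have "\<rho> h * X = X * \<rho> h" if h: "h \<in> carrier G" for h
  proof -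
    have "\<rho> h * X = msum n n (\<lambda>g. f g \<cdot>\<^sub>m \<rho> (h \<otimes> g)) (carrier G)"
      unfolding X_def mult_msum[OF c[OF h] tc, of "carrier G" "\<lambda>g. g", simplified]
      by (rule msum_cong[OF refl left[OF _ h]])
    also have "\<dots> = msum n n (\<lambda>g. f (h \<otimes> g \<otimes> inv h) \<cdot>\<^sub>m \<rho> (h \<otimes> g \<otimes> inv h \<otimes> h)) (carrier G)"
    proof (rule msum_cong[OF refl])
      fix g assume g: "g \<in> carrier G"
      have e: "h \<otimes> g \<otimes> inv h \<otimes> h = h \<otimes> g" using g h by (simp add: m_assoc)
      show "f g \<cdot>\<^sub>m \<rho> (h \<otimes> g) = f (h \<otimes> g \<otimes> inv h) \<cdot>\<^sub>m \<rho> (h \<otimes> g \<otimes> inv h \<otimes> h)"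
        unfolding e f[OF g h] ..
    qed
    also have "\<dots> = msum n n (\<lambda>g. f g \<cdot>\<^sub>m \<rho> (g \<otimes> h)) (carrier G)"
      using msum_reindex[OF bij_betw_conj[OF h], of n n "\<lambda>g. f g \<cdot>\<^sub>m \<rho> (g \<otimes> h)"] by simp
    finally show ?thesis using XR[OF h] by simp
  qed
  then obtain w where w: "X = w \<cdot>\<^sub>m 1\<^sub>m n" using schur_scalar[OF \<rho>(1), of X] by (auto simp: X_def)
  have "(\<Sum>g\<in>carrier G. f g * \<chi> (g \<otimes> h)) = w * \<chi> h" if h: "h \<in> carrier G" for h
  proof -
    have "(\<Sum>g\<in>carrier G. f g * \<chi> (g \<otimes> h)) = (\<Sum>g\<in>carrier G. mat_trace (f g \<cdot>\<^sub>m \<rho> (g \<otimes> h)))"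
      using h by (intro sum.cong refl) (simp add: \<rho>(2) rep_character_apply mat_trace_smult[OF c])
    also have "\<dots> = mat_trace (X * \<rho> h)"
      unfolding XR[OF h] by (rule mat_trace_msum[symmetric]) (use c h in simp)
    also have "X * \<rho> h = w \<cdot>\<^sub>m \<rho> h"
      unfolding w using mult_smult_assoc_mat[OF one_carrier_mat c[OF h]] c[OF h] by simp
    finally show ?thesis using h by (simp add: \<rho>(2) rep_character_apply mat_trace_smult[OF c])
  qed
  then show ?thesis by (rule that)
qed

lemma char_convolution:
  fixes \<alpha> \<beta> :: "'a \<Rightarrow> 'k::{alg_closed_field, field_char_0}"
  assumes \<alpha>: "\<alpha> \<in> irr_chars G" and \<beta>: "\<beta> \<in> irr_chars G" and h: "h \<in> carrier G"
  shows "(\<Sum>g\<in>carrier G. \<alpha> (inv g) * \<beta> (g \<otimes> h)) = char_inner \<beta> \<alpha> / \<beta> \<one> * \<beta> h"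
proof -
  have "\<alpha> (inv (h \<otimes> g \<otimes> inv h)) = \<alpha> (inv g)" if "g \<in> carrier G" "h \<in> carrier G" for g h
    using irr_char_conj[OF \<alpha>, of "inv g" h] that by (simp add: inv_mult_group m_assoc)
  then obtain c where c: "\<And>h. h \<in> carrier G \<Longrightarrow> (\<Sum>g\<in>carrier G. \<alpha> (inv g) * \<beta> (g \<otimes> h)) = c * \<beta> h"
    using class_function_eigen[OF \<beta>, of "\<lambda>g. \<alpha> (inv g)"] by blast
  have "\<beta> \<one> \<noteq> 0" using irr_char_one[OF \<beta>] by simp
  moreover have "char_inner \<beta> \<alpha> = c * \<beta> \<one>"
    unfolding c[OF one_closed, symmetric] char_inner_def by (intro sum.cong refl) (simp add: mult.commute)
  ultimately have "c = char_inner \<beta> \<alpha> / \<beta> \<one>" by simp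
  then show ?thesis using c[OF h] by simp
qed

lemma char_inner_sum_list:
  fixes \<chi> :: "'a \<Rightarrow> 'k::{alg_closed_field, field_char_0}"
  assumes cs: "set cs \<subseteq> irr_chars G" "\<And>g. g \<in> carrier G \<Longrightarrow> \<chi> g = (\<Sum>c\<leftarrow>cs. c g)" and \<theta>: "\<theta> \<in> irr_chars G"
  shows "char_inner \<chi> \<theta> = of_nat (card (carrier G)) * of_nat (count_list cs \<theta>)"
proof -
  have "char_inner \<chi> \<theta> = (\<Sum>g\<in>carrier G. (\<Sum>c\<leftarrow>cs. c g) * \<theta> (inv g))"
    unfolding char_inner_def by (intro sum.cong refl) (simp add: cs(2))
  also have "\<dots> = (\<Sum>c\<leftarrow>cs. char_inner c \<theta>)"
    by (induction cs) (simp_all add: char_inner_def distrib_right sum.distrib)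
  also have "\<dots> = of_nat (card (carrier G)) * of_nat (count_list cs \<theta>)"
    using cs(1) by (induction cs) (auto simp: irr_chars_orthogonal \<theta> algebra_simps)
  finally show ?thesis .
qed

text \<open>Convolving with an irreducible character annihilates all other constituents, so up to a
  factor it projects onto the \<open>\<theta>\<close>-part.\<close>

lemma char_convolution_sum_list:
  fixes \<chi> :: "'a \<Rightarrow> 'k::{alg_closed_field, field_char_0}"
  assumes cs: "set cs \<subseteq> irr_chars G" "\<And>g. g \<in> carrier G \<Longrightarrow> \<chi> g = (\<Sum>c\<leftarrow>cs. c g)" and \<theta>: "\<theta> \<in> irr_chars G"
  obtains K where "\<And>h. h \<in> carrier G \<Longrightarrow> (\<Sum>g\<in>carrier G. \<theta> (inv g) * \<chi> (g \<otimes> h)) = K * \<theta> h"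
proof -
  define K where "K = of_nat (count_list cs \<theta>) * (of_nat (card (carrier G)) / \<theta> \<one>)"
  have "(\<Sum>g\<in>carrier G. \<theta> (inv g) * \<chi> (g \<otimes> h)) = K * \<theta> h" if h: "h \<in> carrier G" for h
  proof -
    have "(\<Sum>g\<in>carrier G. \<theta> (inv g) * \<chi> (g \<otimes> h)) = (\<Sum>g\<in>carrier G. \<theta> (inv g) * (\<Sum>c\<leftarrow>cs. c (g \<otimes> h)))"
      using h by (intro sum.cong refl) (simp add: cs(2))
    also have "\<dots> = (\<Sum>c\<leftarrow>cs. \<Sum>g\<in>carrier G. \<theta> (inv g) * c (g \<otimes> h))"
      by (induction cs) (simp_all add: distrib_left sum.distrib)
    also have "\<dots> = K * \<theta> h"
      unfolding K_def using cs(1)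
      by (induction cs) (auto simp: char_convolution[OF \<theta> _ h] irr_chars_orthogonal \<theta> algebra_simps add_divide_distrib)
    finally show ?thesis .
  qed
  then show ?thesis by (rule that)
qed

end

section \<open>Conjugate characters and restriction to a normal subgroup\<close>

context normal
begin

abbreviation "GH \<equiv> G\<lparr>carrier := H\<rparr>"

lemma GH_group: "group GH"
  by (rule subgroup_is_group[OF is_group])

lemma GH_inv: "x \<in> H \<Longrightarrow> inv\<^bsub>GH\<^esub> x = inv x"
  by (rule m_inv_consistent[OF subgroup_axioms])

lemma oneH: "\<one> \<in> H"
  by (rule subgroup.one_closed[OF subgroup_axioms])

lemma mat_rep_restrict: "mat_rep G n \<rho> \<Longrightarrow> mat_rep GH n \<rho>"
  using subset by (auto simp: mat_rep_def)

lemma conj_hom: "t \<in> carrier G \<Longrightarrow> (\<lambda>x. t \<otimes> x \<otimes> inv t) \<in> hom GH GH"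
proof -
  assume t: "t \<in> carrier G"
  have c: "inv t \<otimes> (t \<otimes> u) = u" if "u \<in> carrier G" for u
    using t that by (simp add: m_assoc[symmetric])
  show ?thesis
  proof (rule homI)
    fix x y assume "x \<in> carrier GH" "y \<in> carrier GH"
    then have "x \<in> carrier G" "y \<in> carrier G" using subset by auto
    then show "t \<otimes> (x \<otimes>\<^bsub>GH\<^esub> y) \<otimes> inv t = (t \<otimes> x \<otimes> inv t) \<otimes>\<^bsub>GH\<^esub> (t \<otimes> y \<otimes> inv t)"
      using t by (simp add: m_assoc c)
  qed (use inv_op_closed2[OF t] in simp)
qed

lemma conj_image: "t \<in> carrier G \<Longrightarrow> (\<lambda>x. t \<otimes> x \<otimes> inv t) ` carrier GH = carrier GH"
proof -
  assume t: "t \<in> carrier G"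
  have c: "t \<otimes> (inv t \<otimes> u) = u" if "u \<in> carrier G" for u
    using t that by (simp add: m_assoc[symmetric])
  have "x \<in> (\<lambda>x. t \<otimes> x \<otimes> inv t) ` H" if x: "x \<in> H" for x
  proof (rule image_eqI[of _ _ "inv t \<otimes> x \<otimes> t"])
    have "x \<in> carrier G" using x subset by blast
    then show "x = t \<otimes> (inv t \<otimes> x \<otimes> t) \<otimes> inv t" using t by (simp add: m_assoc c)
  qed (rule inv_op_closed1[OF t x])
  moreover have "(\<lambda>x. t \<otimes> x \<otimes> inv t) ` H \<subseteq> H" using inv_op_closed2[OF t] by blast
  ultimately have "(\<lambda>x. t \<otimes> x \<otimes> inv t) ` H = H" by blast
  then show ?thesis by simp
qed

definition conj_char :: "('a \<Rightarrow> 'k) \<Rightarrow> 'a \<Rightarrow> 'a \<Rightarrow> 'k" where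
  "conj_char \<theta> t = (\<lambda>x\<in>H. \<theta> (t \<otimes> x \<otimes> inv t))"

lemma conj_char_irr:
  fixes \<theta> :: "'a \<Rightarrow> 'k::field"
  assumes \<theta>: "\<theta> \<in> irr_chars GH" and t: "t \<in> carrier G"
  shows "conj_char \<theta> t \<in> irr_chars GH"
proof -
  interpret GH: group GH by (rule GH_group)
  obtain n \<sigma> where \<sigma>: "irreducible_rep GH n \<sigma>" "\<theta> = rep_character GH \<sigma>" using \<theta> by (rule GH.irr_charsE)
  have "irreducible_rep GH n (\<lambda>x. \<sigma> (t \<otimes> x \<otimes> inv t))"
    by (rule irreducible_rep_inflate[OF GH_group GH_group conj_hom[OF t] conj_image[OF t] \<sigma>(1)])
  moreover have "conj_char \<theta> t = rep_character GH (\<lambda>x. \<sigma> (t \<otimes> x \<otimes> inv t))"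
    unfolding conj_char_def \<sigma>(2) rep_character_def using inv_op_closed2[OF t] by (intro ext) auto
  ultimately show ?thesis by (auto simp: irr_chars_def)
qed

lemma conj_char_one:
  assumes "\<theta> \<in> irr_chars GH"
  shows "conj_char \<theta> \<one> = \<theta>"
proof (rule extensionalityI)
  show "conj_char \<theta> \<one> \<in> extensional H" by (simp add: conj_char_def)
  show "\<theta> \<in> extensional H" using group.irr_char_extensional[OF GH_group assms] by simp
  show "conj_char \<theta> \<one> x = \<theta> x" if "x \<in> H" for x
    using that subset by (auto simp: conj_char_def)
qed

text \<open>The hypothesis \<open>ne\<close> says that \<open>\<theta>\<close> is a constituent of
  the restriction of \<open>\<chi>\<close>. Convolution with the orbit sum of
  \<open>\<theta>\<close> acts on \<open>\<chi>\<close> by a nonzero scalar, yet it annihilates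
  every constituent that is not a conjugate of \<open>\<theta>\<close>. So all constituents are
  conjugates, of equal degree, and the quotient of the degrees is the length of the list
  \<open>cs\<close>.\<close>

theorem clifford_degree_dvd:
  fixes \<chi> \<theta> :: "'a \<Rightarrow> 'k::{alg_closed_field, field_char_0}"
  assumes fin: "finite (carrier G)" and \<chi>: "\<chi> \<in> irr_chars G" and \<theta>: "\<theta> \<in> irr_chars GH"
    and ne: "(\<Sum>x\<in>H. \<chi> x * \<theta> (inv x)) \<noteq> 0"
  shows "char_degree GH \<theta> dvd char_degree G \<chi>"
proof -
  interpret GH: group GH by (rule GH_group)
  have finH: "finite H" using subset fin finite_subset by blast
  have HG: "x \<in> carrier G" if "x \<in> H" for x using that subset by blast
  have H0: "card H \<noteq> 0" using finH oneH by (metis card_eq_0_iff empty_iff)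
  have inner: "GH.char_inner \<alpha> \<beta> = (\<Sum>x\<in>H. \<alpha> x * \<beta> (inv x))" for \<alpha> \<beta> :: "'a \<Rightarrow> 'k"
    by (simp add: GH.char_inner_def GH_inv)
  obtain n \<rho> where \<rho>: "irreducible_rep G n \<rho>" "\<chi> = rep_character G \<rho>" using \<chi> by (rule irr_charsE)
  obtain cs where cs: "set cs \<subseteq> irr_chars GH" "\<forall>g\<in>carrier GH. mat_trace (\<rho> g) = (\<Sum>c\<leftarrow>cs. c g)"
    using GH.rep_decomposition[OF mat_rep_restrict[OF irreducible_rep_mat_rep[OF \<rho>(1)]]] by blast
  have \<chi>cs: "\<chi> g = (\<Sum>c\<leftarrow>cs. c g)" if "g \<in> carrier GH" for g
    using cs(2) that HG by (simp add: \<rho>(2) rep_character_apply)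
  have count: "(\<Sum>x\<in>H. \<chi> x * \<eta> (inv x)) = of_nat (card H) * of_nat (count_list cs \<eta>)" if "\<eta> \<in> irr_chars GH" for \<eta>
    using GH.char_inner_sum_list[OF cs(1) \<chi>cs that] by (simp add: inner)
  \<comment> \<open>Up to a factor, the sum of the distinct conjugates of \<open>\<theta>\<close>,
    read at inverses. Extended by zero outside \<open>H\<close>, it is a class function on
    \<open>G\<close>.\<close>
  define T where "T = (\<lambda>x. \<Sum>t\<in>carrier G. \<theta> (t \<otimes> inv x \<otimes> inv t))"
  define f where "f = (\<lambda>x. if x \<in> H then T x else 0)"
  have Tsum: "(\<Sum>x\<in>H. T x * \<alpha> x) = (\<Sum>t\<in>carrier G. \<Sum>x\<in>H. \<alpha> x * conj_char \<theta> t (inv x))" for \<alpha> :: "'a \<Rightarrow> 'k"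
    unfolding T_def by (subst sum.swap) (simp add: sum_distrib_left sum_distrib_right conj_char_def mult.commute cong: sum.cong)
  have f: "f (h \<otimes> g \<otimes> inv h) = f g" if g: "g \<in> carrier G" and h: "h \<in> carrier G" for g h
  proof -
    have c: "inv h \<otimes> (h \<otimes> u) = u" if "u \<in> carrier G" for u
      using h that by (simp add: m_assoc[symmetric])
    have "h \<otimes> g \<otimes> inv h \<in> H \<longleftrightarrow> g \<in> H"
    proof
      assume "h \<otimes> g \<otimes> inv h \<in> H"
      from inv_op_closed1[OF h this] show "g \<in> H" using g h by (simp add: m_assoc c)
    qed (rule inv_op_closed2[OF h])
    moreover have "T (h \<otimes> g \<otimes> inv h) = T g"
    proof -
      have "T (h \<otimes> g \<otimes> inv h) = (\<Sum>t\<in>carrier G. \<theta> ((t \<otimes> h) \<otimes> inv g \<otimes> inv (t \<otimes> h)))"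
        unfolding T_def using g h by (intro sum.cong refl) (simp add: inv_mult_group m_assoc)
      also have "\<dots> = T g"
        unfolding T_def by (rule sum.reindex_bij_betw[OF bij_betw_right_mult[OF h]])
      finally show ?thesis .
    qed
    ultimately show ?thesis by (simp add: f_def)
  qed
  obtain c where c0: "\<And>h. h \<in> carrier G \<Longrightarrow> (\<Sum>g\<in>carrier G. f g * \<chi> (g \<otimes> h)) = c * \<chi> h"
    using class_function_eigen[OF \<chi>, of f] f by blast
  have c: "(\<Sum>g\<in>H. T g * \<chi> (g \<otimes> h)) = c * \<chi> h" if h: "h \<in> carrier G" for h
    unfolding c0[OF h, symmetric] f_def
    by (intro sum.mono_neutral_cong_left fin subset) auto
  \<comment> \<open>At the identity the convolution counts the multiplicities of all conjugates of
    \<open>\<theta>\<close>; these are natural numbers, and \<open>t = \<one>\<close> contributes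
    the positive multiplicity of \<open>\<theta>\<close>.\<close>
  have "c \<noteq> 0"
  proof
    assume "c = 0"
    then have "0 = (\<Sum>g\<in>H. T g * \<chi> g)" using c[OF one_closed] HG by (simp cong: sum.cong)
    also have "\<dots> = (\<Sum>t\<in>carrier G. of_nat (card H) * of_nat (count_list cs (conj_char \<theta> t)))"
      unfolding Tsum by (intro sum.cong refl count conj_char_irr \<theta>)
    also have "\<dots> = of_nat (card H * (\<Sum>t\<in>carrier G. count_list cs (conj_char \<theta> t)))"
      by (simp add: sum_distrib_left)
    finally have "card H * (\<Sum>t\<in>carrier G. count_list cs (conj_char \<theta> t)) = 0"
      by (simp only: of_nat_eq_0_iff eq_commute[of "0 :: 'k"])
    then have "(\<Sum>t\<in>carrier G. count_list cs (conj_char \<theta> t)) = 0" using H0 by simp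
    then have "count_list cs (conj_char \<theta> \<one>) = 0" using fin by simp
    then show False using ne count[OF \<theta>] by (simp add: conj_char_one[OF \<theta>])
  qed
  have deg: "\<eta> \<one> = \<theta> \<one>" if \<eta>: "\<eta> \<in> set cs" for \<eta>
  proof (cases "\<exists>t\<in>carrier G. \<eta> = conj_char \<theta> t")
    case True
    then show ?thesis by (auto simp: conj_char_def)
  next
    case False
    have \<eta>i: "\<eta> \<in> irr_chars GH" using \<eta> cs(1) by blast
    obtain K where K: "\<And>h. h \<in> H \<Longrightarrow> (\<Sum>g\<in>H. \<eta> (inv g) * \<chi> (g \<otimes> h)) = K * \<eta> h"
      using GH.char_convolution_sum_list[OF cs(1) \<chi>cs \<eta>i] by (auto simp: GH_inv)
    \<comment> \<open>One double sum is computed in two ways: summing over \<open>g\<close> first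
      gives \<open>c\<close> times the multiplicity of \<open>\<eta>\<close>, summing over
      \<open>h\<close> first pairs the orbit sum with \<open>\<eta>\<close>, which is orthogonal to
      it.\<close>
    have "c * (\<Sum>x\<in>H. \<chi> x * \<eta> (inv x)) = (\<Sum>h\<in>H. \<eta> (inv h) * (c * \<chi> h))"
      by (simp add: sum_distrib_left mult_ac)
    also have "\<dots> = (\<Sum>h\<in>H. \<Sum>g\<in>H. \<eta> (inv h) * (T g * \<chi> (g \<otimes> h)))"
      by (intro sum.cong refl) (simp add: c[OF HG, symmetric] sum_distrib_left)
    also have "\<dots> = (\<Sum>g\<in>H. \<Sum>h\<in>H. \<eta> (inv h) * (T g * \<chi> (g \<otimes> h)))" by (rule sum.swap)
    also have "\<dots> = (\<Sum>g\<in>H. T g * (\<Sum>h\<in>H. \<eta> (inv h) * \<chi> (h \<otimes> g)))"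
      using HG by (intro sum.cong refl) (simp add: sum_distrib_left mult_ac irr_char_comm[OF \<chi>] cong: sum.cong)
    also have "\<dots> = K * (\<Sum>g\<in>H. T g * \<eta> g)"
      by (simp add: K sum_distrib_left mult_ac)
    also have "(\<Sum>g\<in>H. T g * \<eta> g) = 0"
      unfolding Tsum
    proof (rule sum.neutral, rule ballI)
      fix t assume t: "t \<in> carrier G"
      have "GH.char_inner \<eta> (conj_char \<theta> t) = 0"
        using GH.irr_chars_orthogonal[OF \<eta>i conj_char_irr[OF \<theta> t]] False t by auto
      then show "(\<Sum>x\<in>H. \<eta> x * conj_char \<theta> t (inv x)) = 0" by (simp add: inner)
    qed
    finally have "of_nat (card H) * of_nat (count_list cs \<eta>) = (0 :: 'k)" using \<open>c \<noteq> 0\<close> count[OF \<eta>i] by simp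
    then show ?thesis using H0 \<eta> by (simp add: count_list_0_iff)
  qed
  have "\<chi> \<one> = (\<Sum>c\<leftarrow>cs. c \<one>)" using \<chi>cs[of \<one>] oneH by simp
  also have "\<dots> = of_nat (length cs) * \<theta> \<one>"
  proof -
    have "map (\<lambda>c. c \<one>) cs = map (\<lambda>c. \<theta> \<one>) cs" by (rule map_cong[OF refl deg])
    then have "(\<Sum>c\<leftarrow>cs. c \<one>) = (\<Sum>c\<leftarrow>cs. \<theta> \<one>)" by (rule arg_cong)
    also have "\<dots> = of_nat (length cs) * \<theta> \<one>" by (induction cs) (simp_all add: algebra_simps)
    finally show ?thesis .
  qed
  finally have "(of_nat (char_degree G \<chi>) :: 'k) = of_nat (length cs * char_degree GH \<theta>)"
    using irr_char_one(1)[OF \<chi>] GH.irr_char_one(1)[OF \<theta>] by simp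
  then have "char_degree G \<chi> = length cs * char_degree GH \<theta>" using of_nat_eq_iff by blast
  then show ?thesis by simp
qed

text \<open>The regular character of \<open>G\<close>, restricted to \<open>H\<close> and paired
  with \<open>\<theta>\<close>, gives the group order times the degree of \<open>\<theta>\<close>,
  which is not zero; so some irreducible constituent pairs nontrivially. This stands in for
  induction and Frobenius reciprocity.\<close>

lemma irr_char_over_exists:
  fixes \<theta> :: "'a \<Rightarrow> 'k::{alg_closed_field, field_char_0}"
  assumes fin: "finite (carrier G)" and \<theta>: "\<theta> \<in> irr_chars GH"
  obtains \<chi> where "\<chi> \<in> irr_chars G" "(\<Sum>x\<in>H. \<chi> x * \<theta> (inv x)) \<noteq> 0"
proof -
  interpret GH: group GH by (rule GH_group)
  have finH: "finite H" using subset fin finite_subset by blast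
  have G0: "card (carrier G) \<noteq> 0" using fin by (metis card_eq_0_iff empty_iff one_closed)
  have "(\<Sum>\<chi>\<in>irr_chars G. of_nat (char_degree G \<chi>) * (\<Sum>x\<in>H. \<chi> x * \<theta> (inv x))) =
      (\<Sum>x\<in>H. (\<Sum>\<chi>\<in>irr_chars G. of_nat (char_degree G \<chi>) * \<chi> x) * \<theta> (inv x))"
    by (simp add: sum_distrib_left sum_distrib_right mult.assoc) (rule sum.swap)
  also have "\<dots> = (\<Sum>x\<in>H. if x = \<one> then of_nat (card (carrier G)) * \<theta> \<one> else 0)"
    using subset by (intro sum.cong refl) (auto simp: regular_character_sum[OF fin])
  also have "\<dots> = of_nat (card (carrier G)) * \<theta> \<one>" using finH oneH by simp
  also have "\<dots> \<noteq> 0" using G0 GH.irr_char_one[OF \<theta>] by simp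
  finally have ne: "(\<Sum>\<chi>\<in>irr_chars G. of_nat (char_degree G \<chi>) * (\<Sum>x\<in>H. \<chi> x * \<theta> (inv x))) \<noteq> 0" .
  have "\<exists>\<chi>\<in>irr_chars G. (\<Sum>x\<in>H. \<chi> x * \<theta> (inv x)) \<noteq> 0"
  proof (rule ccontr)
    assume "\<not> (\<exists>\<chi>\<in>irr_chars G. (\<Sum>x\<in>H. \<chi> x * \<theta> (inv x)) \<noteq> 0)"
    then have "(\<Sum>\<chi>\<in>irr_chars G. of_nat (char_degree G \<chi>) * (\<Sum>x\<in>H. \<chi> x * \<theta> (inv x))) = 0"
      by (intro sum.neutral) auto
    then show False using ne by blast
  qed
  then show ?thesis using that by blast
qed

lemma normal_degree_dvd:
  fixes \<sigma> :: "'a \<Rightarrow> 'k::{alg_closed_field, field_char_0} mat"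
  assumes fin: "finite (carrier G)" and \<sigma>: "irreducible_rep GH m \<sigma>"
  obtains n and \<rho> :: "'a \<Rightarrow> 'k mat" where "irreducible_rep G n \<rho>" "m dvd n"
proof -
  have \<theta>: "rep_character GH \<sigma> \<in> irr_chars GH" using \<sigma> by (auto simp: irr_chars_def)
  obtain \<chi> :: "'a \<Rightarrow> 'k" where \<chi>: "\<chi> \<in> irr_chars G" "(\<Sum>x\<in>H. \<chi> x * rep_character GH \<sigma> (inv x)) \<noteq> 0"
    using irr_char_over_exists[OF fin \<theta>] by blast
  obtain n \<rho> where \<rho>: "irreducible_rep G n \<rho>" "\<chi> = rep_character G \<rho>" using \<chi>(1) by (rule irr_charsE)
  have "m dvd n"
    using clifford_degree_dvd[OF fin \<chi>(1) \<theta> \<chi>(2)]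
    unfolding \<rho>(2) rep_character_degree[OF is_group \<rho>(1)] rep_character_degree[OF GH_group \<sigma>] .
  then show ?thesis using that \<rho>(1) by blast
qed

lemma degree_primes_in_normal:
  assumes fin: "finite (carrier G)" and deg: "degree_primes_in TYPE('k::{alg_closed_field, field_char_0}) G \<pi>"
  shows "degree_primes_in TYPE('k) GH \<pi>"
  unfolding degree_primes_in_def
proof (intro allI impI)
  fix m r and \<sigma> :: "'a \<Rightarrow> 'k mat"
  assume \<sigma>: "irreducible_rep GH m \<sigma>" and r: "prime r" "r dvd m"
  obtain n and \<rho> :: "'a \<Rightarrow> 'k mat" where "irreducible_rep G n \<rho>" "m dvd n"
    using normal_degree_dvd[OF fin \<sigma>] by blast
  then show "r \<in> \<pi>" using degree_primes_inD[OF deg _ r(1)] r(2) dvd_trans by blast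
qed

end

section \<open>Solvability for two prime degrees\<close>

context normal
begin

lemma quotient_hom: "group_hom G (G Mod H) (\<lambda>a. H #> a)"
  using factorgroup_is_group r_coset_hom_Mod is_group
  by (simp add: group_hom_def group_hom_axioms_def)

lemma quotient_image: "(\<lambda>a. H #> a) ` carrier G = carrier (G Mod H)"
  by (auto simp: FactGroup_def RCOSETS_def)

lemma inclusion_hom: "group_hom GH G (\<lambda>x. x)"
  using GH_group is_group subset by (auto simp: group_hom_def group_hom_axioms_def hom_def)

lemma solvable_extension:
  assumes "solvable GH" "solvable (G Mod H)"
  shows "solvable G"
proof (rule solvable_condition[OF inclusion_hom quotient_hom quotient_image _ assms])
  show "kernel G (G Mod H) (\<lambda>a. H #> a) \<subseteq> (\<lambda>x. x) ` carrier GH"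
    using coset_join1[OF _ _ subgroup_axioms] by (auto simp: kernel_def FactGroup_def)
qed

lemma simple_quotient_if_maximal:
  assumes max: "\<And>N. N \<lhd> G \<Longrightarrow> H \<subseteq> N \<Longrightarrow> N = H \<or> N = carrier G"
    and K: "K \<lhd> G Mod H"
  shows "K = {\<one>\<^bsub>G Mod H\<^esub>} \<or> K = carrier (G Mod H)"
proof -
  interpret Q: group_hom G "G Mod H" "\<lambda>a. H #> a" by (rule quotient_hom)
  interpret K: normal K "G Mod H" by (rule K)
  define L where "L = {a \<in> carrier G. H #> a \<in> K}"
  have K1: "\<one>\<^bsub>G Mod H\<^esub> \<in> K" by (rule subgroup.one_closed[OF K.subgroup_axioms])
  have one: "\<one>\<^bsub>G Mod H\<^esub> = H" by (simp add: FactGroup_def)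
  have L: "L \<lhd> G"
    unfolding normal_inv_iff
  proof (intro conjI ballI subgroupI)
    show "L \<noteq> {}" using K1 Q.hom_one by (auto simp: L_def)
  next
    fix a assume "a \<in> L"
    then have a: "a \<in> carrier G" "H #> a \<in> K" by (auto simp: L_def)
    have "H #> inv a = inv\<^bsub>G Mod H\<^esub> (H #> a)" using a(1) by (rule Q.hom_inv)
    then show "inv a \<in> L" using a subgroup.m_inv_closed[OF K.subgroup_axioms a(2)] by (simp add: L_def)
  next
    fix a b assume "a \<in> L" "b \<in> L"
    then have ab: "a \<in> carrier G" "H #> a \<in> K" "b \<in> carrier G" "H #> b \<in> K" by (auto simp: L_def)
    have "H #> (a \<otimes> b) = (H #> a) \<otimes>\<^bsub>G Mod H\<^esub> (H #> b)" using ab(1,3) by (rule Q.hom_mult)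
    then show "a \<otimes> b \<in> L" using ab subgroup.m_closed[OF K.subgroup_axioms ab(2,4)] by (simp add: L_def)
  next
    fix x a assume x: "x \<in> carrier G" and "a \<in> L"
    then have a: "a \<in> carrier G" "H #> a \<in> K" by (auto simp: L_def)
    have "H #> (x \<otimes> a \<otimes> inv x) = (H #> x) \<otimes>\<^bsub>G Mod H\<^esub> (H #> a) \<otimes>\<^bsub>G Mod H\<^esub> inv\<^bsub>G Mod H\<^esub> (H #> x)"
      using x a(1) by (simp only: Q.hom_mult Q.hom_inv m_closed inv_closed)
    then show "x \<otimes> a \<otimes> inv x \<in> L"
      using K.inv_op_closed2[OF Q.hom_closed[OF x] a(2)] x a(1) by (simp add: L_def)
  qed (auto simp: L_def)
  have KL: "K = (\<lambda>a. H #> a) ` L"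
  proof
    show "K \<subseteq> (\<lambda>a. H #> a) ` L"
    proof
      fix C assume C: "C \<in> K"
      then have "C \<in> (\<lambda>a. H #> a) ` carrier G" unfolding quotient_image using K.subset by blast
      then show "C \<in> (\<lambda>a. H #> a) ` L" using C unfolding L_def by blast
    qed
    show "(\<lambda>a. H #> a) ` L \<subseteq> K" unfolding L_def by blast
  qed
  have HH: "H #> a = H" if "a \<in> H" for a
    using coset_join2[OF _ subgroup_axioms that] subset that by blast
  have "H \<subseteq> L"
  proof
    fix a assume a: "a \<in> H"
    have "H #> a \<in> K" unfolding HH[OF a] using K1 one by simp
    then show "a \<in> L" using subsetD[OF subset a] by (simp add: L_def)
  qed
  with max[OF L] consider "L = H" | "L = carrier G" by blast
  then show ?thesis
  proof cases
    case 1
    have "K = (\<lambda>_. H) ` H" unfolding KL 1 by (rule image_cong[OF refl HH])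
    then have "K = {H}" using oneH by blast
    then show ?thesis by (simp add: one)
  next
    case 2
    then show ?thesis unfolding KL quotient_image[symmetric] by simp
  qed
qed

lemma degree_primes_in_quotient:
  "degree_primes_in TYPE('k::field) G \<pi> \<Longrightarrow> degree_primes_in TYPE('k) (G Mod H) \<pi>"
  by (rule degree_primes_in_surj_image[OF is_group factorgroup_is_group r_coset_hom_Mod quotient_image])

end

text \<open>If the derived subgroup is proper, the induction hypothesis applies to it and the
  quotient is abelian. A nontrivial perfect group has a maximal normal subgroup whose quotient is
  simple, hence abelian, so it contains the derived subgroup, a contradiction. The quotient has
  another element type, and the induction hypothesis is used only for the subgroup.\<close>

theorem two_prime_degrees_solvable:
  fixes G :: "('a, 'b) monoid_scheme"
  assumes "group G" "finite (carrier G)" and pq: "prime p" "prime q" "p \<noteq> q"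
    and "degree_primes_in TYPE('k::{alg_closed_field, field_char_0}) G {p, q}"
  shows "solvable G"
  using assms(1,2,6)
proof (induction "card (carrier G)" arbitrary: G rule: less_induct)
  case less
  interpret group G by fact
  note fin = less.prems(2) and deg = less.prems(3)
  show ?case
  proof (cases "derived G (carrier G) = carrier G")
    case False
    interpret D: normal "derived G (carrier G)" G by (rule derived_self_is_normal)
    have "derived G (carrier G) \<subset> carrier G" using D.subset False by blast
    then have "card (carrier D.GH) < card (carrier G)" using fin by (simp add: psubset_card_mono)
    moreover have "finite (carrier D.GH)" using D.subset fin by (simp add: finite_subset)
    ultimately have "solvable D.GH"
      by (rule less.hyps[OF _ D.GH_group _ D.degree_primes_in_normal[OF fin deg]])
    then have "solvable_seq D.GH (derived G (carrier G))" by (simp add: solvable_def)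
    then have "solvable_seq G ((\<lambda>x. x) ` derived G (carrier G))"
      by (rule group_hom.solvable_imp_solvable_img[OF D.inclusion_hom])
    then have "solvable_seq G (carrier G)" using augment_solvable_seq[OF subgroup_self] by simp
    then show ?thesis by (simp add: solvable_def)
  next
    case perfect: True
    show ?thesis
    proof (cases "carrier G = {\<one>\<^bsub>G\<^esub>}")
      case True
      have "solvable_seq G {\<one>\<^bsub>G\<^esub>}" by (rule solvable_seq.unity)
      then show ?thesis using True by (simp add: solvable_def)
    next
      case False
      \<comment> \<open>A proper normal subgroup of greatest order is maximal; the trivial subgroup
        shows that there is one.\<close>
      define P where "P = (\<lambda>N. N \<lhd> G \<and> N \<noteq> carrier G)"
      have "P {\<one>\<^bsub>G\<^esub>}" using one_is_normal False by (auto simp: P_def)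
      moreover have "card N < Suc (card (carrier G))" if "P N" for N
        using that fin normal_imp_subgroup[of N] subgroup.subset[of N G]
        by (auto simp: P_def less_Suc_eq_le intro!: card_mono)
      ultimately obtain M where M: "P M" "\<And>N. P N \<Longrightarrow> card N \<le> card M"
        using ex_has_greatest_nat[of P "{\<one>\<^bsub>G\<^esub>}" card "Suc (card (carrier G))"] by blast
      interpret M: normal M G using M(1) by (simp add: P_def)
      have max: "N = M \<or> N = carrier G" if N: "N \<lhd> G" "M \<subseteq> N" for N
      proof (cases "N = carrier G")
        case False
        then have "card N \<le> card M" using N M(2) by (simp add: P_def)
        moreover have "finite N" using normal_imp_subgroup[OF N(1)] subgroup.subset fin finite_subset by blast
        ultimately have "M = N" using N(2) by (simp add: card_seteq)
        then show ?thesis by simp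
      qed simp
      interpret Q: group "G Mod M" by (rule M.factorgroup_is_group)
      have finQ: "finite (carrier (G Mod M))" unfolding M.quotient_image[symmetric] using fin by simp
      have "comm_group (G Mod M)"
        by (rule Q.group_comm_groupI)
          (rule Q.simple_two_prime_degrees_comm[OF finQ M.simple_quotient_if_maximal[OF max] pq
              M.degree_primes_in_quotient[OF deg]])
      then have "derived G (carrier G) \<subseteq> M" by (rule derived_minimal[OF M.normal_axioms])
      then show ?thesis using perfect M(1) M.subset by (auto simp: P_def)
    qed
  qed
qed

lemma (in normal) p_complement_solvable:
  assumes fin: "finite (carrier G)" and pqr: "prime p" "prime q" "prime r" "p \<noteq> q" "p \<noteq> r" "q \<noteq> r"
    and deg: "degree_primes_in TYPE('k::{alg_closed_field, field_char_0}) G {p, q, r}"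
    and H: "\<not> p dvd card H" and index: "card (rcosets H) = p ^ k"
  shows "solvable G"
proof (rule solvable_extension)
  have finH: "finite (carrier GH)" using subset fin by (simp add: finite_subset)
  have "degree_primes_in TYPE('k) GH {q, r}"
    unfolding degree_primes_in_def
  proof (intro allI impI)
    fix n s and \<rho> :: "'a \<Rightarrow> 'k mat"
    assume \<rho>: "irreducible_rep GH n \<rho>" and s: "prime s" "s dvd n"
    have "s \<in> {p, q, r}" by (rule degree_primes_inD[OF degree_primes_in_normal[OF fin deg] \<rho> s])
    moreover have "s dvd card H" using group.prime_dvd_degree_imp_dvd_card[OF GH_group finH \<rho> s] by simp
    ultimately show "s \<in> {q, r}" using H by auto
  qed
  then show "solvable GH" by (rule two_prime_degrees_solvable[OF GH_group finH pqr(2,3,6)])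
  have finQ: "finite (carrier (G Mod H))" unfolding quotient_image[symmetric] using fin by simp
  \<comment> \<open>The quotient has order \<open>p ^ k\<close>, so only \<open>p\<close> can divide
    its degrees; \<open>q\<close> is added to match the theorem on two primes.\<close>
  have "degree_primes_in TYPE('k) (G Mod H) {p, q}"
    unfolding degree_primes_in_def
  proof (intro allI impI)
    fix n s and \<rho> :: "'a set \<Rightarrow> 'k mat"
    assume \<rho>: "irreducible_rep (G Mod H) n \<rho>" and s: "prime s" "s dvd n"
    have "s dvd p ^ k"
      using group.prime_dvd_degree_imp_dvd_card[OF factorgroup_is_group finQ \<rho> s] index by (simp add: FactGroup_def)
    then show "s \<in> {p, q}" using s(1) pqr(1) prime_dvd_power primes_dvd_imp_eq by blast
  qed
  then show "solvable (G Mod H)" by (rule two_prime_degrees_solvable[OF factorgroup_is_group finQ pqr(1,2,4)])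
qed

section \<open>Extension of invariant representations\<close>

lemma smult_mat_cancel:
  fixes B :: "'k::field mat"
  assumes B: "B \<in> carrier_mat n n" and n: "n > 0" and d: "det B \<noteq> 0" and eq: "a \<cdot>\<^sub>m B = b \<cdot>\<^sub>m B"
  shows "a = b"
proof (rule ccontr)
  assume ne: "a \<noteq> b"
  have "B = 0\<^sub>m n n"
  proof (rule eq_matI)
    fix i j assume "i < dim_row (0\<^sub>m n n :: 'k mat)" "j < dim_col (0\<^sub>m n n :: 'k mat)"
    then have ij: "i < n" "j < n" by auto
    have "(a \<cdot>\<^sub>m B) $$ (i, j) = (b \<cdot>\<^sub>m B) $$ (i, j)" unfolding eq ..
    then have "a * B $$ (i, j) = b * B $$ (i, j)" using ij B by simp
    then show "B $$ (i, j) = 0\<^sub>m n n $$ (i, j)" using ne ij by simp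
  qed (use B in auto)
  then have "det B = 0" using det_zero[OF n] by simp
  then show False using d by simp
qed

lemma det_nonzero_inverse:
  fixes B :: "'k::field mat"
  assumes B: "B \<in> carrier_mat n n" and d: "det B \<noteq> 0"
  obtains Y where "Y \<in> carrier_mat n n" "Y * B = 1\<^sub>m n" "B * Y = 1\<^sub>m n"
  using det_non_zero_imp_unit[OF B d, of "()"] B
  by (auto simp: Units_def ring_mat_simps)

context normal
begin

text \<open>
  Multiplying the cocycle identity over all cosets shows that the \<open>|G : H|\<close>-th power of \<open>c\<close> is a
  coboundary; as \<open>c ^ m = 1\<close> with \<open>m\<close> prime to \<open>|G : H|\<close>, so is \<open>c\<close>.
\<close>

lemma cocycle_trivialization:
  fixes c :: "'a \<Rightarrow> 'a \<Rightarrow> 'k::field"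
  assumes fin: "finite (carrier G)"
    and nz: "\<And>g h. g \<in> carrier G \<Longrightarrow> h \<in> carrier G \<Longrightarrow> c g h \<noteq> 0"
    and cocycle: "\<And>g h y. g \<in> carrier G \<Longrightarrow> h \<in> carrier G \<Longrightarrow> y \<in> carrier G \<Longrightarrow>
      c g h * c (g \<otimes> h) y = c h y * c g (h \<otimes> y)"
    and inv: "\<And>g x y. g \<in> carrier G \<Longrightarrow> x \<in> H \<Longrightarrow> y \<in> carrier G \<Longrightarrow> c g (x \<otimes> y) = c g y"
    and root: "\<And>g h. g \<in> carrier G \<Longrightarrow> h \<in> carrier G \<Longrightarrow> c g h ^ m = 1"
    and cop: "coprime (card (rcosets H)) m"
  obtains \<phi> where "\<And>g. g \<in> carrier G \<Longrightarrow> \<phi> g \<noteq> 0"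
    "\<And>g h. g \<in> carrier G \<Longrightarrow> h \<in> carrier G \<Longrightarrow> c g h * \<phi> (g \<otimes> h) = \<phi> g * \<phi> h"
proof -
  interpret Q: group "G Mod H" by (rule factorgroup_is_group)
  interpret \<pi>: group_hom G "G Mod H" "\<lambda>a. H #> a" by (rule quotient_hom)
  define q where "q = card (rcosets H)"
  have finQ: "finite (carrier (G Mod H))" unfolding quotient_image[symmetric] using fin by simp
  have cardQ: "card (carrier (G Mod H)) = q" by (simp add: q_def FactGroup_def)
  have q0: "q \<noteq> 0" using finQ Q.one_closed unfolding cardQ[symmetric] by (metis card_eq_0_iff empty_iff)
  have "\<forall>C\<in>carrier (G Mod H). \<exists>a. a \<in> carrier G \<and> H #> a = C"
    unfolding quotient_image[symmetric] by blast
  then obtain s where s: "\<And>C. C \<in> carrier (G Mod H) \<Longrightarrow> s C \<in> carrier G"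
    "\<And>C. C \<in> carrier (G Mod H) \<Longrightarrow> H #> s C = C" by metis
  have cos: "c g y = c g z" if g: "g \<in> carrier G" and y: "y \<in> carrier G" and z: "z \<in> carrier G" and e: "H #> y = H #> z" for g y z
  proof -
    have "y \<in> H #> z" using e rcos_self[OF y subgroup_axioms] by simp
    then obtain x where x: "x \<in> H" "y = x \<otimes> z" unfolding r_coset_def by blast
    then show ?thesis using inv[OF g x(1) z] by simp
  qed
  define F where "F = (\<lambda>g. \<Prod>C\<in>carrier (G Mod H). c g (s C))"
  have F0: "F g \<noteq> 0" if "g \<in> carrier G" for g
    unfolding F_def using nz[OF that s(1)] finQ by simp
  have key: "c g h ^ q * F (g \<otimes> h) = F g * F h" if g: "g \<in> carrier G" and h: "h \<in> carrier G" for g h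
  proof -
    have "c g h ^ q * F (g \<otimes> h) = (\<Prod>C\<in>carrier (G Mod H). c g h * c (g \<otimes> h) (s C))"
      by (simp add: F_def prod.distrib cardQ)
    also have "\<dots> = (\<Prod>C\<in>carrier (G Mod H). c h (s C) * c g (h \<otimes> s C))"
      by (intro prod.cong refl cocycle g h s)
    also have "\<dots> = F h * (\<Prod>C\<in>carrier (G Mod H). c g (h \<otimes> s C))"
      by (simp add: F_def prod.distrib)
    \<comment> \<open>By \<open>inv\<close> the value of \<open>c g\<close> depends only on the
      coset of its argument, so \<open>h \<otimes> s C\<close> may be exchanged for the chosen
      representative of its coset; multiplication by \<open>h\<close> then merely permutes the
      cosets.\<close>
    also have "(\<Prod>C\<in>carrier (G Mod H). c g (h \<otimes> s C)) =
        (\<Prod>C\<in>carrier (G Mod H). c g (s ((H #> h) \<otimes>\<^bsub>G Mod H\<^esub> C)))"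
    proof (rule prod.cong[OF refl])
      fix C assume C: "C \<in> carrier (G Mod H)"
      have D: "(H #> h) \<otimes>\<^bsub>G Mod H\<^esub> C \<in> carrier (G Mod H)" by (rule Q.m_closed[OF \<pi>.hom_closed[OF h] C])
      have "H #> (h \<otimes> s C) = (H #> h) \<otimes>\<^bsub>G Mod H\<^esub> (H #> s C)" by (rule \<pi>.hom_mult[OF h s(1)[OF C]])
      then have "H #> (h \<otimes> s C) = H #> s ((H #> h) \<otimes>\<^bsub>G Mod H\<^esub> C)" unfolding s(2)[OF C] s(2)[OF D] .
      then show "c g (h \<otimes> s C) = c g (s ((H #> h) \<otimes>\<^bsub>G Mod H\<^esub> C))"
        by (rule cos[OF g m_closed[OF h s(1)[OF C]] s(1)[OF D]])
    qed
    also have "\<dots> = F g"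
      unfolding F_def by (rule prod.reindex_bij_betw[OF Q.bij_betw_left_mult[OF \<pi>.hom_closed[OF h]], of "\<lambda>C. c g (s C)"])
    finally show ?thesis by (simp add: mult.commute)
  qed
  have "gcd q m = 1" using cop unfolding q_def by (rule coprime_imp_gcd_eq_1)
  \<comment> \<open>\<open>k\<close> inverts the index modulo \<open>m\<close>, so raising to the
    power \<open>k\<close> recovers \<open>c\<close> from its \<open>q\<close>-th power.\<close>
  then obtain k l where kl: "q * k = m * l + 1" using bezout_nat[OF q0, of m] by auto
  show ?thesis
  proof (rule that[of "\<lambda>g. F g ^ k"])
    show "F g ^ k \<noteq> 0" if "g \<in> carrier G" for g using F0[OF that] by simp
    show "c g h * F (g \<otimes> h) ^ k = F g ^ k * F h ^ k" if g: "g \<in> carrier G" and h: "h \<in> carrier G" for g h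
    proof -
      have "c g h = c g h ^ (m * l + 1)" using root[OF g h] by (simp add: power_mult)
      also have "\<dots> = (c g h ^ q) ^ k" unfolding kl[symmetric] by (rule power_mult)
      finally have "c g h * F (g \<otimes> h) ^ k = (c g h ^ q * F (g \<otimes> h)) ^ k" by (simp add: power_mult_distrib)
      then show ?thesis unfolding key[OF g h] by (simp add: power_mult_distrib)
    qed
  qed
qed

text \<open>Equality of the two characters makes their pairing nonzero, so some matrix has a nonzero
  average, which Schur's lemma makes invertible. Determinant 1 is arranged by an \<open>n\<close>-th
  root; it will confine the cocycle of the extension problem to roots of unity.\<close>

lemma invariant_intertwiner:
  fixes \<sigma> :: "'a \<Rightarrow> 'k::{alg_closed_field, field_char_0} mat"
  assumes fin: "finite (carrier G)" and \<sigma>: "irreducible_rep GH n \<sigma>" and t: "t \<in> carrier G"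
    and inv: "conj_char (rep_character GH \<sigma>) t = rep_character GH \<sigma>"
  obtains T where "T \<in> carrier_mat n n" "det T = 1" "\<And>x. x \<in> H \<Longrightarrow> T * \<sigma> x = \<sigma> (t \<otimes> x \<otimes> inv t) * T"
proof -
  interpret GH: group GH by (rule GH_group)
  have n: "n > 0" using \<sigma> by (simp add: GH.irreducible_rep_iff)
  have finH: "finite H" using subset fin finite_subset by blast
  define \<tau> where "\<tau> = (\<lambda>x. \<sigma> (t \<otimes> x \<otimes> inv t))"
  have \<tau>: "irreducible_rep GH n \<tau>"
    unfolding \<tau>_def by (rule irreducible_rep_inflate[OF GH_group GH_group conj_hom[OF t] conj_image[OF t] \<sigma>])
  have "rep_character GH \<tau> = conj_char (rep_character GH \<sigma>) t"
    unfolding conj_char_def rep_character_def \<tau>_def using inv_op_closed2[OF t] by (intro ext) auto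
  then have "GH.char_inner (rep_character GH \<tau>) (rep_character GH \<sigma>) = of_nat (card H)"
    using GH.irr_chars_orthogonal[of "rep_character GH \<sigma>" "rep_character GH \<sigma>"] \<sigma> inv by (auto simp: irr_chars_def)
  moreover have "card H \<noteq> 0" using finH oneH by (metis card_eq_0_iff empty_iff)
  ultimately have ne: "GH.char_inner (rep_character GH \<tau>) (rep_character GH \<sigma>) \<noteq> 0" by simp
  note rt = GH.irreducible_rep_mat_rep[OF \<tau>] and rs = GH.irreducible_rep_mat_rep[OF \<sigma>]
  have "\<exists>X\<in>carrier_mat n n. GH.conj_sum n n \<tau> \<sigma> X \<noteq> 0\<^sub>m n n"
  proof (rule ccontr)
    assume "\<not> (\<exists>X\<in>carrier_mat n n. GH.conj_sum n n \<tau> \<sigma> X \<noteq> 0\<^sub>m n n)"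
    then have z: "GH.conj_sum n n \<tau> \<sigma> (mat n n X) = 0\<^sub>m n n" for X by simp
    show False using ne unfolding GH.char_inner_conj_sum[OF rt rs] z by simp
  qed
  then obtain X where X: "X \<in> carrier_mat n n" "GH.conj_sum n n \<tau> \<sigma> X \<noteq> 0\<^sub>m n n" by blast
  define A where "A = GH.conj_sum n n \<tau> \<sigma> X"
  have A: "A \<in> carrier_mat n n" by (simp add: A_def)
  have comm: "\<tau> x * A = A * \<sigma> x" if "x \<in> carrier GH" for x
    unfolding A_def by (rule GH.conj_sum_intertwines[OF rt rs X(1) that])
  obtain Y where Y: "Y \<in> carrier_mat n n" "A * Y = 1\<^sub>m n"
    using GH.schur_intertwiner[OF \<tau> \<sigma> A comm] X(2) unfolding A_def by blast
  have "det A * det Y = 1" using det_mult[OF A Y(1)] Y(2) by simp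
  then have dA: "det A \<noteq> 0" by auto
  obtain a where a: "a ^ n = 1 / det A" using nth_root_exists[OF n] by blast
  have "det (a \<cdot>\<^sub>m A) = 1" using a dA A by (simp add: det_smult)
  moreover have "(a \<cdot>\<^sub>m A) * \<sigma> x = \<sigma> (t \<otimes> x \<otimes> inv t) * (a \<cdot>\<^sub>m A)" if x: "x \<in> H" for x
  proof -
    have c: "\<sigma> x \<in> carrier_mat n n" "\<tau> x \<in> carrier_mat n n" using mat_rep_carrier[OF rs] mat_rep_carrier[OF rt] x by auto
    have "(a \<cdot>\<^sub>m A) * \<sigma> x = a \<cdot>\<^sub>m (\<tau> x * A)" using mult_smult_assoc_mat[OF A c(1)] comm x by simp
    also have "\<dots> = \<tau> x * (a \<cdot>\<^sub>m A)" using mult_smult_distrib[OF c(2) A] by simp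
    finally show ?thesis by (simp add: \<tau>_def)
  qed
  ultimately show ?thesis using that[of "a \<cdot>\<^sub>m A"] A by simp
qed

text \<open>Intertwiners at coset representatives extend \<open>\<sigma>\<close> to a map
  \<open>R\<close> that is multiplicative up to a cocycle. Since the intertwiners have determinant
  1, the determinants of \<open>R\<close> are \<open>m\<close>-th roots of unity, so the cocycle
  satisfies \<open>c ^ (n * m) = 1\<close>. This exponent is prime to the index, the cocycle is a
  coboundary, and rescaling \<open>R\<close> gives a representation.\<close>

theorem invariant_rep_extends:
  fixes \<sigma> :: "'a \<Rightarrow> 'k::{alg_closed_field, field_char_0} mat"
  assumes fin: "finite (carrier G)" and \<sigma>: "irreducible_rep GH n \<sigma>"
    and inv: "\<And>t. t \<in> carrier G \<Longrightarrow> conj_char (rep_character GH \<sigma>) t = rep_character GH \<sigma>"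
    and det: "\<And>x. x \<in> H \<Longrightarrow> det (\<sigma> x) ^ m = 1"
    and cop: "coprime (card (rcosets H)) (n * m)"
  obtains \<rho> :: "'a \<Rightarrow> 'k mat" where "irreducible_rep G n \<rho>"
proof -
  interpret GH: group GH by (rule GH_group)
  note rs = GH.irreducible_rep_mat_rep[OF \<sigma>]
  have n: "n > 0" using \<sigma> by (simp add: GH.irreducible_rep_iff)
  have \<sigma>c: "\<sigma> x \<in> carrier_mat n n" if "x \<in> H" for x using mat_rep_carrier[OF rs] that by simp
  have \<sigma>m: "\<sigma> (x \<otimes> y) = \<sigma> x * \<sigma> y" if "x \<in> H" "y \<in> H" for x y using mat_rep_mult[OF rs] that by simp
  have \<sigma>1: "\<sigma> \<one> = 1\<^sub>m n" using mat_rep_one[OF rs] by simp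
  have HG: "x \<in> carrier G" if "x \<in> H" for x using subset that by blast
  have detn: "det (\<sigma> x) \<noteq> 0" if "x \<in> H" for x
  proof -
    have "\<sigma> x * \<sigma> (inv x) = 1\<^sub>m n" using \<sigma>m[of x "inv x"] \<sigma>1 that HG[OF that] by simp
    then have "det (\<sigma> x) * det (\<sigma> (inv x)) = 1"
      using det_mult[OF \<sigma>c[OF that], of "\<sigma> (inv x)"] \<sigma>c[of "inv x"] that by simp
    then show ?thesis by auto
  qed
  have "\<forall>t. \<exists>T. t \<in> carrier G \<longrightarrow> T \<in> carrier_mat n n \<and> det T = 1 \<and> (\<forall>x\<in>H. T * \<sigma> x = \<sigma> (t \<otimes> x \<otimes> inv t) * T)"
    using invariant_intertwiner[OF fin \<sigma> _ inv] by metis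
  then obtain T where T: "\<And>t. t \<in> carrier G \<Longrightarrow> T t \<in> carrier_mat n n" "\<And>t. t \<in> carrier G \<Longrightarrow> det (T t) = 1"
    "\<And>t x. t \<in> carrier G \<Longrightarrow> x \<in> H \<Longrightarrow> T t * \<sigma> x = \<sigma> (t \<otimes> x \<otimes> inv t) * T t"
    by metis
  \<comment> \<open>The choice is made from the coset as a set, so \<open>s\<close> is constant on
    cosets.\<close>
  define s where "s = (\<lambda>g. SOME y. y \<in> H #> g)"
  have sH: "s g \<in> H #> g" if "g \<in> carrier G" for g
    unfolding s_def using rcos_self[OF that subgroup_axioms] by (rule someI)
  have sG: "s g \<in> carrier G" if "g \<in> carrier G" for g
    using sH[OF that] r_coset_subset_G[OF subset that] by blast
  have gs: "g \<otimes> inv (s g) \<in> H" if g: "g \<in> carrier G" for g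
  proof -
    obtain x where x: "x \<in> H" "s g = x \<otimes> g" using sH[OF g] unfolding r_coset_def by blast
    have "g \<otimes> inv (s g) = inv x" using x g HG[OF x(1)] by (simp add: inv_mult_group m_assoc[symmetric])
    then show ?thesis using x by simp
  qed
  have s_mult: "s (x \<otimes> g) = s g" if x: "x \<in> H" and g: "g \<in> carrier G" for x g
  proof -
    have "x \<otimes> g \<in> H #> g" using x unfolding r_coset_def by blast
    then have "H #> (x \<otimes> g) = H #> g" using repr_independence[OF _ g subgroup_axioms] by blast
    then show ?thesis by (simp add: s_def)
  qed
  define R where "R = (\<lambda>g. \<sigma> (g \<otimes> inv (s g)) * T (s g))"
  have Rc: "R g \<in> carrier_mat n n" if "g \<in> carrier G" for g
    unfolding R_def using \<sigma>c[OF gs[OF that]] T(1)[OF sG[OF that]] by simp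
  have RH: "R (x \<otimes> g) = \<sigma> x * R g" if x: "x \<in> H" and g: "g \<in> carrier G" for x g
  proof -
    have "x \<otimes> g \<otimes> inv (s g) = x \<otimes> (g \<otimes> inv (s g))" using HG[OF x] g sG[OF g] by (simp add: m_assoc)
    then have "\<sigma> (x \<otimes> g \<otimes> inv (s g)) = \<sigma> x * \<sigma> (g \<otimes> inv (s g))" using \<sigma>m[OF x gs[OF g]] by simp
    then show ?thesis
      unfolding R_def s_mult[OF x g] using assoc_mult_mat[OF \<sigma>c[OF x] \<sigma>c[OF gs[OF g]] T(1)[OF sG[OF g]]] by simp
  qed
  have Rint: "R g * \<sigma> x = \<sigma> (g \<otimes> x \<otimes> inv g) * R g" if g: "g \<in> carrier G" and x: "x \<in> H" for g x
  proof -
    define u where "u = g \<otimes> inv (s g)"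
    have uH: "u \<in> H" using gs[OF g] by (simp add: u_def)
    have sxs: "s g \<otimes> x \<otimes> inv (s g) \<in> H" by (rule inv_op_closed2[OF sG[OF g] x])
    have gxg: "g \<otimes> x \<otimes> inv g \<in> H" by (rule inv_op_closed2[OF g x])
    have e: "u \<otimes> (s g \<otimes> x \<otimes> inv (s g)) = (g \<otimes> x \<otimes> inv g) \<otimes> u"
    proof -
      have a: "inv (s g) \<otimes> (s g \<otimes> v) = v" "inv g \<otimes> (g \<otimes> v) = v" if "v \<in> carrier G" for v
        using that g sG[OF g] by (simp_all add: m_assoc[symmetric])
      show ?thesis unfolding u_def using g sG[OF g] HG[OF x] by (simp add: m_assoc a)
    qed
    note c = \<sigma>c[OF uH] T(1)[OF sG[OF g]] \<sigma>c[OF x] \<sigma>c[OF sxs] \<sigma>c[OF gxg]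
    have "R g * \<sigma> x = \<sigma> u * (T (s g) * \<sigma> x)" unfolding R_def u_def[symmetric] by (rule assoc_mult_mat[OF c(1,2,3)])
    also have "\<dots> = \<sigma> u * (\<sigma> (s g \<otimes> x \<otimes> inv (s g)) * T (s g))" unfolding T(3)[OF sG[OF g] x] ..
    also have "\<dots> = \<sigma> u * \<sigma> (s g \<otimes> x \<otimes> inv (s g)) * T (s g)" by (rule assoc_mult_mat[OF c(1,4,2), symmetric])
    also have "\<dots> = \<sigma> (g \<otimes> x \<otimes> inv g) * \<sigma> u * T (s g)"
      unfolding \<sigma>m[OF uH sxs, symmetric] e \<sigma>m[OF gxg uH] ..
    also have "\<dots> = \<sigma> (g \<otimes> x \<otimes> inv g) * R g" unfolding R_def u_def[symmetric] by (rule assoc_mult_mat[OF c(5,1,2)])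
    finally show ?thesis .
  qed
  have Rdet: "det (R g) = det (\<sigma> (g \<otimes> inv (s g)))" if g: "g \<in> carrier G" for g
    unfolding R_def det_mult[OF \<sigma>c[OF gs[OF g]] T(1)[OF sG[OF g]]] using T(2)[OF sG[OF g]] by simp
  have Rdet0: "det (R g) \<noteq> 0" and Rdetm: "det (R g) ^ m = 1" if g: "g \<in> carrier G" for g
    unfolding Rdet[OF g] using detn[OF gs[OF g]] det[OF gs[OF g]] by auto
  \<comment> \<open>Both \<open>R g * R h\<close> and \<open>R (g \<otimes> h)\<close> intertwine
    \<open>\<sigma>\<close> with its conjugate by \<open>g \<otimes> h\<close>, so by Schur's lemma
    they differ by a scalar.\<close>
  have scal: "\<exists>a. R g * R h = a \<cdot>\<^sub>m R (g \<otimes> h)" if g: "g \<in> carrier G" and h: "h \<in> carrier G" for g h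
  proof -
    have gh: "g \<otimes> h \<in> carrier G" using g h by simp
    obtain Y where Y: "Y \<in> carrier_mat n n" "Y * R (g \<otimes> h) = 1\<^sub>m n" "R (g \<otimes> h) * Y = 1\<^sub>m n"
      using det_nonzero_inverse[OF Rc[OF gh] Rdet0[OF gh]] by blast
    define A where "A = R g * R h"
    have A: "A \<in> carrier_mat n n" unfolding A_def using Rc[OF g] Rc[OF h] by simp
    have Aint: "A * \<sigma> x = \<sigma> (g \<otimes> h \<otimes> x \<otimes> inv (g \<otimes> h)) * A" if x: "x \<in> H" for x
    proof -
      have hx: "h \<otimes> x \<otimes> inv h \<in> H" by (rule inv_op_closed2[OF h x])
      have ghx: "g \<otimes> (h \<otimes> x \<otimes> inv h) \<otimes> inv g \<in> H" by (rule inv_op_closed2[OF g hx])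
      have e: "g \<otimes> (h \<otimes> x \<otimes> inv h) \<otimes> inv g = g \<otimes> h \<otimes> x \<otimes> inv (g \<otimes> h)"
        using g h HG[OF x] by (simp add: m_assoc inv_mult_group)
      have "A * \<sigma> x = R g * (R h * \<sigma> x)" unfolding A_def by (rule assoc_mult_mat[OF Rc[OF g] Rc[OF h] \<sigma>c[OF x]])
      also have "\<dots> = R g * \<sigma> (h \<otimes> x \<otimes> inv h) * R h"
        unfolding Rint[OF h x] by (rule assoc_mult_mat[OF Rc[OF g] \<sigma>c[OF hx] Rc[OF h], symmetric])
      also have "\<dots> = \<sigma> (g \<otimes> (h \<otimes> x \<otimes> inv h) \<otimes> inv g) * A"
        unfolding Rint[OF g hx] A_def by (rule assoc_mult_mat[OF \<sigma>c[OF ghx] Rc[OF g] Rc[OF h]])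
      finally show ?thesis unfolding e .
    qed
    have comm: "\<sigma> x * (Y * A) = (Y * A) * \<sigma> x" if x: "x \<in> carrier GH" for x
    proof -
      have xH: "x \<in> H" using x by simp
      define x' where "x' = g \<otimes> h \<otimes> x \<otimes> inv (g \<otimes> h)"
      have x'H: "x' \<in> H" unfolding x'_def by (rule inv_op_closed2[OF gh xH])
      note c = \<sigma>c[OF xH] \<sigma>c[OF x'H] Rc[OF gh]
      have "Y * \<sigma> x' = Y * \<sigma> x' * (R (g \<otimes> h) * Y)" unfolding Y(3) using c Y(1) by simp
      also have "\<dots> = Y * (\<sigma> x' * R (g \<otimes> h)) * Y"
        using assoc_mult_mat[OF mult_carrier_mat[OF Y(1) c(2)] c(3) Y(1)] assoc_mult_mat[OF Y(1) c(2,3)] by simp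
      also have "\<sigma> x' * R (g \<otimes> h) = R (g \<otimes> h) * \<sigma> x" unfolding x'_def by (rule Rint[OF gh xH, symmetric])
      also have "Y * (R (g \<otimes> h) * \<sigma> x) = \<sigma> x"
        using assoc_mult_mat[OF Y(1) c(3,1)] Y(2) c(1) by simp
      finally have Yx: "Y * \<sigma> x' = \<sigma> x * Y" .
      have "(Y * A) * \<sigma> x = Y * (\<sigma> x' * A)"
        unfolding x'_def Aint[OF xH, symmetric] by (rule assoc_mult_mat[OF Y(1) A c(1)])
      also have "\<dots> = \<sigma> x * Y * A" unfolding Yx[symmetric] by (rule assoc_mult_mat[OF Y(1) c(2) A, symmetric])
      also have "\<dots> = \<sigma> x * (Y * A)" by (rule assoc_mult_mat[OF c(1) Y(1) A])
      finally show ?thesis by simp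
    qed
    obtain a where a: "Y * A = a \<cdot>\<^sub>m 1\<^sub>m n"
      using GH.schur_scalar[OF \<sigma> mult_carrier_mat[OF Y(1) A] comm] by blast
    have "A = R (g \<otimes> h) * (Y * A)" using assoc_mult_mat[OF Rc[OF gh] Y(1) A] Y(3) A by simp
    also have "\<dots> = a \<cdot>\<^sub>m R (g \<otimes> h)"
      unfolding a using mult_smult_distrib[OF Rc[OF gh] one_carrier_mat] Rc[OF gh] by simp
    finally show ?thesis unfolding A_def by blast
  qed
  then obtain c where c: "\<And>g h. g \<in> carrier G \<Longrightarrow> h \<in> carrier G \<Longrightarrow> R g * R h = c g h \<cdot>\<^sub>m R (g \<otimes> h)"
    by metis
  have cdet: "det (R g) * det (R h) = c g h ^ n * det (R (g \<otimes> h))" if g: "g \<in> carrier G" and h: "h \<in> carrier G" for g h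
    unfolding det_mult[OF Rc[OF g] Rc[OF h], symmetric] c[OF g h] det_smult using Rc[of "g \<otimes> h"] g h by simp
  have nz: "c g h \<noteq> 0" if g: "g \<in> carrier G" and h: "h \<in> carrier G" for g h
  proof
    assume "c g h = 0"
    then have "det (R g) * det (R h) = 0" using cdet[OF g h] n by simp
    then show False using Rdet0[OF g] Rdet0[OF h] by simp
  qed
  have root: "c g h ^ (n * m) = 1" if g: "g \<in> carrier G" and h: "h \<in> carrier G" for g h
  proof -
    have "(det (R g) * det (R h)) ^ m = (c g h ^ n) ^ m * det (R (g \<otimes> h)) ^ m"
      unfolding cdet[OF g h] by (rule power_mult_distrib)
    then show ?thesis using Rdetm[OF g] Rdetm[OF h] Rdetm[OF m_closed[OF g h]] by (simp add: power_mult_distrib power_mult)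
  qed
  have uniq: "a = b" if "g \<in> carrier G" "a \<cdot>\<^sub>m R g = b \<cdot>\<^sub>m R g" for a b g
    by (rule smult_mat_cancel[OF Rc[OF that(1)] n Rdet0[OF that(1)] that(2)])
  have ss: "a \<cdot>\<^sub>m (b \<cdot>\<^sub>m B) = (a * b) \<cdot>\<^sub>m B" for a b and B :: "'k mat" by (intro eq_matI) auto
  \<comment> \<open>Associativity of \<open>R g * R h * R y\<close>, with the invertible matrix
    \<open>R (g \<otimes> h \<otimes> y)\<close> cancelled by \<open>uniq\<close>.\<close>
  have cocycle: "c g h * c (g \<otimes> h) y = c h y * c g (h \<otimes> y)"
    if g: "g \<in> carrier G" and h: "h \<in> carrier G" and y: "y \<in> carrier G" for g h y
  proof (rule uniq[of "g \<otimes> h \<otimes> y"])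
    note gh = m_closed[OF g h] and hy = m_closed[OF h y]
    have "(c g h * c (g \<otimes> h) y) \<cdot>\<^sub>m R (g \<otimes> h \<otimes> y) = (c g h \<cdot>\<^sub>m R (g \<otimes> h)) * R y"
      using mult_smult_assoc_mat[OF Rc[OF gh] Rc[OF y]] c[OF gh y] ss by simp
    also have "\<dots> = R g * (R h * R y)"
      unfolding c[OF g h, symmetric] by (rule assoc_mult_mat[OF Rc[OF g] Rc[OF h] Rc[OF y]])
    also have "\<dots> = (c h y * c g (h \<otimes> y)) \<cdot>\<^sub>m R (g \<otimes> (h \<otimes> y))"
      unfolding c[OF h y] using mult_smult_distrib[OF Rc[OF g] Rc[OF hy]] c[OF g hy] ss by simp
    also have "g \<otimes> (h \<otimes> y) = g \<otimes> h \<otimes> y" using g h y by (simp add: m_assoc)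
    finally show "(c g h * c (g \<otimes> h) y) \<cdot>\<^sub>m R (g \<otimes> h \<otimes> y) = (c h y * c g (h \<otimes> y)) \<cdot>\<^sub>m R (g \<otimes> h \<otimes> y)" .
  qed (use g h y in simp)
  have cinv: "c g (x \<otimes> y) = c g y" if g: "g \<in> carrier G" and x: "x \<in> H" and y: "y \<in> carrier G" for g x y
  proof (rule uniq[of "g \<otimes> (x \<otimes> y)"])
    have xy: "x \<otimes> y \<in> carrier G" using HG[OF x] y by simp
    have gxg: "g \<otimes> x \<otimes> inv g \<in> H" by (rule inv_op_closed2[OF g x])
    have gy: "g \<otimes> y \<in> carrier G" using g y by simp
    have e: "g \<otimes> x \<otimes> inv g \<otimes> (g \<otimes> y) = g \<otimes> (x \<otimes> y)"
    proof -
      have "inv g \<otimes> (g \<otimes> v) = v" if "v \<in> carrier G" for v using that g by (simp add: m_assoc[symmetric])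
      then show ?thesis using g y HG[OF x] by (simp add: m_assoc)
    qed
    have "c g (x \<otimes> y) \<cdot>\<^sub>m R (g \<otimes> (x \<otimes> y)) = R g * (\<sigma> x * R y)"
      unfolding c[OF g xy, symmetric] RH[OF x y] ..
    also have "\<dots> = R g * \<sigma> x * R y" by (rule assoc_mult_mat[OF Rc[OF g] \<sigma>c[OF x] Rc[OF y], symmetric])
    also have "\<dots> = \<sigma> (g \<otimes> x \<otimes> inv g) * (R g * R y)"
      unfolding Rint[OF g x] by (rule assoc_mult_mat[OF \<sigma>c[OF gxg] Rc[OF g] Rc[OF y]])
    also have "\<dots> = c g y \<cdot>\<^sub>m (\<sigma> (g \<otimes> x \<otimes> inv g) * R (g \<otimes> y))"
      unfolding c[OF g y] by (rule mult_smult_distrib[OF \<sigma>c[OF gxg] Rc[OF gy]])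
    also have "\<sigma> (g \<otimes> x \<otimes> inv g) * R (g \<otimes> y) = R (g \<otimes> (x \<otimes> y))" unfolding RH[OF gxg gy, symmetric] e ..
    finally show "c g (x \<otimes> y) \<cdot>\<^sub>m R (g \<otimes> (x \<otimes> y)) = c g y \<cdot>\<^sub>m R (g \<otimes> (x \<otimes> y))" .
  qed (use g HG[OF x] y in simp)
  obtain \<phi> where \<phi>: "\<And>g. g \<in> carrier G \<Longrightarrow> \<phi> g \<noteq> 0"
    "\<And>g h. g \<in> carrier G \<Longrightarrow> h \<in> carrier G \<Longrightarrow> c g h * \<phi> (g \<otimes> h) = \<phi> g * \<phi> h"
    using cocycle_trivialization[OF fin nz cocycle cinv root cop] by blast
  define \<rho> where "\<rho> = (\<lambda>g. (1 / \<phi> g) \<cdot>\<^sub>m R g)"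
  have \<rho>c: "\<rho> g \<in> carrier_mat n n" if "g \<in> carrier G" for g using Rc[OF that] by (simp add: \<rho>_def)
  have \<rho>m: "\<rho> (g \<otimes> h) = \<rho> g * \<rho> h" if g: "g \<in> carrier G" and h: "h \<in> carrier G" for g h
  proof -
    have "\<rho> g * \<rho> h = (1 / \<phi> g) \<cdot>\<^sub>m ((1 / \<phi> h) \<cdot>\<^sub>m (R g * R h))"
      unfolding \<rho>_def mult_smult_assoc_mat[OF Rc[OF g] smult_carrier_mat[OF Rc[OF h]]] mult_smult_distrib[OF Rc[OF g] Rc[OF h]] ..
    also have "\<dots> = (1 / \<phi> g * (1 / \<phi> h) * c g h) \<cdot>\<^sub>m R (g \<otimes> h)" unfolding c[OF g h] by (simp add: ss mult.assoc)
    also have "1 / \<phi> g * (1 / \<phi> h) * c g h = 1 / \<phi> (g \<otimes> h)"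
      using \<phi>(2)[OF g h] \<phi>(1)[OF g] \<phi>(1)[OF h] \<phi>(1)[OF m_closed[OF g h]] by (simp add: field_simps)
    finally show ?thesis by (simp add: \<rho>_def)
  qed
  \<comment> \<open>The representative of \<open>H\<close> itself is arbitrary, so
    \<open>R \<one>\<close> may differ from the identity matrix. But \<open>\<rho> \<one>\<close> is
    invertible and idempotent.\<close>
  have \<rho>1: "\<rho> \<one> = 1\<^sub>m n"
  proof -
    have "det (\<rho> \<one>) \<noteq> 0" unfolding \<rho>_def det_smult using \<phi>(1)[of \<one>] Rdet0[of \<one>] by simp
    then obtain Y where Y: "Y \<in> carrier_mat n n" "Y * \<rho> \<one> = 1\<^sub>m n" using det_nonzero_inverse[OF \<rho>c[OF one_closed]] by blast
    have "\<rho> \<one> = Y * (\<rho> \<one> * \<rho> \<one>)"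
      using assoc_mult_mat[OF Y(1) \<rho>c[OF one_closed] \<rho>c[OF one_closed]] Y(2) \<rho>c[OF one_closed] by simp
    also have "\<rho> \<one> * \<rho> \<one> = \<rho> \<one>" using \<rho>m[of \<one> \<one>] by simp
    finally show ?thesis using Y(2) by simp
  qed
  have rep: "mat_rep G n \<rho>" using \<rho>c \<rho>m \<rho>1 by (simp add: mat_rep_def)
  \<comment> \<open>On \<open>H\<close> the two representations agree up to nonzero scalars, so
    every subspace invariant under \<open>\<rho>\<close> is invariant under \<open>\<sigma>\<close>;
    this carries irreducibility over.\<close>
  have \<sigma>\<rho>: "\<sigma> x = (\<phi> x / \<phi> \<one>) \<cdot>\<^sub>m \<rho> x" if x: "x \<in> H" for x
  proof -
    have "\<rho> x = (1 / \<phi> x) \<cdot>\<^sub>m (\<sigma> x * R \<one>)" unfolding \<rho>_def using RH[OF x one_closed] HG[OF x] by simp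
    also have "R \<one> = \<phi> \<one> \<cdot>\<^sub>m \<rho> \<one>" unfolding \<rho>_def using \<phi>(1)[of \<one>] by (simp add: ss) (intro eq_matI, auto)
    also have "\<sigma> x * (\<phi> \<one> \<cdot>\<^sub>m \<rho> \<one>) = \<phi> \<one> \<cdot>\<^sub>m \<sigma> x"
      unfolding \<rho>1 using mult_smult_distrib[OF \<sigma>c[OF x] one_carrier_mat] \<sigma>c[OF x] by simp
    finally have "\<rho> x = (1 / \<phi> x * \<phi> \<one>) \<cdot>\<^sub>m \<sigma> x" by (simp add: ss)
    then show ?thesis using \<phi>(1)[OF HG[OF x]] \<phi>(1)[OF one_closed] by (simp add: ss) (intro eq_matI, auto)
  qed
  have "W = {0\<^sub>v n} \<or> W = carrier_vec n"
    if W: "vec_subspace n W" "\<forall>g\<in>carrier G. \<forall>w\<in>W. \<rho> g *\<^sub>v w \<in> W" for W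
  proof -
    have "\<sigma> x *\<^sub>v w \<in> W" if x: "x \<in> H" and w: "w \<in> W" for x w
    proof -
      have wc: "w \<in> carrier_vec n" using W(1) w by (auto simp: vec_subspace_def)
      have "\<sigma> x *\<^sub>v w = (\<phi> x / \<phi> \<one>) \<cdot>\<^sub>v (\<rho> x *\<^sub>v w)"
        unfolding \<sigma>\<rho>[OF x] using \<rho>c[OF HG[OF x]] wc by (intro eq_vecI) auto
      then show ?thesis using W w HG[OF x] by (simp add: vec_subspace_def)
    qed
    then show ?thesis using \<sigma> W(1) unfolding GH.irreducible_rep_iff by simp
  qed
  then have "irreducible_rep G n \<rho>" unfolding irreducible_rep_iff using n rep by blast
  then show ?thesis by (rule that)
qed

end

section \<open>Thompson's theorem on character degrees\<close>

lemma root_of_unity_coprime_eq_one: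
  fixes x :: "'k::field"
  assumes "x ^ p = 1" "x ^ m = 1" "coprime p m" "p \<noteq> 0"
  shows "x = 1"
proof -
  have "gcd p m = 1" using assms(3) by (rule coprime_imp_gcd_eq_1)
  then obtain u v where uv: "p * u = m * v + 1" using bezout_nat[OF assms(4), of m] by auto
  have "x ^ (p * u) = x ^ (m * v) * x" unfolding uv by simp
  then show ?thesis using assms(1,2) by (simp add: power_mult)
qed

context group
begin

definition linear_chars :: "('a \<Rightarrow> 'k::field) set" where
  "linear_chars = {\<alpha> \<in> extensional (carrier G). \<alpha> \<one> = 1 \<and>
     (\<forall>x\<in>carrier G. \<forall>y\<in>carrier G. \<alpha> (x \<otimes> y) = \<alpha> x * \<alpha> y)}"

lemma linear_chars_iff:
  fixes \<alpha> :: "'a \<Rightarrow> 'k::field_char_0"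
  shows "\<alpha> \<in> linear_chars \<longleftrightarrow> \<alpha> \<in> irr_chars G \<and> char_degree G \<alpha> = 1"
proof
  assume \<alpha>: "\<alpha> \<in> linear_chars"
  define \<rho> where "\<rho> = (\<lambda>g. mat 1 1 (\<lambda>_. \<alpha> g))"
  have "mat_rep G 1 \<rho>"
    using \<alpha> unfolding mat_rep_def \<rho>_def linear_chars_def
    by (auto intro!: eq_matI simp: scalar_prod_def)
  then have \<rho>: "irreducible_rep G 1 \<rho>" by (rule one_dim_irreducible)
  have e: "\<alpha> = rep_character G \<rho>"
  proof (rule extensionalityI[of _ "carrier G"])
    show "\<alpha> \<in> extensional (carrier G)" using \<alpha> by (simp add: linear_chars_def)
  qed (auto simp: rep_character_def mat_trace_def \<rho>_def)
  show "\<alpha> \<in> irr_chars G \<and> char_degree G \<alpha> = 1"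
    using \<rho> rep_character_degree[OF is_group \<rho>] unfolding e irr_chars_def by blast
next
  assume \<alpha>: "\<alpha> \<in> irr_chars G \<and> char_degree G \<alpha> = 1"
  then obtain n \<rho> where \<rho>: "irreducible_rep G n \<rho>" "\<alpha> = rep_character G \<rho>" by (blast elim: irr_charsE)
  have "n = 1" using rep_character_degree[OF is_group \<rho>(1)] \<rho>(2) \<alpha> by simp
  note r = irreducible_rep_mat_rep[OF \<rho>(1), unfolded \<open>n = 1\<close>]
  note c = mat_rep_carrier[OF r]
  have v: "\<alpha> x = \<rho> x $$ (0, 0)" if "x \<in> carrier G" for x
    using that by (simp add: \<rho>(2) rep_character_apply mat_trace_carrier[OF c])
  have "\<alpha> (x \<otimes> y) = \<alpha> x * \<alpha> y" if "x \<in> carrier G" "y \<in> carrier G" for x y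
    using that c[OF that(1)] c[OF that(2)] by (simp add: v mat_rep_mult[OF r] scalar_prod_def)
  moreover have "\<alpha> \<one> = 1" using irr_char_one(1)[of \<alpha>] \<alpha> by simp
  ultimately show "\<alpha> \<in> linear_chars"
    using irr_char_extensional[of \<alpha>] \<alpha> by (simp add: linear_chars_def)
qed

lemma linear_char_pow:
  assumes "\<alpha> \<in> linear_chars" "x \<in> carrier G"
  shows "\<alpha> (x [^] (k::nat)) = \<alpha> x ^ k"
  using assms by (induction k) (auto simp: linear_chars_def)

lemma linear_char_nonzero:
  assumes "\<alpha> \<in> linear_chars" "x \<in> carrier G"
  shows "\<alpha> x \<noteq> (0 :: 'k::field)"
proof
  assume "\<alpha> x = 0"
  moreover have "\<alpha> (x \<otimes> inv x) = \<alpha> x * \<alpha> (inv x)"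
    using assms inv_closed[OF assms(2)] unfolding linear_chars_def by blast
  moreover have "\<alpha> \<one> = 1" using assms(1) by (simp add: linear_chars_def)
  ultimately show False using assms(2) by simp
qed

text \<open>For \<open>m\<close> the \<open>p'\<close>-part of the group order this is \<open>O^p(G)\<close>.\<close>

definition coprime_order_subgroup :: "nat \<Rightarrow> 'a set" where
  "coprime_order_subgroup m = generate G {g \<in> carrier G. g [^] m = \<one>}"

lemma coprime_order_subgroup_normal: "coprime_order_subgroup m \<lhd> G"
  unfolding coprime_order_subgroup_def
proof (rule normal_generateI)
  fix h g assume h: "h \<in> {g \<in> carrier G. g [^] m = \<one>}" and g: "g \<in> carrier G"
  have "(g \<otimes> h \<otimes> inv g) [^] k = g \<otimes> h [^] k \<otimes> inv g" for k :: nat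
  proof (induction k)
    case (Suc k)
    have "inv g \<otimes> (g \<otimes> u) = u" if "u \<in> carrier G" for u using that g by (simp add: m_assoc[symmetric])
    then show ?case unfolding nat_pow_Suc Suc.IH using h g by (simp add: m_assoc)
  qed (use g in simp)
  then show "g \<otimes> h \<otimes> inv g \<in> {g \<in> carrier G. g [^] m = \<one>}" using h g by simp
qed blast

text \<open>For a prime \<open>r\<close> other than \<open>p\<close> the order of a Sylow
  \<open>r\<close>-subgroup divides \<open>m\<close>, so that subgroup lies among the generators.
  The full power of \<open>r\<close> therefore divides the order of \<open>N\<close>, and
  \<open>r\<close> cannot divide the index.\<close>

lemma coprime_order_subgroup_index:
  assumes fin: "finite (carrier G)" and p: "prime p" and card: "card (carrier G) = p ^ e * m"
  obtains k where "card (rcosets (coprime_order_subgroup m)) = p ^ k"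
proof -
  define N where "N = coprime_order_subgroup m"
  have N: "subgroup N G" unfolding N_def by (rule normal_imp_subgroup[OF coprime_order_subgroup_normal])
  have lag: "card (rcosets N) * card N = card (carrier G)" using lagrange[OF N] by (simp add: Coset.order_def)
  have "card (carrier G) > 0" using fin by (auto simp: card_gt_0_iff)
  then have c0: "card (rcosets N) > 0" using lag by (metis mult_0 neq0_conv)
  have "r = p" if r: "prime r" "r dvd card (rcosets N)" for r
  proof (rule ccontr)
    assume rp: "r \<noteq> p"
    obtain f l where fl: "card (carrier G) = r ^ f * l" "\<not> r dvd l"
      using prime_power_decompose[OF r(1) \<open>card (carrier G) > 0\<close>] by metis
    obtain Q where Q: "subgroup Q G" "card Q = r ^ f"
      using sylow_thm[OF r(1) is_group _ fin, of f l] fl by (auto simp: Coset.order_def)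
    have "coprime (r ^ f) (p ^ e)" using primes_coprime[OF r(1) p rp] by simp
    moreover have "r ^ f dvd p ^ e * m" using fl(1) card by (metis dvd_triv_left)
    ultimately have "r ^ f dvd m" using coprime_dvd_mult_right_iff by blast
    then obtain u where u: "m = r ^ f * u" by blast
    have "Q \<subseteq> N"
    proof
      fix x assume x: "x \<in> Q"
      interpret GQ: group "G\<lparr>carrier := Q\<rparr>" by (rule subgroup.subgroup_is_group[OF Q(1) is_group])
      have xG: "x \<in> carrier G" using x subgroup.subset[OF Q(1)] by blast
      have "x [^]\<^bsub>G\<lparr>carrier := Q\<rparr>\<^esub> (r ^ f) = \<one>"
        using GQ.pow_order_eq_1[of x] x Q(2) by (simp add: Coset.order_def)
      then have "x [^] (r ^ f) = \<one>" using nat_pow_consistent[of x "r ^ f" Q] by metis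
      then have "x [^] m = \<one>" unfolding u using xG by (simp flip: nat_pow_pow)
      then show "x \<in> N" unfolding N_def coprime_order_subgroup_def using xG by (intro generate.incl) simp
    qed
    interpret GN: group "G\<lparr>carrier := N\<rparr>" by (rule subgroup.subgroup_is_group[OF N is_group])
    have "subgroup Q (G\<lparr>carrier := N\<rparr>)" by (rule subgroup_incl[OF Q(1) N \<open>Q \<subseteq> N\<close>])
    then have "card (rcosets\<^bsub>G\<lparr>carrier := N\<rparr>\<^esub> Q) * card Q = card N" using GN.lagrange by (simp add: Coset.order_def)
    then have "r ^ f dvd card N" unfolding Q(2) by (metis dvd_triv_right)
    then have "r * r ^ f dvd card (carrier G)" unfolding lag[symmetric] using r(2) by (rule mult_dvd_mono[rotated])
    then have "r ^ f * r dvd r ^ f * l" unfolding fl(1) by (simp only: mult.commute)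
    then have "r dvd l" using r(1) by (simp add: prime_gt_0_nat)
    then show False using fl(2) by simp
  qed
  then obtain k where "card (rcosets N) = p ^ k" using only_prime_divisor_power[OF p c0] by blast
  then show ?thesis using that unfolding N_def by blast
qed

text \<open>The generators satisfy \<open>g [^] m = \<one>\<close> and \<open>\<alpha>\<close> is
  multiplicative. In Thompson's theorem this supplies the determinant hypothesis of
  \<open>invariant_rep_extends\<close> and also rules out elements of order \<open>p\<close> among
  the invariant linear characters.\<close>

lemma linear_char_coprime_order_subgroup:
  assumes \<alpha>: "\<alpha> \<in> group.linear_chars (G\<lparr>carrier := coprime_order_subgroup m\<rparr>)"
    and x: "x \<in> coprime_order_subgroup m"
  shows "\<alpha> x ^ m = (1 :: 'k::field)"
proof -
  define N where "N = coprime_order_subgroup m"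
  have N: "subgroup N G" unfolding N_def by (rule normal_imp_subgroup[OF coprime_order_subgroup_normal])
  interpret GN: group "G\<lparr>carrier := N\<rparr>" by (rule subgroup.subgroup_is_group[OF N is_group])
  have \<alpha>: "\<alpha> \<in> GN.linear_chars" using \<alpha> unfolding N_def .
  have S: "\<alpha> g ^ m = 1" if g: "g \<in> carrier G" "g [^] m = \<one>" for g
  proof -
    have gN: "g \<in> N" unfolding N_def coprime_order_subgroup_def using g by (intro generate.incl) simp
    have "\<alpha> (g [^]\<^bsub>G\<lparr>carrier := N\<rparr>\<^esub> m) = \<alpha> g ^ m" using GN.linear_char_pow[OF \<alpha>, of g] gN by simp
    moreover have "g [^]\<^bsub>G\<lparr>carrier := N\<rparr>\<^esub> m = \<one>" using nat_pow_consistent[of g m N] g(2) by metis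
    ultimately show ?thesis using \<alpha> by (simp add: GN.linear_chars_def)
  qed
  have mult: "\<alpha> (y \<otimes> z) = \<alpha> y * \<alpha> z" if "y \<in> N" "z \<in> N" for y z
    using \<alpha> that by (simp add: GN.linear_chars_def)
  have "x \<in> generate G {g \<in> carrier G. g [^] m = \<one>}" using x unfolding coprime_order_subgroup_def .
  then show ?thesis
  proof (induction rule: generate.induct)
    case one
    then show ?case using \<alpha> by (simp add: GN.linear_chars_def)
  next
    case (incl h)
    then show ?case using S by blast
  next
    case (inv h)
    then have "inv h [^] m = \<one>" by (simp add: nat_pow_inv)
    then show ?case using S inv by simp
  next
    case (eng h1 h2)
    then have "h1 \<in> N" "h2 \<in> N" by (simp_all add: N_def coprime_order_subgroup_def)
    then show ?case using eng.IH by (simp add: mult power_mult_distrib)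
  qed
qed

end

section \<open>Invariant linear characters and the action on irreducible characters\<close>

context normal
begin

definition invariant_linear_chars :: "('a \<Rightarrow> 'k::field) set" where
  "invariant_linear_chars = {\<alpha> \<in> group.linear_chars GH. \<forall>t\<in>carrier G. conj_char \<alpha> t = \<alpha>}"

definition invariant_linear_group :: "('a \<Rightarrow> 'k::field) monoid" where
  "invariant_linear_group = \<lparr>carrier = invariant_linear_chars,
     monoid.mult = (\<lambda>\<alpha> \<beta>. \<lambda>x\<in>H. \<alpha> x * \<beta> x), one = (\<lambda>x\<in>H. 1)\<rparr>"

lemma invariant_linear_charsD:
  assumes "\<alpha> \<in> invariant_linear_chars"
  shows "\<alpha> \<in> extensional H" "\<alpha> \<one> = 1" "x \<in> H \<Longrightarrow> y \<in> H \<Longrightarrow> \<alpha> (x \<otimes> y) = \<alpha> x * \<alpha> y"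
    "t \<in> carrier G \<Longrightarrow> x \<in> H \<Longrightarrow> \<alpha> (t \<otimes> x \<otimes> inv t) = \<alpha> x" "x \<in> H \<Longrightarrow> \<alpha> x \<noteq> (0 :: 'k::field)"
proof -
  interpret GH: group GH by (rule GH_group)
  have \<alpha>: "\<alpha> \<in> GH.linear_chars" "\<And>t. t \<in> carrier G \<Longrightarrow> conj_char \<alpha> t = \<alpha>"
    using assms by (auto simp: invariant_linear_chars_def)
  then show "\<alpha> \<in> extensional H" "\<alpha> \<one> = 1" "x \<in> H \<Longrightarrow> y \<in> H \<Longrightarrow> \<alpha> (x \<otimes> y) = \<alpha> x * \<alpha> y"
    by (auto simp: GH.linear_chars_def)
  show "x \<in> H \<Longrightarrow> \<alpha> x \<noteq> (0 :: 'k::field)" using GH.linear_char_nonzero[OF \<alpha>(1)] by simp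
  show "\<alpha> (t \<otimes> x \<otimes> inv t) = \<alpha> x" if t: "t \<in> carrier G" and x: "x \<in> H"
  proof -
    have "conj_char \<alpha> t x = \<alpha> (t \<otimes> x \<otimes> inv t)" using x by (simp add: conj_char_def)
    then show ?thesis using \<alpha>(2)[OF t] by simp
  qed
qed

lemma invariant_linear_charsI:
  assumes "\<alpha> \<in> extensional H" "\<alpha> \<one> = 1" "\<And>x y. x \<in> H \<Longrightarrow> y \<in> H \<Longrightarrow> \<alpha> (x \<otimes> y) = \<alpha> x * \<alpha> y"
    "\<And>t x. t \<in> carrier G \<Longrightarrow> x \<in> H \<Longrightarrow> \<alpha> (t \<otimes> x \<otimes> inv t) = \<alpha> x"
  shows "\<alpha> \<in> (invariant_linear_chars :: ('a \<Rightarrow> 'k::field) set)"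
proof -
  interpret GH: group GH by (rule GH_group)
  have "conj_char \<alpha> t = \<alpha>" if t: "t \<in> carrier G" for t
    by (rule extensionalityI[of _ H]) (use assms t in \<open>auto simp: conj_char_def\<close>)
  then show ?thesis using assms(1-3) by (simp add: invariant_linear_chars_def GH.linear_chars_def)
qed

lemma invariant_linear_group: "group (invariant_linear_group :: ('a \<Rightarrow> 'k::field) monoid)"
proof -
  note D = invariant_linear_charsD
  note cl = inv_op_closed2
  have HH: "x \<otimes> y \<in> H" if "x \<in> H" "y \<in> H" for x y using that by (rule subgroup.m_closed[OF subgroup_axioms])
  have one: "(\<lambda>x\<in>H. 1 :: 'k) \<in> invariant_linear_chars"
    by (rule invariant_linear_charsI) (auto simp: oneH HH cl)
  show ?thesis
  proof (rule groupI, unfold invariant_linear_group_def, simp_all only: monoid.simps partial_object.simps)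
    fix \<alpha> \<beta> :: "'a \<Rightarrow> 'k" assume \<alpha>: "\<alpha> \<in> invariant_linear_chars" and \<beta>: "\<beta> \<in> invariant_linear_chars"
    show "(\<lambda>x\<in>H. \<alpha> x * \<beta> x) \<in> invariant_linear_chars"
      by (rule invariant_linear_charsI) (auto simp: oneH HH cl D(2)[OF \<alpha>] D(2)[OF \<beta>] D(3)[OF \<alpha>] D(3)[OF \<beta>] D(4)[OF \<alpha>] D(4)[OF \<beta>])
  next
    fix \<alpha> \<beta> \<gamma> :: "'a \<Rightarrow> 'k"
    show "(\<lambda>x\<in>H. (\<lambda>x\<in>H. \<alpha> x * \<beta> x) x * \<gamma> x) = (\<lambda>x\<in>H. \<alpha> x * (\<lambda>x\<in>H. \<beta> x * \<gamma> x) x)"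
      by (auto simp: mult.assoc)
  next
    fix \<alpha> :: "'a \<Rightarrow> 'k" assume \<alpha>: "\<alpha> \<in> invariant_linear_chars"
    show "(\<lambda>x\<in>H. (\<lambda>x\<in>H. 1) x * \<alpha> x) = \<alpha>"
      by (rule extensionalityI[of _ H]) (use D(1)[OF \<alpha>] in auto)
    have "(\<lambda>x\<in>H. 1 / \<alpha> x) \<in> invariant_linear_chars"
      by (rule invariant_linear_charsI) (auto simp: oneH HH cl D(2)[OF \<alpha>] D(3)[OF \<alpha>] D(4)[OF \<alpha>])
    moreover have "(\<lambda>x\<in>H. (\<lambda>x\<in>H. 1 / \<alpha> x) x * \<alpha> x) = (\<lambda>x\<in>H. 1)"
      using D(5)[OF \<alpha>] by auto
    ultimately show "\<exists>\<beta>\<in>invariant_linear_chars. (\<lambda>x\<in>H. \<beta> x * \<alpha> x) = (\<lambda>x\<in>H. 1)" by blast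
  qed (rule one)
qed

text \<open>Otherwise the group of these characters has an element of order \<open>p\<close>, for
  which \<open>central_sylow_element_exists\<close> plays the part of Cauchy's theorem. Its values
  are both \<open>p\<close>-th and \<open>m\<close>-th roots of unity and hence 1.\<close>

lemma prime_not_dvd_card_invariant_linear_chars:
  assumes fin: "finite (invariant_linear_chars :: ('a \<Rightarrow> 'k::field) set)" and p: "prime p" "\<not> p dvd m"
    and pow: "\<And>\<alpha> x. \<alpha> \<in> invariant_linear_chars \<Longrightarrow> x \<in> H \<Longrightarrow> \<alpha> x ^ m = (1 :: 'k)"
  shows "\<not> p dvd card (invariant_linear_chars :: ('a \<Rightarrow> 'k) set)"
proof
  assume d: "p dvd card (invariant_linear_chars :: ('a \<Rightarrow> 'k) set)"
  interpret L: group "invariant_linear_group :: ('a \<Rightarrow> 'k) monoid" by (rule invariant_linear_group)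
  have car: "carrier invariant_linear_group = (invariant_linear_chars :: ('a \<Rightarrow> 'k) set)"
    by (simp add: invariant_linear_group_def)
  obtain \<alpha> :: "'a \<Rightarrow> 'k" where "L.central_sylow_element p \<alpha>"
    using L.central_sylow_element_exists[OF _ p(1)] fin d unfolding car by blast
  then have \<alpha>: "\<alpha> \<in> invariant_linear_chars" "\<alpha> \<noteq> \<one>\<^bsub>invariant_linear_group\<^esub>"
    "\<alpha> [^]\<^bsub>invariant_linear_group\<^esub> p = \<one>\<^bsub>invariant_linear_group\<^esub>"
    unfolding L.central_sylow_element_def car by auto
  have pw: "(\<alpha> [^]\<^bsub>invariant_linear_group\<^esub> k) x = \<alpha> x ^ k" if "x \<in> H" for x and k :: nat
    using that by (induction k) (simp_all add: L.nat_pow_Suc L.nat_pow_0, simp_all add: invariant_linear_group_def)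
  have "coprime p m" using p prime_imp_coprime by blast
  have "\<alpha> = \<one>\<^bsub>invariant_linear_group\<^esub>"
  proof (rule extensionalityI[of _ H])
    show "\<alpha> \<in> extensional H" by (rule invariant_linear_charsD(1)[OF \<alpha>(1)])
    fix x assume x: "x \<in> H"
    have "\<alpha> x ^ p = 1" unfolding pw[OF x, symmetric] \<alpha>(3) using x by (simp add: invariant_linear_group_def)
    then have "\<alpha> x = 1"
      using root_of_unity_coprime_eq_one[OF _ pow[OF \<alpha>(1) x] \<open>coprime p m\<close>] prime_gt_0_nat[OF p(1)] by simp
    then show "\<alpha> x = \<one>\<^bsub>invariant_linear_group\<^esub> x" using x by (simp add: invariant_linear_group_def)
  qed (simp add: invariant_linear_group_def)
  then show False using \<alpha>(2) by simp
qed

lemma conj_char_mult: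
  assumes "s \<in> carrier G" "t \<in> carrier G"
  shows "conj_char (conj_char \<theta> s) t = conj_char \<theta> (s \<otimes> t)"
  unfolding conj_char_def using assms subset inv_op_closed2[OF assms(2)]
  by (intro restrict_ext) (auto simp: inv_mult_group m_assoc subsetD)

lemma conj_char_self:
  assumes \<theta>: "\<theta> \<in> irr_chars GH" and t: "t \<in> H"
  shows "conj_char \<theta> t = \<theta>"
proof (rule extensionalityI[of _ H])
  interpret GH: group GH by (rule GH_group)
  show "\<theta> \<in> extensional H" using GH.irr_char_extensional[OF \<theta>] by simp
  show "conj_char \<theta> t x = \<theta> x" if "x \<in> H" for x
    using GH.irr_char_conj[OF \<theta>, of x t] that t by (simp add: conj_char_def GH_inv)
qed (simp add: conj_char_def)

text \<open>Conjugation of characters composes as a right action, see \<open>conj_char_mult\<close>;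
  inverting \<open>t\<close> turns it into a left action.\<close>

lemma conj_char_action:
  "group_action G (irr_chars GH :: ('a \<Rightarrow> 'k::field) set) (\<lambda>t. \<lambda>\<theta>\<in>irr_chars GH. conj_char \<theta> (inv t))"
proof -
  define E where "E = (irr_chars GH :: ('a \<Rightarrow> 'k) set)"
  have cE: "conj_char \<theta> t \<in> E" if "\<theta> \<in> E" "t \<in> carrier G" for \<theta> t
    using that unfolding E_def by (rule conj_char_irr)
  have one: "conj_char \<theta> \<one> = \<theta>" if "\<theta> \<in> E" for \<theta> using that unfolding E_def by (rule conj_char_one)
  have bij: "(\<lambda>\<theta>\<in>E. conj_char \<theta> (inv t)) \<in> Bij E" if t: "t \<in> carrier G" for t
    unfolding Bij_def
  proof (intro IntI CollectI)
    show "bij_betw (\<lambda>\<theta>\<in>E. conj_char \<theta> (inv t)) E E"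
      by (rule bij_betw_byWitness[where f'="\<lambda>\<theta>. conj_char \<theta> t"])
        (use t cE in \<open>auto simp: conj_char_mult one\<close>)
  qed auto
  have "(\<lambda>t. \<lambda>\<theta>\<in>E. conj_char \<theta> (inv t)) \<in> hom G (BijGroup E)"
  proof (rule homI)
    fix s t assume s: "s \<in> carrier G" and t: "t \<in> carrier G"
    show "(\<lambda>\<theta>\<in>E. conj_char \<theta> (inv (s \<otimes> t))) =
        (\<lambda>\<theta>\<in>E. conj_char \<theta> (inv s)) \<otimes>\<^bsub>BijGroup E\<^esub> (\<lambda>\<theta>\<in>E. conj_char \<theta> (inv t))"
      using s t bij[OF s] bij[OF t] cE
      by (auto simp: BijGroup_def compose_def conj_char_mult inv_mult_group intro!: restrict_ext)
  qed (use bij in \<open>simp add: BijGroup_def\<close>)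
  then show ?thesis
    unfolding group_action_def group_hom_def group_hom_axioms_def E_def
    using is_group group_BijGroup by blast
qed

end

context group
begin

lemma sum_degree_squares:
  assumes fin: "finite (carrier G)"
  shows "(\<Sum>\<chi>\<in>(irr_chars G :: ('a \<Rightarrow> 'k::{alg_closed_field, field_char_0}) set). char_degree G \<chi> ^ 2) = card (carrier G)"
proof -
  have "(of_nat (\<Sum>\<chi>\<in>(irr_chars G :: ('a \<Rightarrow> 'k) set). char_degree G \<chi> ^ 2) :: 'k) =
      (\<Sum>\<chi>\<in>irr_chars G. of_nat (char_degree G \<chi>) * \<chi> \<one>)"
    unfolding of_nat_sum by (intro sum.cong refl) (simp add: irr_char_one(1) power2_eq_square)
  also have "\<dots> = of_nat (card (carrier G))" using regular_character_sum[OF fin one_closed] by simp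
  finally show ?thesis using of_nat_eq_iff by blast
qed

theorem thompson_normal_complement:
  assumes fin: "finite (carrier G)" and p: "prime p"
    and deg: "\<And>n (\<rho> :: 'a \<Rightarrow> 'k::{alg_closed_field, field_char_0} mat). irreducible_rep G n \<rho> \<Longrightarrow> n = 1 \<or> p dvd n"
  obtains N k where "N \<lhd> G" "\<not> p dvd card N" "card (rcosets N) = p ^ k"
proof -
  have "card (carrier G) > 0" using fin by (auto simp: card_gt_0_iff)
  then obtain e m where em: "card (carrier G) = p ^ e * m" "\<not> p dvd m"
    using prime_power_decompose[OF p] by metis
  define N where "N = coprime_order_subgroup m"
  interpret N: normal N G unfolding N_def by (rule coprime_order_subgroup_normal)
  interpret GN: group N.GH by (rule N.GH_group)
  obtain k where k: "card (rcosets N) = p ^ k"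
    using coprime_order_subgroup_index[OF fin p em(1)] N_def by blast
  have finN: "finite (carrier N.GH)" using N.subset fin by (simp add: finite_subset)
  have "\<not> p dvd card N"
  proof
    assume pN: "p dvd card N"
    define E where "E = (irr_chars N.GH :: ('a \<Rightarrow> 'k) set)"
    have finE: "finite E" unfolding E_def by (rule GN.finite_irr_chars[OF finN])
    interpret act: group_action G E "\<lambda>t. \<lambda>\<theta>\<in>E. N.conj_char \<theta> (inv t)"
      unfolding E_def by (rule N.conj_char_action)
    \<comment> \<open>Degrees divisible by \<open>p\<close> get weight 0. This leaves the sum of
      squared degrees unchanged modulo \<open>p\<close> and removes the fixed points to which the
      extension theorem does not apply.\<close>
    define w :: "('a \<Rightarrow> 'k) \<Rightarrow> nat" where "w = (\<lambda>\<theta>. if p dvd char_degree N.GH \<theta> then 0 else char_degree N.GH \<theta> ^ 2)"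
    define F where "F = {\<theta> \<in> E. \<forall>t\<in>carrier G. (\<lambda>\<theta>\<in>E. N.conj_char \<theta> (inv t)) \<theta> = \<theta>}"
    have F: "N.conj_char \<theta> t = \<theta>" if \<theta>: "\<theta> \<in> F" and t: "t \<in> carrier G" for \<theta> t
    proof -
      have "\<theta> \<in> E" "(\<lambda>\<theta>\<in>E. N.conj_char \<theta> (inv (inv t))) \<theta> = \<theta>" using \<theta> t unfolding F_def by blast+
      then show ?thesis using t by simp
    qed
    \<comment> \<open>\<open>N\<close> acts trivially on its own characters, so each stabiliser
      contains \<open>N\<close> and the orbit size divides the index \<open>p ^ k\<close>.\<close>
    have orb: "card (orbit G (\<lambda>t. \<lambda>\<theta>\<in>E. N.conj_char \<theta> (inv t)) \<theta>) dvd p ^ k" if \<theta>: "\<theta> \<in> E" for \<theta>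
    proof -
      define S where "S = stabilizer G (\<lambda>t. \<lambda>\<theta>\<in>E. N.conj_char \<theta> (inv t)) \<theta>"
      have S: "subgroup S G" unfolding S_def by (rule act.stabilizer_subgroup[OF \<theta>])
      have NS: "N \<subseteq> S"
      proof
        fix t assume t: "t \<in> N"
        then have "N.conj_char \<theta> (inv t) = \<theta>" using N.conj_char_self[of \<theta> "inv t"] subgroup.m_inv_closed[OF N.subgroup_axioms t] \<theta> unfolding E_def by simp
        then show "t \<in> S" using t N.subset \<theta> by (auto simp: S_def stabilizer_def)
      qed
      interpret GS: group "G\<lparr>carrier := S\<rparr>" by (rule subgroup.subgroup_is_group[OF S is_group])
      have "subgroup N (G\<lparr>carrier := S\<rparr>)" by (rule subgroup_incl[OF N.subgroup_axioms S NS])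
      then have "card (rcosets\<^bsub>G\<lparr>carrier := S\<rparr>\<^esub> N) * card N = card S"
        using GS.lagrange by (simp add: Coset.order_def)
      then obtain j where j: "card S = j * card N" by metis
      have "card (orbit G (\<lambda>t. \<lambda>\<theta>\<in>E. N.conj_char \<theta> (inv t)) \<theta>) * card S = card (carrier G)"
        using act.orbit_stabilizer_theorem[OF \<theta>] by (simp add: S_def Coset.order_def)
      also have "\<dots> = p ^ k * card N" using lagrange[OF N.subgroup_axioms] k by (simp add: Coset.order_def)
      finally have "card (orbit G (\<lambda>t. \<lambda>\<theta>\<in>E. N.conj_char \<theta> (inv t)) \<theta>) * j * card N = p ^ k * card N"
        unfolding j by (simp only: mult.assoc)
      moreover have "card N \<noteq> 0" proof -
        have "finite N" using finN by simp
        then show ?thesis using N.oneH by (metis card_eq_0_iff empty_iff)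
      qed
      ultimately have "card (orbit G (\<lambda>t. \<lambda>\<theta>\<in>E. N.conj_char \<theta> (inv t)) \<theta>) * j = p ^ k" by simp
      then show ?thesis by (metis dvd_triv_left)
    qed
    have wt: "w ((\<lambda>\<theta>\<in>E. N.conj_char \<theta> (inv t)) \<theta>) = w \<theta>" if t: "t \<in> carrier G" and \<theta>: "\<theta> \<in> E" for t \<theta>
    proof -
      have "N.conj_char \<theta> (inv t) \<in> irr_chars N.GH" using N.conj_char_irr[of \<theta> "inv t"] \<theta> t by (simp add: E_def)
      then have "(of_nat (char_degree N.GH (N.conj_char \<theta> (inv t))) :: 'k) = N.conj_char \<theta> (inv t) \<one>"
        using GN.irr_char_one(1)[of "N.conj_char \<theta> (inv t)"] by simp
      also have "\<dots> = \<theta> \<one>" using t N.oneH by (simp add: N.conj_char_def)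
      also have "\<dots> = of_nat (char_degree N.GH \<theta>)" using GN.irr_char_one(1)[of \<theta>] \<theta> by (simp add: E_def)
      finally have "char_degree N.GH (N.conj_char \<theta> (inv t)) = char_degree N.GH \<theta>" using of_nat_eq_iff by blast
      then show ?thesis using \<theta> by (simp add: w_def)
    qed
    have "(\<Sum>\<theta>\<in>E. w \<theta>) mod p = (\<Sum>\<theta>\<in>F. w \<theta>) mod p"
      unfolding F_def by (rule act.fixed_points_weight_mod[OF p orb finE wt])
    moreover have "p dvd (\<Sum>\<theta>\<in>E. w \<theta>)"
    proof -
      have "p dvd (\<Sum>\<theta>\<in>E. char_degree N.GH \<theta> ^ 2)"
        using GN.sum_degree_squares[OF finN, where ?'k='k] pN by (simp add: E_def)
      moreover have "(\<Sum>\<theta>\<in>E. char_degree N.GH \<theta> ^ 2) = (\<Sum>\<theta>\<in>E. w \<theta>) +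
          (\<Sum>\<theta>\<in>E. if p dvd char_degree N.GH \<theta> then char_degree N.GH \<theta> ^ 2 else 0)"
        unfolding sum.distrib[symmetric] by (intro sum.cong refl) (simp add: w_def)
      moreover have "p dvd (\<Sum>\<theta>\<in>E. if p dvd char_degree N.GH \<theta> then char_degree N.GH \<theta> ^ 2 else 0)"
        by (intro dvd_sum) (simp add: power2_eq_square)
      ultimately show ?thesis by (simp add: dvd_add_left_iff)
    qed
    ultimately have pF: "p dvd (\<Sum>\<theta>\<in>F. w \<theta>)" by (simp add: dvd_eq_mod_eq_0)
    have L: "{\<theta> \<in> F. char_degree N.GH \<theta> = 1} = N.invariant_linear_chars"
    proof (rule Set.set_eqI)
      fix \<theta> :: "'a \<Rightarrow> 'k"
      have "\<theta> \<in> F \<longleftrightarrow> \<theta> \<in> irr_chars N.GH \<and> (\<forall>t\<in>carrier G. N.conj_char \<theta> t = \<theta>)"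
        using F[of \<theta>] by (auto simp: F_def E_def)
      then show "\<theta> \<in> {\<theta> \<in> F. char_degree N.GH \<theta> = 1} \<longleftrightarrow> \<theta> \<in> N.invariant_linear_chars"
        using GN.linear_chars_iff[of \<theta>] unfolding N.invariant_linear_chars_def mem_Collect_eq by blast
    qed
    have lin: "char_degree N.GH \<theta> = 1" if \<theta>: "\<theta> \<in> F" and np: "\<not> p dvd char_degree N.GH \<theta>" for \<theta>
    proof -
      have "\<theta> \<in> irr_chars N.GH" using \<theta> by (simp add: F_def E_def)
      then obtain n \<sigma> where \<sigma>: "irreducible_rep N.GH n \<sigma>" "\<theta> = rep_character N.GH \<sigma>" by (rule GN.irr_charsE)
      have n: "char_degree N.GH \<theta> = n" unfolding \<sigma>(2) by (rule rep_character_degree[OF N.GH_group \<sigma>(1)])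
      note r = GN.irreducible_rep_mat_rep[OF \<sigma>(1)]
      \<comment> \<open>The determinant is a linear character of \<open>N\<close>, so its
        \<open>m\<close>-th power is 1. With \<open>p\<close> dividing neither the degree nor
        \<open>m\<close>, the coprimality needed for extension holds.\<close>
      have dl: "(\<lambda>x\<in>N. det (\<sigma> x)) \<in> GN.linear_chars"
        unfolding GN.linear_chars_def
        using mat_rep_mult[OF r] mat_rep_one[OF r] det_mult[OF mat_rep_carrier[OF r] mat_rep_carrier[OF r]] N.oneH
          subgroup.m_closed[OF N.subgroup_axioms]
        by simp
      have d: "det (\<sigma> x) ^ m = 1" if x: "x \<in> N" for x
        using linear_char_coprime_order_subgroup[OF dl[unfolded N_def] x[unfolded N_def]] x by (simp add: N_def)
      have "coprime p (n * m)"
      proof (rule prime_imp_coprime[OF p])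
        show "\<not> p dvd n * m" using np em(2) p unfolding n by (simp add: prime_dvd_mult_iff)
      qed
      then have cop: "coprime (card (rcosets N)) (n * m)" unfolding k by simp
      have "N.conj_char (rep_character N.GH \<sigma>) t = rep_character N.GH \<sigma>" if "t \<in> carrier G" for t
        using F[OF \<theta> that] unfolding \<sigma>(2) .
      from N.invariant_rep_extends[OF fin \<sigma>(1) this d cop] obtain \<rho> :: "'a \<Rightarrow> 'k mat" where "irreducible_rep G n \<rho>" .
      then have "n = 1 \<or> p dvd n" by (rule deg)
      then show ?thesis using np n by simp
    qed
    have finF: "finite F" using finE by (simp add: F_def)
    \<comment> \<open>On fixed points the weight is the indicator of degree 1, so \<open>p\<close>
      would divide the number of invariant linear characters.\<close>
    have "(\<Sum>\<theta>\<in>F. w \<theta>) = (\<Sum>\<theta>\<in>F. if char_degree N.GH \<theta> = 1 then 1 else 0)"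
    proof (rule sum.cong[OF refl])
      fix \<theta> assume \<theta>: "\<theta> \<in> F"
      show "w \<theta> = (if char_degree N.GH \<theta> = 1 then 1 else 0)"
      proof (cases "p dvd char_degree N.GH \<theta>")
        case True
        then have "char_degree N.GH \<theta> \<noteq> 1" using prime_gt_1_nat[OF p] by (metis nat_dvd_1_iff_1 less_irrefl)
        then show ?thesis using True unfolding w_def by (simp only: if_True if_False)
      next
        case False
        then show ?thesis using lin[OF \<theta> False] unfolding w_def by (simp only: if_True if_False power_one simp_thms)
      qed
    qed
    also have "\<dots> = card {\<theta> \<in> F. char_degree N.GH \<theta> = 1}"
      using finF by (simp only: sum.inter_filter[symmetric] sum_constant of_nat_id mult.right_neutral)
    finally have "p dvd card (N.invariant_linear_chars :: ('a \<Rightarrow> 'k) set)" using pF unfolding L by simp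
    moreover have "finite (N.invariant_linear_chars :: ('a \<Rightarrow> 'k) set)" using finF unfolding L[symmetric] by simp
    moreover have "\<alpha> x ^ m = (1 :: 'k)" if "\<alpha> \<in> N.invariant_linear_chars" "x \<in> N" for \<alpha> x
    proof -
      have "\<alpha> \<in> GN.linear_chars" using that(1) unfolding N.invariant_linear_chars_def by blast
      then show ?thesis using linear_char_coprime_order_subgroup[of \<alpha> m x] that(2) unfolding N_def by blast
    qed
    ultimately show False using N.prime_not_dvd_card_invariant_linear_chars[OF _ p em(2)] by blast
  qed
  then show ?thesis using that N.normal_axioms k by blast
qed

end

section \<open>The three cases of the hypothesis\<close>

theorem proposition27:
  fixes G :: "('a, 'b) monoid_scheme"
    and \<psi> :: "'a \<Rightarrow> 'k::{alg_closed_field, field_char_0}"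
  assumes "group G"
    and "finite (carrier G)"
    and "peak_group TYPE('k) G"
    and "peak_character G \<psi>"
    and "(\<exists>p q n m :: nat. prime p \<and> prime q \<and> p \<noteq> q \<and>
            char_degree G \<psi> = p ^ n * q ^ m)
       \<or> (\<exists>p1 p2 p3 n1 n2 n3 :: nat.
            prime p1 \<and> prime p2 \<and> prime p3 \<and> p1 \<noteq> p2 \<and> p1 \<noteq> p3 \<and> p2 \<noteq> p3 \<and>
            0 < n1 \<and> 0 < n2 \<and> 0 < n3 \<and>
            char_degree G \<psi> = p1 ^ n1 * p2 ^ n2 * p3 ^ n3 \<and>
            (\<exists>p\<in>{p1, p2, p3}. has_normal_complement G p))
       \<or> (\<exists>p1 p2 p3 n1 n2 n3 :: nat.
            prime p1 \<and> prime p2 \<and> prime p3 \<and> p1 \<noteq> p2 \<and> p1 \<noteq> p3 \<and> p2 \<noteq> p3 \<and>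
            0 < n1 \<and> 0 < n2 \<and> 0 < n3 \<and>
            char_degree G \<psi> = p1 ^ n1 * p2 ^ n2 * p3 ^ n3 \<and>
            (\<exists>p\<in>{p1, p2, p3}. \<forall>\<chi> \<in> (irr_chars G :: ('a \<Rightarrow> 'k) set).
               nonlinear_char G \<chi> \<longrightarrow> p dvd char_degree G \<chi>))"
  shows "solvable G"
proof -
  interpret group G by fact
  note fin = assms(2)
  have dvd: "n dvd char_degree G \<psi>" if \<rho>: "irreducible_rep G n \<rho>" for n and \<rho> :: "'a \<Rightarrow> 'k mat"
  proof -
    have "rep_character G \<rho> \<in> irr_chars G" using \<rho> by (auto simp: irr_chars_def)
    then have "char_degree G (rep_character G \<rho>) \<in> char_degrees TYPE('k) G" by (simp add: char_degrees_def)
    then show ?thesis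
      using assms(4) rep_character_degree[OF is_group \<rho>] by (simp add: peak_character_def peak_degree_def)
  qed
  have three: "degree_primes_in TYPE('k) G {p1, p2, p3}"
    if "prime p1" "prime p2" "prime p3" "char_degree G \<psi> = p1 ^ n1 * p2 ^ n2 * p3 ^ n3" for p1 p2 p3 n1 n2 n3
    unfolding degree_primes_in_def
  proof (intro allI impI)
    fix n r and \<rho> :: "'a \<Rightarrow> 'k mat"
    assume \<rho>: "irreducible_rep G n \<rho>" and r: "prime r" "r dvd n"
    have "r dvd p1 ^ n1 * p2 ^ n2 * p3 ^ n3" using dvd_trans[OF r(2) dvd[OF \<rho>]] that(4) by simp
    then have "r dvd p1 \<or> r dvd p2 \<or> r dvd p3" using r(1) by (auto simp: prime_dvd_mult_iff dest: prime_dvd_power)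
    then show "r \<in> {p1, p2, p3}" using that(1-3) r(1) primes_dvd_imp_eq by blast
  qed
  \<comment> \<open>The exponent \<open>k\<close> is unrestricted here, so the subgroup delivered by
    Thompson's theorem fits, whose index is not claimed to be nontrivial.\<close>
  have complement: "solvable G"
    if pr: "prime p1" "prime p2" "prime p3" "p1 \<noteq> p2" "p1 \<noteq> p3" "p2 \<noteq> p3"
      and d: "char_degree G \<psi> = p1 ^ n1 * p2 ^ n2 * p3 ^ n3"
      and p: "p \<in> {p1, p2, p3}" and N: "N \<lhd> G" "\<not> p dvd card N" "card (rcosets\<^bsub>G\<^esub> N) = p ^ k"
    for p1 p2 p3 n1 n2 n3 p k N
  proof -
    note s = normal.p_complement_solvable[OF N(1) fin, where p=p and k=k and ?'k='k]
    have deg: "degree_primes_in TYPE('k) G {p1, p2, p3}" by (rule three[OF pr(1-3) d])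
    consider "p = p1" | "p = p2" | "p = p3" using p by blast
    then show ?thesis
    proof cases
      case 1
      show ?thesis by (rule s[of p2 p3]) (use 1 pr deg N in auto)
    next
      case 2
      have "{p1, p2, p3} = {p2, p1, p3}" by auto
      then show ?thesis by (intro s[of p1 p3]) (use 2 pr deg N in auto)
    next
      case 3
      have "{p1, p2, p3} = {p3, p1, p2}" by auto
      then show ?thesis by (intro s[of p1 p2]) (use 3 pr deg N in auto)
    qed
  qed
  from assms(5) show ?thesis
  proof (elim disjE exE conjE bexE)
    fix p q n m :: nat
    assume pq: "prime p" "prime q" "p \<noteq> q" and d: "char_degree G \<psi> = p ^ n * q ^ m"
    \<comment> \<open>The two-prime case enters \<open>three\<close> with \<open>q\<close> repeated
      as third prime, to the exponent 0.\<close>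
    have "degree_primes_in TYPE('k) G {p, q, q}" by (rule three[of p q q n m 0]) (use pq d in auto)
    then show ?thesis using two_prime_degrees_solvable[OF is_group fin pq, where ?'k='k] by simp
  next
    fix p1 p2 p3 n1 n2 n3 p :: nat
    assume "prime p1" "prime p2" "prime p3" "p1 \<noteq> p2" "p1 \<noteq> p3" "p2 \<noteq> p3"
      "char_degree G \<psi> = p1 ^ n1 * p2 ^ n2 * p3 ^ n3" "p \<in> {p1, p2, p3}" and c: "has_normal_complement G p"
    note * = complement[OF this(1-8)]
    obtain N k where "N \<lhd> G" "\<not> p dvd card N" "card (rcosets\<^bsub>G\<^esub> N) = p ^ k"
      using c unfolding has_normal_complement_def by blast
    then show ?thesis by (rule *)
  next
    fix p1 p2 p3 n1 n2 n3 p :: nat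
    assume pr: "prime p1" "prime p2" "prime p3" "p1 \<noteq> p2" "p1 \<noteq> p3" "p2 \<noteq> p3"
      "char_degree G \<psi> = p1 ^ n1 * p2 ^ n2 * p3 ^ n3" "p \<in> {p1, p2, p3}"
      and nl: "\<forall>\<chi>\<in>(irr_chars G :: ('a \<Rightarrow> 'k) set). nonlinear_char G \<chi> \<longrightarrow> p dvd char_degree G \<chi>"
    have p: "prime p" using pr(1-3,8) by blast
    have nd: "n = 1 \<or> p dvd n" if \<rho>: "irreducible_rep G n \<rho>" for n and \<rho> :: "'a \<Rightarrow> 'k mat"
    proof -
      have "rep_character G \<rho> \<in> irr_chars G" using \<rho> by (auto simp: irr_chars_def)
      then have "n > 1 \<longrightarrow> p dvd n"
        using nl rep_character_degree[OF is_group \<rho>] by (auto simp: nonlinear_char_def)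
      moreover have "n > 0" using \<rho> by (simp add: irreducible_rep_iff)
      ultimately show ?thesis by linarith
    qed
    show ?thesis
    proof (rule thompson_normal_complement[OF fin p])
      show "n = 1 \<or> p dvd n" if "irreducible_rep G n \<rho>" for n and \<rho> :: "'a \<Rightarrow> 'k mat"
        using that by (rule nd)
      show "solvable G" if "N \<lhd> G" "\<not> p dvd card N" "card (rcosets\<^bsub>G\<^esub> N) = p ^ k" for N k
        using that by (rule complement[OF pr])
    qed
  qed
qed

end
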